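(* Let $G=O(p,q)$ (with $p+q=2n+1$) or $Sp_{2n}(\mathbb{R})$, and let $X$ be a Harish-Chandra module of $G$. The type $B/C$ Brauer (VW-) algebra $\mathfrak B_k^\theta[m_0,m_1]$ acts on $X\otimes V^{\otimes k}$, by the formulas in the context, and this action commutes with the action of $K$ on $X\otimes V^{\otimes k}$.
   Context: Groups. $Sp_{2n}(\mathbb{R})$ preserves the form with matrix $\begin{bmatrix}0&I_n\\-I_n&0\end{bmatrix}$; $O(p,q)$ preserves $\mathrm{diag}(I_p,-I_q)$. $\mathfrak g$ is the complexified Lie algebra of $G$, $V$ the complexified defining matrix module. Let $\xi=\begin{bmatrix}0&iI_n\\-iI_n&0\end{bmatrix}$ (symplectic) or $\xi=\mathrm{diag}(I_p,-I_q)$ (orthogonal). Conjugation by $\xi$ is the Cartan involution; $K$ is its fixed group in $G$, a maximal compact subgroup. The algebra. $\mathfrak B_k^\theta[m_0,m_1]$ is generated by $t_{i,i+1},e_{i,i+1}$ ($1\le i<k$), $z_i,\theta_i$ ($1\le i\le k$), subject to the following. The elements $t_{i,i+1},e_{i,i+1},z_i$ generate the VW-algebra $\mathfrak B_k[m_0]$: the $t_{i,i+1}$ generate $\mathbb C[S_k]$; $e_{i,i+1}^2=m_0e_{i,i+1}$; $t_{i,i+1}e_{i,i+1}=e_{i,i+1}t_{i,i+1}=e_{i,i+1}$; $t_{i,i+1}t_{i+1,i+2}e_{i,i+1}t_{i+1,i+2}t_{i,i+1}=e_{i+1,i+2}$; $[t_{i,i+1},e_{j,j+1}]=0$ for $j\ne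 i,i+1$ (these define the Brauer algebra $B_k[m_0]$); as a vector space $\mathfrak B_k[m_0]\cong B_k[m_0]\otimes S(U)$ with $U$ spanned by a basis $z_1,\dots,z_k$; $t_{i,i+1}z_i-z_{i+1}t_{i,i+1}=1+e_{i,i+1}$; $[t_{i,i+1},z_j]=[e_{i,i+1},z_j]=0$ for $j\ne i,i+1$; $e_{i,i+1}(z_i+z_{i+1})=0=(z_i+z_{i+1})e_{i,i+1}$; $[z_i,z_j]=0$; $e_{12}z_1^le_{12}=w_le_{12}$ for constants $w_l\in\mathbb C$. Further: the $t_{i,i+1}$ and $\theta_j$ generate a copy of the group algebra $\mathbb C[W(B_k)]$ of the $k$-th hyperoctahedral group; $[e_{i,i+1},\theta_j]=0$ for all $j$; $e_{i,i+1}\theta_i\theta_{i+1}=e_{i,i+1}=\theta_i\theta_{i+1}e_{i,i+1}$; $[\theta_k,z_j]=0$ for $j\ne k$; $e_{i,i+1}\theta_ie_{i,i+1}=m_1e_{i,i+1}$. The parameters are $(m_0,m_1)=(\lfloor\frac{p+q}2\rfloor,p-q)$ for $O(p,q)$ and $(-n,0)$ for $Sp_{2n}(\mathbb R)$. The action. Tensor factors of $X\otimes V^{\otimes k}$ are numbered $0$ (for $X$), $1,\dots,k$; $(g)_i$ is $g$ acting on the $i$-th factor; $\Omega_{ij}=\sum_{b\in B}(b)_i(b^* )_j$ for a basis $B$ of $\mathfrak g$ and dual basis $b\mapsto b^*$ for the Killing form. Then $z_i$ acts by $\sum_{0\le j<i}\Omega_{ji}$, $t_{i,i+1}$ by the flip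 of factors $i,i+1$, $\theta_i$ by $(\xi)_i$, and $e_{i,i+1}$ by $m_0$ times the projection of factors $i,i+1$ onto the trivial $\mathfrak g$-submodule of $V\otimes V$.
   Formalization: Corrected: m0=p+q (O), -2n (Sp); tz_i-z_{i+1}t=1-e; [t_i,e_j]=0 only for |i-j|>1, [e_i,θ_j]=0 for j≠i,i+1; tangle relations added; Sp: t=-flip, eθθ=θθe=-e; z_i=2(2-m0)ΣΩ+(1-m0)/2; w_l central in U(g), constants if X has an infinitesimal character. *)

theory Defs
  imports "HOL-Analysis.Analysis" "HOL-Library.Function_Algebras"
begin

section \<open>Algebras given by generators and relations\<close>

text \<open>
  Elements of the unital associative complex algebra presented by a set of generators and a
  set R of relations (pairs of terms) are terms modulo the congruence \<open>alg_cong R\<close>.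
\<close>

datatype 'g alg_term =
    Gen 'g
  | Scalar complex
  | Plus "'g alg_term" "'g alg_term"  (infixl "\<boxplus>" 65)
  | Times "'g alg_term" "'g alg_term"  (infixl "\<boxdot>" 70)

abbreviation Minus :: "'g alg_term \<Rightarrow> 'g alg_term \<Rightarrow> 'g alg_term"  (infixl "\<boxminus>" 65)
  where "a \<boxminus> b \<equiv> a \<boxplus> Scalar (-1) \<boxdot> b"

primrec Power :: "'g alg_term \<Rightarrow> nat \<Rightarrow> 'g alg_term"  (infixr "\<up>" 80)
  where
    "a \<up> 0 = Scalar 1"
  | "a \<up> Suc l = a \<boxdot> a \<up> l"

inductive alg_cong :: "('g alg_term \<times> 'g alg_term) set \<Rightarrow> 'g alg_term \<Rightarrow> 'g alg_term \<Rightarrow> bool"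
  for R
  where
    rel: "(a, b) \<in> R \<Longrightarrow> alg_cong R a b"
  | refl: "alg_cong R a a"
  | sym: "alg_cong R a b \<Longrightarrow> alg_cong R b a"
  | trans: "alg_cong R a b \<Longrightarrow> alg_cong R b c \<Longrightarrow> alg_cong R a c"
  | plus: "alg_cong R a a' \<Longrightarrow> alg_cong R b b' \<Longrightarrow> alg_cong R (a \<boxplus> b) (a' \<boxplus> b')"
  | times: "alg_cong R a a' \<Longrightarrow> alg_cong R b b' \<Longrightarrow> alg_cong R (a \<boxdot> b) (a' \<boxdot> b')"
  | plus_assoc: "alg_cong R (a \<boxplus> b \<boxplus> c) (a \<boxplus> (b \<boxplus> c))"
  | plus_commute: "alg_cong R (a \<boxplus> b) (b \<boxplus> a)"
  | plus_zero: "alg_cong R (Scalar 0 \<boxplus> a) a"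
  | times_assoc: "alg_cong R (a \<boxdot> b \<boxdot> c) (a \<boxdot> (b \<boxdot> c))"
  | distrib_left: "alg_cong R (a \<boxdot> (b \<boxplus> c)) (a \<boxdot> b \<boxplus> a \<boxdot> c)"
  | distrib_right: "alg_cong R ((a \<boxplus> b) \<boxdot> c) (a \<boxdot> c \<boxplus> b \<boxdot> c)"
  | times_zero: "alg_cong R (Scalar 0 \<boxdot> a) (Scalar 0)"
  | times_one: "alg_cong R (Scalar 1 \<boxdot> a) a"
  | scalar_plus: "alg_cong R (Scalar c \<boxplus> Scalar d) (Scalar (c + d))"
  | scalar_times: "alg_cong R (Scalar c \<boxdot> Scalar d) (Scalar (c * d))"
  | scalar_central: "alg_cong R (Scalar c \<boxdot> a) (a \<boxdot> Scalar c)"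

definition terms_over :: "'g set \<Rightarrow> 'g alg_term set"
  where "terms_over gens = {a. set_alg_term a \<subseteq> gens}"

primrec eval_term ::
  "(complex \<Rightarrow> 't \<Rightarrow> 't) \<Rightarrow> ('g \<Rightarrow> 't \<Rightarrow> 't::ab_group_add) \<Rightarrow> 'g alg_term \<Rightarrow> 't \<Rightarrow> 't"
  where
    "eval_term sc \<phi> (Gen g) v = \<phi> g v"
  | "eval_term sc \<phi> (Scalar c) v = sc c v"
  | "eval_term sc \<phi> (a \<boxplus> b) v = eval_term sc \<phi> a v + eval_term sc \<phi> b v"
  | "eval_term sc \<phi> (a \<boxdot> b) v = eval_term sc \<phi> a (eval_term sc \<phi> b v)"

definition linear_on_subspace :: "(complex \<Rightarrow> 't \<Rightarrow> 't) \<Rightarrow> 't set \<Rightarrow> ('t \<Rightarrow> 't::ab_group_add) \<Rightarrow> bool"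
  where "linear_on_subspace sc T f \<longleftrightarrow>
    (\<forall>v\<in>T. f v \<in> T) \<and> (\<forall>v\<in>T. \<forall>w\<in>T. f (v + w) = f v + f w) \<and> (\<forall>c. \<forall>v\<in>T. f (sc c v) = sc c (f v))"

text \<open>
  The assignment \<open>\<phi>\<close> of operators to generators defines an action on the subspace T of the
  algebra presented by \<open>gens\<close> and R.
\<close>

definition acts_by ::
  "'g set \<Rightarrow> ('g alg_term \<times> 'g alg_term) set \<Rightarrow> (complex \<Rightarrow> 't \<Rightarrow> 't) \<Rightarrow> 't set \<Rightarrow>
    ('g \<Rightarrow> 't \<Rightarrow> 't::ab_group_add) \<Rightarrow> bool"
  where "acts_by gens R sc T \<phi> \<longleftrightarrow>
    (\<forall>g\<in>gens. linear_on_subspace sc T (\<phi> g)) \<and>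
    (\<forall>a\<in>terms_over gens. \<forall>b\<in>terms_over gens. alg_cong R a b \<longrightarrow>
      (\<forall>v\<in>T. eval_term sc \<phi> a v = eval_term sc \<phi> b v))"


section \<open>The type B/C affine Brauer (VW-) algebra\<close>

datatype bvw_gen =
    T nat   \<comment> \<open>\<open>t\<^sub>i\<^sub>,\<^sub>i\<^sub>+\<^sub>1\<close>\<close>
  | E nat   \<comment> \<open>\<open>e\<^sub>i\<^sub>,\<^sub>i\<^sub>+\<^sub>1\<close>\<close>
  | Z nat   \<comment> \<open>\<open>z\<^sub>i\<close>\<close>
  | Th nat  \<comment> \<open>\<open>\<theta>\<^sub>i\<close>\<close>
  | W nat   \<comment> \<open>the parameter \<open>w\<^sub>l\<close>, when it is not a constant\<close>

abbreviation "tt i \<equiv> Gen (T i)"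
abbreviation "ee i \<equiv> Gen (E i)"
abbreviation "zz i \<equiv> Gen (Z i)"
abbreviation "th i \<equiv> Gen (Th i)"
abbreviation "ww l \<equiv> Gen (W l)"

definition bvw_gens :: "nat \<Rightarrow> bvw_gen set"
  where "bvw_gens k = T ` {1..<k} \<union> E ` {1..<k} \<union> Z ` {1..k} \<union> Th ` {1..k}"

inductive_set symmetric_rels :: "nat \<Rightarrow> (bvw_gen alg_term \<times> bvw_gen alg_term) set"
  for k
  where
    t_square: "i \<in> {1..<k} \<Longrightarrow> (tt i \<boxdot> tt i, Scalar 1) \<in> symmetric_rels k"
  | t_braid: "\<lbrakk>i \<in> {1..<k}; i + 1 \<in> {1..<k}\<rbrakk> \<Longrightarrow>
      (tt i \<boxdot> tt (i+1) \<boxdot> tt i, tt (i+1) \<boxdot> tt i \<boxdot> tt (i+1)) \<in> symmetric_rels k"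
  | t_t: "\<lbrakk>i \<in> {1..<k}; j \<in> {1..<k}; i + 1 < j\<rbrakk> \<Longrightarrow> (tt i \<boxdot> tt j, tt j \<boxdot> tt i) \<in> symmetric_rels k"

text \<open>
  The Brauer algebra, with the tangle relations, which make it the algebra of Brauer diagrams
  with loop parameter \<open>m\<^sub>0\<close>. Since \<open>t\<^sub>i\<^sub>,\<^sub>i\<^sub>+\<^sub>1\<close> and \<open>e\<^sub>j\<^sub>,\<^sub>j\<^sub>+\<^sub>1\<close> do not commute for
  \<open>\<bar>i - j\<bar> = 1\<close>, the commutation relations are those for \<open>\<bar>i - j\<bar> \<ge> 2\<close>.
\<close>

inductive_set brauer_rels :: "nat \<Rightarrow> complex \<Rightarrow> (bvw_gen alg_term \<times> bvw_gen alg_term) set"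
  for k m0
  where
    symmetric: "r \<in> symmetric_rels k \<Longrightarrow> r \<in> brauer_rels k m0"
  | e_square: "i \<in> {1..<k} \<Longrightarrow> (ee i \<boxdot> ee i, Scalar m0 \<boxdot> ee i) \<in> brauer_rels k m0"
  | t_e: "i \<in> {1..<k} \<Longrightarrow> (tt i \<boxdot> ee i, ee i) \<in> brauer_rels k m0"
  | e_t: "i \<in> {1..<k} \<Longrightarrow> (ee i \<boxdot> tt i, ee i) \<in> brauer_rels k m0"
  | conjugate: "\<lbrakk>i \<in> {1..<k}; i + 1 \<in> {1..<k}\<rbrakk> \<Longrightarrow>
      (tt i \<boxdot> tt (i+1) \<boxdot> ee i \<boxdot> tt (i+1) \<boxdot> tt i, ee (i+1)) \<in> brauer_rels k m0"
  | t_e_commute: "\<lbrakk>i \<in> {1..<k}; j \<in> {1..<k}; i + 1 < j \<or> j + 1 < i\<rbrakk> \<Longrightarrow>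
      (tt i \<boxdot> ee j, ee j \<boxdot> tt i) \<in> brauer_rels k m0"
  | e_e_commute: "\<lbrakk>i \<in> {1..<k}; j \<in> {1..<k}; i + 1 < j\<rbrakk> \<Longrightarrow>
      (ee i \<boxdot> ee j, ee j \<boxdot> ee i) \<in> brauer_rels k m0"
  | tangle: "\<lbrakk>i \<in> {1..<k}; j \<in> {1..<k}; j = i + 1 \<or> i = j + 1\<rbrakk> \<Longrightarrow>
      (ee i \<boxdot> ee j \<boxdot> ee i, ee i) \<in> brauer_rels k m0"
  | tangle_left: "\<lbrakk>i \<in> {1..<k}; j \<in> {1..<k}; j = i + 1 \<or> i = j + 1\<rbrakk> \<Longrightarrow>
      (tt i \<boxdot> ee j \<boxdot> ee i, tt j \<boxdot> ee i) \<in> brauer_rels k m0"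
  | tangle_right: "\<lbrakk>i \<in> {1..<k}; j \<in> {1..<k}; j = i + 1 \<or> i = j + 1\<rbrakk> \<Longrightarrow>
      (ee i \<boxdot> ee j \<boxdot> tt i, ee i \<boxdot> tt j) \<in> brauer_rels k m0"

text \<open>
  The term \<open>w l\<close> stands for the parameter \<open>w\<^sub>l\<close>. The sign in \<open>t z\<^sub>i - z\<^sub>i\<^sub>+\<^sub>1 t = 1 - e\<close> is the
  one compatible with a positive tangle relation \<open>e\<^sub>i e\<^sub>i\<^sub>+\<^sub>1 e\<^sub>i = e\<^sub>i\<close> and the operators below.
\<close>

inductive_set vw_rels ::
  "nat \<Rightarrow> complex \<Rightarrow> (nat \<Rightarrow> bvw_gen alg_term) \<Rightarrow> (bvw_gen alg_term \<times> bvw_gen alg_term) set"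
  for k m0 w
  where
    brauer: "r \<in> brauer_rels k m0 \<Longrightarrow> r \<in> vw_rels k m0 w"
  | t_z: "i \<in> {1..<k} \<Longrightarrow>
      (tt i \<boxdot> zz i \<boxminus> zz (i+1) \<boxdot> tt i, Scalar 1 \<boxminus> ee i) \<in> vw_rels k m0 w"
  | t_z_commute: "\<lbrakk>i \<in> {1..<k}; j \<in> {1..k}; j \<noteq> i; j \<noteq> i + 1\<rbrakk> \<Longrightarrow>
      (tt i \<boxdot> zz j, zz j \<boxdot> tt i) \<in> vw_rels k m0 w"
  | e_z_commute: "\<lbrakk>i \<in> {1..<k}; j \<in> {1..k}; j \<noteq> i; j \<noteq> i + 1\<rbrakk> \<Longrightarrow>
      (ee i \<boxdot> zz j, zz j \<boxdot> ee i) \<in> vw_rels k m0 w"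
  | e_z: "i \<in> {1..<k} \<Longrightarrow> (ee i \<boxdot> (zz i \<boxplus> zz (i+1)), Scalar 0) \<in> vw_rels k m0 w"
  | z_e: "i \<in> {1..<k} \<Longrightarrow> ((zz i \<boxplus> zz (i+1)) \<boxdot> ee i, Scalar 0) \<in> vw_rels k m0 w"
  | z_z: "\<lbrakk>i \<in> {1..k}; j \<in> {1..k}\<rbrakk> \<Longrightarrow> (zz i \<boxdot> zz j, zz j \<boxdot> zz i) \<in> vw_rels k m0 w"
  | e_z_e: "2 \<le> k \<Longrightarrow> (ee 1 \<boxdot> zz 1 \<up> l \<boxdot> ee 1, w l \<boxdot> ee 1) \<in> vw_rels k m0 w"

text \<open>
  The sign \<open>\<epsilon>\<close> is 1 for an invariant form that \<open>\<xi>\<close> preserves, and -1 for one that \<open>\<xi>\<close>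
  negates (the symplectic case). The commutator \<open>[e\<^sub>i\<^sub>,\<^sub>i\<^sub>+\<^sub>1, \<theta>\<^sub>j]\<close> vanishes only for
  \<open>j \<noteq> i, i+1\<close>.
\<close>

inductive_set bvw_rels ::
  "nat \<Rightarrow> complex \<Rightarrow> complex \<Rightarrow> complex \<Rightarrow> (nat \<Rightarrow> bvw_gen alg_term) \<Rightarrow>
    (bvw_gen alg_term \<times> bvw_gen alg_term) set"
  for k m0 m1 \<epsilon> w
  where
    vw: "r \<in> vw_rels k m0 w \<Longrightarrow> r \<in> bvw_rels k m0 m1 \<epsilon> w"
  | th_square: "i \<in> {1..k} \<Longrightarrow> (th i \<boxdot> th i, Scalar 1) \<in> bvw_rels k m0 m1 \<epsilon> w"
  | th_th: "\<lbrakk>i \<in> {1..k}; j \<in> {1..k}\<rbrakk> \<Longrightarrow> (th i \<boxdot> th j, th j \<boxdot> th i) \<in> bvw_rels k m0 m1 \<epsilon> w"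
  | t_th: "i \<in> {1..<k} \<Longrightarrow> (tt i \<boxdot> th i \<boxdot> tt i, th (i+1)) \<in> bvw_rels k m0 m1 \<epsilon> w"
  | t_th_commute: "\<lbrakk>i \<in> {1..<k}; j \<in> {1..k}; j \<noteq> i; j \<noteq> i + 1\<rbrakk> \<Longrightarrow>
      (tt i \<boxdot> th j, th j \<boxdot> tt i) \<in> bvw_rels k m0 m1 \<epsilon> w"
  | e_th_commute: "\<lbrakk>i \<in> {1..<k}; j \<in> {1..k}; j \<noteq> i; j \<noteq> i + 1\<rbrakk> \<Longrightarrow>
      (ee i \<boxdot> th j, th j \<boxdot> ee i) \<in> bvw_rels k m0 m1 \<epsilon> w"
  | e_th_th: "i \<in> {1..<k} \<Longrightarrow>
      (ee i \<boxdot> th i \<boxdot> th (i+1), Scalar \<epsilon> \<boxdot> ee i) \<in> bvw_rels k m0 m1 \<epsilon> w"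
  | th_th_e: "i \<in> {1..<k} \<Longrightarrow>
      (th i \<boxdot> th (i+1) \<boxdot> ee i, Scalar \<epsilon> \<boxdot> ee i) \<in> bvw_rels k m0 m1 \<epsilon> w"
  | th_z: "\<lbrakk>j \<in> {1..k}; j \<noteq> k\<rbrakk> \<Longrightarrow> (th k \<boxdot> zz j, zz j \<boxdot> th k) \<in> bvw_rels k m0 m1 \<epsilon> w"
  | e_th_e: "i \<in> {1..<k} \<Longrightarrow>
      (ee i \<boxdot> th i \<boxdot> ee i, Scalar m1 \<boxdot> ee i) \<in> bvw_rels k m0 m1 \<epsilon> w"

text \<open>
  In the generic algebra the \<open>w\<^sub>l\<close> are central elements; specialising them to complex numbers
  \<open>c l\<close> gives the algebra with constants \<open>w\<^sub>l\<close>.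
\<close>

definition generic_bvw_gens :: "nat \<Rightarrow> bvw_gen set"
  where "generic_bvw_gens k = bvw_gens k \<union> range W"

definition generic_bvw_rels ::
  "nat \<Rightarrow> complex \<Rightarrow> complex \<Rightarrow> complex \<Rightarrow> (bvw_gen alg_term \<times> bvw_gen alg_term) set"
  where "generic_bvw_rels k m0 m1 \<epsilon> = bvw_rels k m0 m1 \<epsilon> ww \<union>
    {(ww l \<boxdot> Gen g, Gen g \<boxdot> ww l) | l g. g \<in> generic_bvw_gens k}"

definition constant_bvw_rels ::
  "nat \<Rightarrow> complex \<Rightarrow> complex \<Rightarrow> complex \<Rightarrow> (nat \<Rightarrow> complex) \<Rightarrow> (bvw_gen alg_term \<times> bvw_gen alg_term) set"
  where "constant_bvw_rels k m0 m1 \<epsilon> c = bvw_rels k m0 m1 \<epsilon> (\<lambda>l. Scalar (c l))"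


section \<open>The groups\<close>

datatype real_form = Orth nat nat | Symp nat

fun form_dim :: "real_form \<Rightarrow> nat"
  where
    "form_dim (Orth p q) = p + q"
  | "form_dim (Symp n) = 2 * n"

type_synonym 'i cmatrix = "complex^'i^'i"
type_synonym 'i rmatrix = "real^'i^'i"

definition pos :: "'i::{finite,linorder} \<Rightarrow> nat"
  where "pos a = card {b. b < a}"

text \<open>The matrices \<open>diag(I\<^sub>p, -I\<^sub>q)\<close> and \<open>[0, I\<^sub>n; -I\<^sub>n, 0]\<close>, for an index type of size \<open>form_dim G\<close>.\<close>

fun form_matrix :: "real_form \<Rightarrow> 'i::{finite,linorder} rmatrix"
  where
    "form_matrix (Orth p q) = (\<chi> a b. if a = b then if pos a < p then 1 else -1 else 0)"
  | "form_matrix (Symp n) =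
      (\<chi> a b. if pos b = pos a + n then 1 else if pos a = pos b + n then -1 else 0)"

definition cmat :: "'i::finite rmatrix \<Rightarrow> 'i cmatrix"
  where "cmat A = (\<chi> a b. complex_of_real (A $ a $ b))"

definition mscale :: "complex \<Rightarrow> 'i::finite cmatrix \<Rightarrow> 'i cmatrix"
  where "mscale c A = (\<chi> a b. c * A $ a $ b)"

fun xi :: "real_form \<Rightarrow> 'i::{finite,linorder} cmatrix"
  where
    "xi (Orth p q) = cmat (form_matrix (Orth p q))"
  | "xi (Symp n) = mscale \<i> (cmat (form_matrix (Symp n)))"

definition real_group :: "real_form \<Rightarrow> 'i::{finite,linorder} rmatrix set"
  where "real_group G = {g. transpose g ** form_matrix G ** g = form_matrix G}"

definition max_compact :: "real_form \<Rightarrow> 'i::{finite,linorder} rmatrix set"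
  where "max_compact G = {g \<in> real_group G. xi G ** cmat g ** matrix_inv (xi G) = cmat g}"

definition real_lie_algebra :: "real_form \<Rightarrow> 'i::{finite,linorder} rmatrix set"
  where "real_lie_algebra G = {A. transpose A ** form_matrix G + form_matrix G ** A = 0}"

definition lie_algebra :: "real_form \<Rightarrow> 'i::{finite,linorder} cmatrix set"
  where "lie_algebra G =
    {cmat A + mscale \<i> (cmat B) | A B. A \<in> real_lie_algebra G \<and> B \<in> real_lie_algebra G}"

definition bracket :: "'i::finite cmatrix \<Rightarrow> 'i cmatrix \<Rightarrow> 'i cmatrix"
  where "bracket A B = A ** B - B ** A"

definition basis_of :: "('a::field \<Rightarrow> 'b::ab_group_add \<Rightarrow> 'b) \<Rightarrow> 'b set \<Rightarrow> 'b set \<Rightarrow> bool"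
  where "basis_of s S B \<longleftrightarrow> \<not> module.dependent s B \<and> module.span s B = S"

definition trace_on :: "('a::field \<Rightarrow> 'b::ab_group_add \<Rightarrow> 'b) \<Rightarrow> 'b set \<Rightarrow> ('b \<Rightarrow> 'b) \<Rightarrow> 'a"
  where "trace_on s S f =
    (let B = (SOME B. basis_of s S B) in \<Sum>b\<in>B. module.representation s B (f b) b)"

definition killing :: "'i::finite cmatrix set \<Rightarrow> 'i cmatrix \<Rightarrow> 'i cmatrix \<Rightarrow> complex"
  where "killing \<gg> A B = trace_on mscale \<gg> (\<lambda>C. bracket A (bracket B C))"

definition killing_dual :: "'i::finite cmatrix set \<Rightarrow> 'i cmatrix set \<Rightarrow> 'i cmatrix \<Rightarrow> 'i cmatrix"
  where "killing_dual \<gg> B b =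
    (THE d. d \<in> \<gg> \<and> (\<forall>b'\<in>B. killing \<gg> b' d = (if b' = b then 1 else 0)))"


section \<open>The enveloping algebra and Harish-Chandra modules\<close>

definition env_rels ::
  "'i::finite cmatrix set \<Rightarrow> ('i cmatrix alg_term \<times> 'i cmatrix alg_term) set"
  where "env_rels \<gg> =
    {(Gen (A + B), Gen A \<boxplus> Gen B) | A B. A \<in> \<gg> \<and> B \<in> \<gg>} \<union>
    {(Gen (mscale c A), Scalar c \<boxdot> Gen A) | c A. A \<in> \<gg>} \<union>
    {(Gen (bracket A B), Gen A \<boxdot> Gen B \<boxminus> Gen B \<boxdot> Gen A) | A B. A \<in> \<gg> \<and> B \<in> \<gg>}"

definition env_centre :: "'i::finite cmatrix set \<Rightarrow> 'i cmatrix alg_term set"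
  where "env_centre \<gg> = {u \<in> terms_over \<gg>. \<forall>a\<in>terms_over \<gg>. alg_cong (env_rels \<gg>) (u \<boxdot> a) (a \<boxdot> u)}"

definition lie_module ::
  "'i::finite cmatrix set \<Rightarrow> (complex \<Rightarrow> 'x \<Rightarrow> 'x) \<Rightarrow> ('i cmatrix \<Rightarrow> 'x \<Rightarrow> 'x::ab_group_add) \<Rightarrow> bool"
  where "lie_module \<gg> sc \<rho> \<longleftrightarrow>
    (\<forall>A\<in>\<gg>. Vector_Spaces.linear sc sc (\<rho> A)) \<and>
    (\<forall>A\<in>\<gg>. \<forall>B\<in>\<gg>. \<forall>x. \<rho> (A + B) x = \<rho> A x + \<rho> B x) \<and>
    (\<forall>A\<in>\<gg>. \<forall>c x. \<rho> (mscale c A) x = sc c (\<rho> A x)) \<and>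
    (\<forall>A\<in>\<gg>. \<forall>B\<in>\<gg>. \<forall>x. \<rho> (bracket A B) x = \<rho> A (\<rho> B x) - \<rho> B (\<rho> A x))"

definition group_rep ::
  "'i::finite rmatrix set \<Rightarrow> (complex \<Rightarrow> 'x \<Rightarrow> 'x) \<Rightarrow> ('i rmatrix \<Rightarrow> 'x \<Rightarrow> 'x::ab_group_add) \<Rightarrow> bool"
  where "group_rep K sc \<sigma> \<longleftrightarrow>
    (\<forall>g\<in>K. Vector_Spaces.linear sc sc (\<sigma> g)) \<and>
    (\<forall>x. \<sigma> (mat 1) x = x) \<and>
    (\<forall>g\<in>K. \<forall>h\<in>K. \<forall>x. \<sigma> (g ** h) x = \<sigma> g (\<sigma> h x))"

text \<open>
  Every vector lies in a finite-dimensional K-stable space on which K acts continuously, with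
  differential \<open>\<rho>\<close>: the orbit map of x has continuous coordinates \<open>c j\<close> with respect to finitely
  many vectors \<open>b j\<close>, and its derivative along a curve in K through the identity with velocity A
  is \<open>\<rho> A x\<close>.
\<close>

definition K_finite_integrable ::
  "'i::finite rmatrix set \<Rightarrow> (complex \<Rightarrow> 'x \<Rightarrow> 'x) \<Rightarrow> ('i cmatrix \<Rightarrow> 'x \<Rightarrow> 'x::ab_group_add) \<Rightarrow>
    ('i rmatrix \<Rightarrow> 'x \<Rightarrow> 'x) \<Rightarrow> bool"
  where "K_finite_integrable K sc \<rho> \<sigma> \<longleftrightarrow> (\<forall>x. \<exists>(m::nat) b c.
    (\<forall>g\<in>K. \<sigma> g x = (\<Sum>j<m. sc (c j g) (b j))) \<and>
    (\<forall>j<m. continuous_on K (c j)) \<and>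
    (\<forall>\<gamma> A. \<gamma> (0::real) = mat 1 \<and> range \<gamma> \<subseteq> K \<and> (\<gamma> has_vector_derivative A) (at 0) \<longrightarrow>
      (\<exists>d. (\<forall>j<m. ((\<lambda>s. c j (\<gamma> s)) has_vector_derivative d j) (at 0)) \<and>
        \<rho> (cmat A) x = (\<Sum>j<m. sc (d j) (b j)))))"

definition gK_module ::
  "real_form \<Rightarrow> (complex \<Rightarrow> 'x \<Rightarrow> 'x) \<Rightarrow> ('i::{finite,linorder} cmatrix \<Rightarrow> 'x \<Rightarrow> 'x::ab_group_add) \<Rightarrow>
    ('i rmatrix \<Rightarrow> 'x \<Rightarrow> 'x) \<Rightarrow> bool"
  where "gK_module G sc \<rho> \<sigma> \<longleftrightarrow>
    vector_space sc \<and>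
    lie_module (lie_algebra G) sc \<rho> \<and>
    group_rep (max_compact G) sc \<sigma> \<and>
    (\<forall>g\<in>max_compact G. \<forall>A\<in>lie_algebra G. \<forall>x.
      \<sigma> g (\<rho> A x) = \<rho> (cmat g ** A ** matrix_inv (cmat g)) (\<sigma> g x)) \<and>
    K_finite_integrable (max_compact G) sc \<rho> \<sigma>"

definition K_subspace ::
  "'i::finite rmatrix set \<Rightarrow> (complex \<Rightarrow> 'x \<Rightarrow> 'x) \<Rightarrow> ('i rmatrix \<Rightarrow> 'x \<Rightarrow> 'x::ab_group_add) \<Rightarrow> 'x set \<Rightarrow> bool"
  where "K_subspace K sc \<sigma> S \<longleftrightarrow> module.subspace sc S \<and> (\<forall>g\<in>K. \<forall>x\<in>S. \<sigma> g x \<in> S)"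

definition K_irreducible ::
  "'i::finite rmatrix set \<Rightarrow> (complex \<Rightarrow> 'x \<Rightarrow> 'x) \<Rightarrow> ('i rmatrix \<Rightarrow> 'x \<Rightarrow> 'x::ab_group_add) \<Rightarrow> 'x set \<Rightarrow> bool"
  where "K_irreducible K sc \<sigma> S \<longleftrightarrow>
    K_subspace K sc \<sigma> S \<and> S \<noteq> {0} \<and> (\<forall>S'\<subseteq>S. K_subspace K sc \<sigma> S' \<longrightarrow> S' = {0} \<or> S' = S)"

definition K_isomorphic ::
  "'i::finite rmatrix set \<Rightarrow> (complex \<Rightarrow> 'x \<Rightarrow> 'x) \<Rightarrow> ('i rmatrix \<Rightarrow> 'x \<Rightarrow> 'x::ab_group_add) \<Rightarrow>
    'x set \<Rightarrow> 'x set \<Rightarrow> bool"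
  where "K_isomorphic K sc \<sigma> S S' \<longleftrightarrow> (\<exists>f. bij_betw f S S' \<and>
    (\<forall>x\<in>S. \<forall>y\<in>S. f (x + y) = f x + f y) \<and> (\<forall>c. \<forall>x\<in>S. f (sc c x) = sc c (f x)) \<and>
    (\<forall>g\<in>K. \<forall>x\<in>S. f (\<sigma> g x) = \<sigma> g (f x)))"

text \<open>Admissibility: all K-isotypic components are finite-dimensional.\<close>

definition admissible ::
  "'i::finite rmatrix set \<Rightarrow> (complex \<Rightarrow> 'x \<Rightarrow> 'x) \<Rightarrow> ('i rmatrix \<Rightarrow> 'x \<Rightarrow> 'x::ab_group_add) \<Rightarrow> bool"
  where "admissible K sc \<sigma> \<longleftrightarrow> (\<forall>S. K_irreducible K sc \<sigma> S \<longrightarrow>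
    (\<exists>F. finite F \<and>
      \<Union>{S'. K_subspace K sc \<sigma> S' \<and> K_isomorphic K sc \<sigma> S S'} \<subseteq> module.span sc F))"

definition finitely_generated ::
  "'i::finite cmatrix set \<Rightarrow> (complex \<Rightarrow> 'x \<Rightarrow> 'x) \<Rightarrow> ('i cmatrix \<Rightarrow> 'x \<Rightarrow> 'x::ab_group_add) \<Rightarrow> bool"
  where "finitely_generated \<gg> sc \<rho> \<longleftrightarrow> (\<exists>F. finite F \<and>
    (\<forall>S. module.subspace sc S \<and> F \<subseteq> S \<and> (\<forall>A\<in>\<gg>. \<forall>x\<in>S. \<rho> A x \<in> S) \<longrightarrow> S = UNIV))"

definition harish_chandra_module ::
  "real_form \<Rightarrow> (complex \<Rightarrow> 'x \<Rightarrow> 'x) \<Rightarrow> ('i::{finite,linorder} cmatrix \<Rightarrow> 'x \<Rightarrow> 'x::ab_group_add) \<Rightarrow>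
    ('i rmatrix \<Rightarrow> 'x \<Rightarrow> 'x) \<Rightarrow> bool"
  where "harish_chandra_module G sc \<rho> \<sigma> \<longleftrightarrow>
    gK_module G sc \<rho> \<sigma> \<and> admissible (max_compact G) sc \<sigma> \<and> finitely_generated (lie_algebra G) sc \<rho>"

definition infinitesimal_character ::
  "'i::finite cmatrix set \<Rightarrow> (complex \<Rightarrow> 'x \<Rightarrow> 'x) \<Rightarrow> ('i cmatrix \<Rightarrow> 'x \<Rightarrow> 'x::ab_group_add) \<Rightarrow>
    ('i cmatrix alg_term \<Rightarrow> complex) \<Rightarrow> bool"
  where "infinitesimal_character \<gg> sc \<rho> \<eta> \<longleftrightarrow> (\<forall>u\<in>env_centre \<gg>. \<forall>x. eval_term sc \<rho> u x = sc (\<eta> u) x)"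


section \<open>The space \<open>X \<otimes> V\<^sup>\<otimes>\<^sup>k\<close> and the operators on it\<close>

text \<open>
  With \<open>V\<close> the space of column vectors indexed by \<open>'i\<close>, an element f of \<open>X \<otimes> V\<^sup>\<otimes>\<^sup>k\<close> is given by its
  coefficients \<open>f w\<close> in \<open>X\<close> at \<open>e\<^bsub>w 1\<^esub> \<otimes> \<dots> \<otimes> e\<^bsub>w k\<^esub>\<close>. An element of \<open>V \<otimes> V\<close> is the matrix of its
  coefficients.
\<close>

definition words :: "nat \<Rightarrow> (nat \<Rightarrow> 'i) set"
  where "words k = {1..k} \<rightarrow>\<^sub>E UNIV"

definition tensors :: "nat \<Rightarrow> ((nat \<Rightarrow> 'i) \<Rightarrow> 'x::ab_group_add) set"
  where "tensors k = {f. \<forall>w. w \<notin> words k \<longrightarrow> f w = 0}"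

definition tscale :: "(complex \<Rightarrow> 'x \<Rightarrow> 'x) \<Rightarrow> complex \<Rightarrow> ((nat \<Rightarrow> 'i) \<Rightarrow> 'x) \<Rightarrow> (nat \<Rightarrow> 'i) \<Rightarrow> 'x"
  where "tscale sc c f = (\<lambda>w. sc c (f w))"

definition at_factor ::
  "(complex \<Rightarrow> 'x \<Rightarrow> 'x) \<Rightarrow> ('i::finite cmatrix \<Rightarrow> 'x \<Rightarrow> 'x::ab_group_add) \<Rightarrow> 'i cmatrix \<Rightarrow> nat \<Rightarrow>
    ((nat \<Rightarrow> 'i) \<Rightarrow> 'x) \<Rightarrow> (nat \<Rightarrow> 'i) \<Rightarrow> 'x"
  where "at_factor sc \<rho> A i f =
    (\<lambda>w. if i = 0 then \<rho> A (f w) else (\<Sum>b\<in>UNIV. sc (A $ w i $ b) (f (w(i := b)))))"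

definition at_pair ::
  "(complex \<Rightarrow> 'x \<Rightarrow> 'x) \<Rightarrow> ('i::finite cmatrix \<Rightarrow> 'i cmatrix) \<Rightarrow> nat \<Rightarrow> nat \<Rightarrow>
    ((nat \<Rightarrow> 'i) \<Rightarrow> 'x) \<Rightarrow> (nat \<Rightarrow> 'i) \<Rightarrow> 'x::ab_group_add"
  where "at_pair sc P i j f = (\<lambda>w. \<Sum>a\<in>UNIV. \<Sum>b\<in>UNIV.
    sc (P (\<chi> c d. if c = a \<and> d = b then 1 else 0) $ w i $ w j) (f (w(i := a, j := b))))"

definition flip :: "nat \<Rightarrow> nat \<Rightarrow> ((nat \<Rightarrow> 'i) \<Rightarrow> 'x) \<Rightarrow> (nat \<Rightarrow> 'i) \<Rightarrow> 'x"
  where "flip i j f = (\<lambda>w. f (w(i := w j, j := w i)))"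

definition omega ::
  "real_form \<Rightarrow> (complex \<Rightarrow> 'x \<Rightarrow> 'x) \<Rightarrow> ('i::{finite,linorder} cmatrix \<Rightarrow> 'x \<Rightarrow> 'x::ab_group_add) \<Rightarrow>
    'i cmatrix set \<Rightarrow> nat \<Rightarrow> nat \<Rightarrow> ((nat \<Rightarrow> 'i) \<Rightarrow> 'x) \<Rightarrow> (nat \<Rightarrow> 'i) \<Rightarrow> 'x"
  where "omega G sc \<rho> B i j f =
    (\<Sum>b\<in>B. at_factor sc \<rho> b i (at_factor sc \<rho> (killing_dual (lie_algebra G) B b) j f))"

definition lie_on_VV :: "'i::finite cmatrix \<Rightarrow> 'i cmatrix \<Rightarrow> 'i cmatrix"
  where "lie_on_VV A u = A ** u + u ** transpose A"

definition trivial_submodule :: "'i::finite cmatrix set \<Rightarrow> 'i cmatrix set"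
  where "trivial_submodule \<gg> = {u. \<forall>A\<in>\<gg>. lie_on_VV A u = 0}"

definition trivial_projection :: "'i::finite cmatrix set \<Rightarrow> 'i cmatrix \<Rightarrow> 'i cmatrix"
  where "trivial_projection \<gg> = (THE P. Vector_Spaces.linear mscale mscale P \<and>
    range P = trivial_submodule \<gg> \<and> (\<forall>u. P (P u) = P u) \<and>
    (\<forall>A\<in>\<gg>. \<forall>u. P (lie_on_VV A u) = lie_on_VV A (P u)))"

fun form_sign :: "real_form \<Rightarrow> complex"
  where
    "form_sign (Orth p q) = 1"
  | "form_sign (Symp n) = -1"

text \<open>The parameters: the superdimension of \<open>V\<close> (odd in the symplectic case) and the trace of \<open>\<xi>\<close>.\<close>

fun m0 :: "real_form \<Rightarrow> complex"
  where
    "m0 (Orth p q) = of_nat (p + q)"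
  | "m0 (Symp n) = - of_nat (2 * n)"

fun m1 :: "real_form \<Rightarrow> complex"
  where
    "m1 (Orth p q) = of_nat p - of_nat q"
  | "m1 (Symp n) = 0"

text \<open>
  In the symplectic case the flip carries a sign, because the invariants of \<open>V \<otimes> V\<close> are
  antisymmetric and \<open>te = e\<close>. On \<open>V \<otimes> V\<close> one has \<open>2 (m\<^sub>0 - 2) \<Omega>\<^sub>1\<^sub>2 = t - e\<close> for the Killing form;
  this gives the factor in front of \<open>\<Omega>\<close>, and the additive constant is forced by
  \<open>e\<^sub>i\<^sub>,\<^sub>i\<^sub>+\<^sub>1 (z\<^sub>i + z\<^sub>i\<^sub>+\<^sub>1) = 0\<close>. The parameter \<open>w\<^sub>l\<close> acts by \<open>u l\<close>, an element of the enveloping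
  algebra, on \<open>X\<close>.
\<close>

fun bvw_op ::
  "real_form \<Rightarrow> (complex \<Rightarrow> 'x \<Rightarrow> 'x) \<Rightarrow> ('i::{finite,linorder} cmatrix \<Rightarrow> 'x \<Rightarrow> 'x::ab_group_add) \<Rightarrow>
    'i cmatrix set \<Rightarrow> (nat \<Rightarrow> 'i cmatrix alg_term) \<Rightarrow>
    bvw_gen \<Rightarrow> ((nat \<Rightarrow> 'i) \<Rightarrow> 'x) \<Rightarrow> (nat \<Rightarrow> 'i) \<Rightarrow> 'x"
  where
    "bvw_op G sc \<rho> B u (T i) f = tscale sc (form_sign G) (flip i (i+1) f)"
  | "bvw_op G sc \<rho> B u (E i) f =
      tscale sc (m0 G) (at_pair sc (trivial_projection (lie_algebra G)) i (i+1) f)"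
  | "bvw_op G sc \<rho> B u (Z i) f =
      tscale sc (2 * (2 - m0 G)) (\<Sum>j<i. omega G sc \<rho> B j i f) + tscale sc ((1 - m0 G) / 2) f"
  | "bvw_op G sc \<rho> B u (Th i) f = at_factor sc \<rho> (xi G) i f"
  | "bvw_op G sc \<rho> B u (W l) f = (\<lambda>w. eval_term sc \<rho> (u l) (f w))"

definition K_op ::
  "(complex \<Rightarrow> 'x \<Rightarrow> 'x) \<Rightarrow> ('i::finite rmatrix \<Rightarrow> 'x \<Rightarrow> 'x::ab_group_add) \<Rightarrow> nat \<Rightarrow> 'i rmatrix \<Rightarrow>
    ((nat \<Rightarrow> 'i) \<Rightarrow> 'x) \<Rightarrow> (nat \<Rightarrow> 'i) \<Rightarrow> 'x"
  where "K_op sc \<sigma> k g f = (\<lambda>w. if w \<in> words k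
    then (\<Sum>v\<in>words k. sc (\<Prod>i=1..k. cmat g $ w i $ v i) (\<sigma> g (f v))) else 0)"

end

theory Submission
  imports Defs
begin

text \<open>
  All operators on \<open>X \<otimes> V\<^sup>\<otimes>\<^sup>k\<close> are built from the operators \<open>(A)\<^sub>i\<close>. With matrix units \<open>E\<^sub>a\<^sub>b\<close> and \<open>A\<^sup>*\<close> the
  adjoint for the form, the flip is \<open>\<Sum> (E\<^sub>a\<^sub>b)\<^sub>i (E\<^sub>b\<^sub>a)\<^sub>j\<close>, the contraction is
  \<open>\<Sum> (E\<^sub>a\<^sub>b\<^sup>*)\<^sub>i (E\<^sub>b\<^sub>a)\<^sub>j\<close> and the Casimir element is proportional to
  \<open>\<Sum> (E\<^sub>a\<^sub>b - E\<^sub>a\<^sub>b\<^sup>*)\<^sub>j (E\<^sub>b\<^sub>a)\<^sub>i\<close>. A linear map can be moved from one tensor factor of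
  \<open>\<Sum> E\<^sub>a\<^sub>b \<otimes> E\<^sub>b\<^sub>a\<close> to the other, and all relations follow from this in any ring containing operators
  \<open>(A)\<^sub>i\<close> with the obvious products and commutators.

  The operator \<open>z\<^sub>1\<close> is a matrix over the enveloping algebra, and \<open>w\<^sub>l\<close> is the trace of its l-th power.
  Since \<open>e\<^sub>1\<^sub>2 z\<^sub>1\<^sup>l e\<^sub>1\<^sub>2 = w\<^sub>l e\<^sub>1\<^sub>2\<close>, whatever commutes with \<open>z\<^sub>1\<close> and is absorbed by \<open>e\<^sub>1\<^sub>2\<close> on the factors 1
  and 2 commutes with \<open>w\<^sub>l\<close>; this gives invariance under \<open>K\<close>, and, with \<open>X\<close> the enveloping algebra
  itself, centrality.
\<close>

section \<open>Evaluation of terms in a ring\<close>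

primrec ring_eval :: "(complex \<Rightarrow> 'r) \<Rightarrow> ('g \<Rightarrow> 'r) \<Rightarrow> 'g alg_term \<Rightarrow> 'r::{ring, monoid_mult}"
  where
    "ring_eval s \<phi> (Gen g) = \<phi> g"
  | "ring_eval s \<phi> (Scalar c) = s c"
  | "ring_eval s \<phi> (a \<boxplus> b) = ring_eval s \<phi> a + ring_eval s \<phi> b"
  | "ring_eval s \<phi> (a \<boxdot> b) = ring_eval s \<phi> a * ring_eval s \<phi> b"

locale scalar_hom =
  fixes scal :: "complex \<Rightarrow> 'r::{ring, monoid_mult}"
  assumes scal_add: "scal (c + d) = scal c + scal d"
    and scal_mult: "scal (c * d) = scal c * scal d"
    and scal_one [simp]: "scal 1 = 1"
begin

lemma scal_zero [simp]: "scal 0 = 0"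
  using scal_add[of 0 0] by simp

lemma scal_minus: "scal (- c) = - scal c"
  using scal_add[of c "- c"] by (simp add: eq_neg_iff_add_eq_0 add.commute)

lemma scal_diff: "scal (c - d) = scal c - scal d"
  using scal_add[of c "- d"] by (simp add: scal_minus)

lemma scal_commute: "scal c * scal d = scal d * scal c"
  by (metis mult.commute scal_mult)

lemma ring_eval_power: "ring_eval scal \<phi> (a \<up> l) = ring_eval scal \<phi> a ^ l"
  by (induction l) auto

lemma ring_eval_commute:
  assumes "\<And>g. g \<in> set_alg_term a \<Longrightarrow> x * \<phi> g = \<psi> g * x" and "\<And>c. x * scal c = scal c * x"
  shows "x * ring_eval scal \<phi> a = ring_eval scal \<psi> a * x"
  using assms(1)
proof (induction a)
  case (Times a b)
  then have "x * ring_eval scal \<phi> a = ring_eval scal \<psi> a * x"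
    and "x * ring_eval scal \<phi> b = ring_eval scal \<psi> b * x"
    by simp_all
  then show ?case
    by simp (metis mult.assoc)
qed (auto simp: assms(2) algebra_simps)

lemma ring_eval_cong:
  assumes "\<And>g. g \<in> set_alg_term a \<Longrightarrow> \<phi> g = \<psi> g"
  shows "ring_eval s \<phi> a = ring_eval s \<psi> a"
  using assms by (induction a) auto

lemma ring_eval_alg_cong:
  assumes "alg_cong R a b"
    and R: "\<And>a b. (a, b) \<in> R \<Longrightarrow> a \<in> terms_over gens \<and> b \<in> terms_over gens \<and>
      ring_eval scal \<phi> a = ring_eval scal \<phi> b"
    and central: "\<And>g c. g \<in> gens \<Longrightarrow> scal c * \<phi> g = \<phi> g * scal c"
    and "a \<in> terms_over gens" "b \<in> terms_over gens"
  shows "ring_eval scal \<phi> a = ring_eval scal \<phi> b"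
proof -
  \<comment> \<open>A derivation of the congruence may pass through terms with generators outside \<open>gens\<close>.\<close>
  define \<psi> where "\<psi> g = (if g \<in> gens then \<phi> g else 0)" for g
  have eq: "ring_eval scal \<phi> a = ring_eval scal \<psi> a" if "a \<in> terms_over gens" for a
    using that by (intro ring_eval_cong) (auto simp: \<psi>_def terms_over_def)
  have central': "scal c * \<psi> g = \<psi> g * scal c" for g c
    using central by (simp add: \<psi>_def)
  from assms(1) have "ring_eval scal \<psi> a = ring_eval scal \<psi> b"
  proof induction
    case (rel a b)
    then show ?case using R[OF rel] eq by metis
  next
    case (scalar_central c a)
    show ?case by (simp add: ring_eval_commute[where \<psi> = \<psi>] central' scal_commute)
  qed (auto simp: algebra_simps scal_add scal_mult)
  then show ?thesis using assms(4,5) by (simp add: eq)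
qed

end


section \<open>Additive operators and actions\<close>

typedef (overloaded) 'a endo = "{f :: 'a::ab_group_add \<Rightarrow> 'a. \<forall>x y. f (x + y) = f x + f y}"
  morphisms app Endo
  by (rule exI[of _ id]) auto

setup_lifting type_definition_endo

instantiation endo :: (ab_group_add) "{ring, monoid_mult}"
begin

lift_definition zero_endo :: "'a endo" is "\<lambda>x. 0" by simp
lift_definition one_endo :: "'a endo" is "\<lambda>x. x" by simp
lift_definition plus_endo :: "'a endo \<Rightarrow> 'a endo \<Rightarrow> 'a endo" is "\<lambda>f g x. f x + g x"
  by (simp add: algebra_simps)
lift_definition minus_endo :: "'a endo \<Rightarrow> 'a endo \<Rightarrow> 'a endo" is "\<lambda>f g x. f x - g x"
  by (simp add: algebra_simps)
lift_definition uminus_endo :: "'a endo \<Rightarrow> 'a endo" is "\<lambda>f x. - f x"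
  by (simp add: algebra_simps)
lift_definition times_endo :: "'a endo \<Rightarrow> 'a endo \<Rightarrow> 'a endo" is "\<lambda>f g x. f (g x)"
  by simp

instance
  by standard (transfer; auto simp: fun_eq_iff algebra_simps)+

end

lemma app_add: "app f (x + y) = app f x + app f y"
  using app[of f] by simp

lemma app_zero [simp]: "app f 0 = 0"
  using app_add[of f 0 0] by simp

lemma app_ops [simp]:
  "app 0 x = 0" "app 1 x = x" "app (f + g) x = app f x + app g x"
  "app (f - g) x = app f x - app g x" "app (- f) x = - app f x" "app (f * g) x = app f (app g x)"
  by (transfer; simp)+

lemma app_sum: "app (sum f A) x = (\<Sum>a\<in>A. app (f a) x)"
  by (induction A rule: infinite_finite_induct) auto

lemma app_Endo: "(\<And>x y. f (x + y) = f x + f y) \<Longrightarrow> app (Endo f) = f"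
  by (rule Endo_inverse) simp

lemma endo_eqI: "(\<And>x. app f x = app g x) \<Longrightarrow> f = g"
  by (simp add: app_inject[symmetric] fun_eq_iff)

lemma eval_term_eq_app:
  assumes "\<And>c x. app (s c) x = sc c x" and "\<And>g x. g \<in> set_alg_term a \<Longrightarrow> app (\<Phi> g) x = \<phi> g x"
  shows "eval_term sc \<phi> a x = app (ring_eval s \<Phi> a) x"
  using assms(2) by (induction a arbitrary: x) (auto simp: assms(1))

lemma acts_byI:
  assumes "scalar_hom s" and s: "\<And>c x. app (s c) x = sc c x"
    and \<Phi>: "\<And>g x. g \<in> gens \<Longrightarrow> app (\<Phi> g) x = \<phi> g x"
    and stable: "\<And>g x. \<lbrakk>g \<in> gens; x \<in> S\<rbrakk> \<Longrightarrow> \<phi> g x \<in> S"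
    and central: "\<And>g c. g \<in> gens \<Longrightarrow> s c * \<Phi> g = \<Phi> g * s c"
    and rels: "\<And>a b. (a, b) \<in> R \<Longrightarrow> a \<in> terms_over gens \<and> b \<in> terms_over gens \<and>
      ring_eval s \<Phi> a = ring_eval s \<Phi> b"
  shows "acts_by gens R sc S \<phi>"
  unfolding acts_by_def
proof (intro conjI ballI impI)
  fix g assume g: "g \<in> gens"
  have "\<phi> g (sc c v) = sc c (\<phi> g v)" for c v
    using arg_cong[OF central[OF g, of c], of "\<lambda>f. app f v"] by (simp add: s \<Phi>[OF g])
  moreover have "\<phi> g (v + w) = \<phi> g v + \<phi> g w" for v w
    using app_add[of "\<Phi> g" v w] by (simp add: \<Phi>[OF g])
  ultimately show "linear_on_subspace sc S (\<phi> g)"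
    using stable[OF g] by (simp add: linear_on_subspace_def)
next
  fix a b v assume ab: "a \<in> terms_over gens" "b \<in> terms_over gens" "alg_cong R a b"
  have ev: "eval_term sc \<phi> a v = app (ring_eval s \<Phi> a) v" if "a \<in> terms_over gens" for a
    using that by (intro eval_term_eq_app s \<Phi>) (auto simp: terms_over_def)
  interpret scalar_hom s by fact
  have "ring_eval s \<Phi> a = ring_eval s \<Phi> b"
    using ab by (intro ring_eval_alg_cong[where R = R and gens = gens] rels central)
  then show "eval_term sc \<phi> a v = eval_term sc \<phi> b v"
    using ab by (simp add: ev)
qed

section \<open>Matrix units and the adjoint of a form\<close>

definition munit :: "'i \<Rightarrow> 'i \<Rightarrow> 'i::finite cmatrix"
  where "munit a b = (\<chi> c d. if c = a \<and> d = b then 1 else 0)"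

lemma munit_nth: "munit a b $ c $ d = (if c = a then if d = b then 1 else 0 else 0)"
  by (simp add: munit_def)

lemma mscale_nth: "mscale c A $ a $ b = c * A $ a $ b"
  by (simp add: mscale_def)

lemma mscale_simps [simp]:
  "mscale c A ** C = mscale c (A ** C)" "C ** mscale c A = mscale c (C ** A)"
  "mscale c (mscale d A) = mscale (c * d) A" "mscale 1 A = A" "mscale 0 A = 0" "mscale c 0 = 0"
  "transpose (mscale c A) = mscale c (transpose A)" "trace (mscale c A) = c * trace A"
  by (simp_all add: vec_eq_iff mscale_nth matrix_matrix_mult_def transpose_def trace_def
      sum_distrib_left mult_ac)

lemma mscale_distrib:
  "mscale c (A + C) = mscale c A + mscale c C" "mscale c (A - C) = mscale c A - mscale c C"
  "mscale (c + d) A = mscale c A + mscale d A" "mscale (c - d) A = mscale c A - mscale d A"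
  "mscale (-1) A = - A" "mscale c (- A) = - mscale c A" "mscale (- c) A = - mscale c A"
  by (simp_all add: vec_eq_iff mscale_nth algebra_simps)

lemma transpose_distrib:
  "transpose (A + C) = transpose A + transpose C" "transpose (A - C) = transpose A - transpose C"
  "transpose (- A) = - transpose A" for A C :: "'i::finite cmatrix"
  by (simp_all add: vec_eq_iff transpose_def)

lemma matrix_mult_distrib:
  "A ** (C + D) = A ** C + A ** D" "(C + D) ** A = C ** A + D ** A"
  "A ** (C - D) = A ** C - A ** D" "(C - D) ** A = C ** A - D ** A"
  "A ** (- C) = - (A ** C)" "(- C) ** A = - (C ** A)"
  "A ** 0 = 0" "0 ** A = 0"
  for A C D :: "'i::finite cmatrix"
  by (simp_all add: vec_eq_iff matrix_matrix_mult_def algebra_simps sum.distrib sum_subtractf sum_negf)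

lemma sum_matrix_mult:
  "sum f S ** A = (\<Sum>x\<in>S. f x ** A)" "A ** sum f S = (\<Sum>x\<in>S. A ** f x)"
  for A :: "'i::finite cmatrix"
  by (induction S rule: infinite_finite_induct) (auto simp: matrix_mult_distrib)

lemma transpose_munit [simp]: "transpose (munit a b) = munit b a"
  by (auto simp: vec_eq_iff transpose_def munit_nth)

lemma trace_munit: "trace (munit a b) = (if a = b then 1 else 0)"
  by (simp add: trace_def munit_nth)

lemma trace_transpose: "trace (transpose A) = trace A" for A :: "'i::finite cmatrix"
  by (simp add: trace_def transpose_def)

lemma sum_if_const: "(\<Sum>x\<in>S. if P then f x else 0) = (if P then sum f S else 0)"
  by simp

lemma munit_mult: "munit a b ** A = (\<Sum>c\<in>UNIV. mscale (A $ b $ c) (munit a c))"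
  by (simp add: vec_eq_iff matrix_matrix_mult_def sum_component mscale_nth munit_nth
      if_distribR if_distrib[of "\<lambda>x. c * x" for c] if_distrib[of "\<lambda>x. x * c" for c] sum_if_const cong: if_cong)

lemma mult_munit: "A ** munit a b = (\<Sum>c\<in>UNIV. mscale (A $ c $ a) (munit c b))"
  by (simp add: vec_eq_iff matrix_matrix_mult_def sum_component mscale_nth munit_nth
      if_distribR if_distrib[of "\<lambda>x. c * x" for c] if_distrib[of "\<lambda>x. x * c" for c] sum_if_const cong: if_cong)

lemma munit_expansion: "A = (\<Sum>a\<in>UNIV. \<Sum>b\<in>UNIV. mscale (A $ a $ b) (munit a b))"
  by (simp add: vec_eq_iff sum_component mscale_nth munit_nth
      if_distribR if_distrib[of "\<lambda>x. c * x" for c] sum_if_const cong: if_cong)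

lemma munit_mult_munit: "munit a b ** A ** munit c d = mscale (A $ b $ c) (munit a d)"
  by (simp add: munit_mult sum_matrix_mult)
    (simp add: vec_eq_iff sum_component mscale_nth munit_nth
      if_distribR if_distrib[of "\<lambda>x. c * x" for c] sum_if_const cong: if_cong)

lemma munit_munit: "munit a b ** munit c d = (if b = c then munit a d else 0)"
  using munit_mult_munit[of a b "mat 1" c d] by (simp split: if_splits) (simp_all add: mat_def)

lemma sum_munit_diag: "(\<Sum>a\<in>UNIV. munit a a) = mat 1"
  by (simp add: vec_eq_iff sum_component munit_nth mat_def)

lemma sum_munit_mult_munit:
  "(\<Sum>a\<in>UNIV. \<Sum>b\<in>UNIV. munit a b ** A ** munit b a) = mscale (trace A) (mat 1)"
proof -
  have "(\<Sum>a\<in>UNIV. \<Sum>b\<in>UNIV. munit a b ** A ** munit b a) =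
      (\<Sum>a\<in>UNIV. mscale (trace A) (munit a a))"
    by (simp add: munit_mult_munit trace_def vec_eq_iff sum_component mscale_nth sum_distrib_right)
  also have "\<dots> = mscale (trace A) (mat 1)"
    by (simp add: sum_munit_diag[symmetric] vec_eq_iff sum_component mscale_nth sum_distrib_left)
  finally show ?thesis .
qed

lemma sum_munit_mult_munit':
  "(\<Sum>a\<in>UNIV. \<Sum>b\<in>UNIV. munit b a ** A ** munit a b) = mscale (trace A) (mat 1)"
  by (subst sum.swap) (rule sum_munit_mult_munit)

lemma sum_munit_transpose:
  "(\<Sum>a\<in>UNIV. \<Sum>b\<in>UNIV. munit a b ** A ** munit a b) = transpose A"
  using munit_expansion[of "transpose A"] by (simp add: munit_mult_munit transpose_def)

lemma sum_munit_transpose':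
  "(\<Sum>a\<in>UNIV. \<Sum>b\<in>UNIV. munit b a ** A ** munit b a) = transpose A"
  by (subst sum.swap) (rule sum_munit_transpose)

locale invariant_form =
  fixes J :: "'i::finite cmatrix" and \<epsilon> :: complex
  assumes transpose_J: "transpose J = mscale \<epsilon> J"
    and J_J: "J ** J = mscale \<epsilon> (mat 1)"
    and eps_sq: "\<epsilon> * \<epsilon> = 1"
    and card_neq: "of_nat CARD('i) \<noteq> 2 * \<epsilon>"
begin

definition star :: "'i cmatrix \<Rightarrow> 'i cmatrix"
  where "star A = transpose J ** transpose A ** J"

definition lie :: "'i cmatrix set"
  where "lie = {A. star A = - A}"

lemma eps_cases: obtains "\<epsilon> = 1" | "\<epsilon> = -1"
  using eps_sq square_eq_1_iff by blast

lemma J_J_mult: "J ** (J ** A) = mscale \<epsilon> A" "A ** J ** J = mscale \<epsilon> A"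
proof -
  have "J ** (J ** A) = J ** J ** A" by (simp add: matrix_mul_assoc)
  then show "J ** (J ** A) = mscale \<epsilon> A" by (simp add: J_J)
  have "A ** J ** J = A ** (J ** J)" by (simp add: matrix_mul_assoc)
  then show "A ** J ** J = mscale \<epsilon> A" by (simp add: J_J)
qed

lemma star_mult: "star (A ** C) = star C ** star A"
  by (simp add: star_def transpose_J matrix_transpose_mul matrix_mul_assoc J_J_mult eps_sq)

lemma star_star [simp]: "star (star A) = A"
  by (simp add: star_def transpose_J matrix_transpose_mul matrix_mul_assoc J_J J_J_mult eps_sq mult_ac)

lemma star_linear:
  "star (A + C) = star A + star C" "star (A - C) = star A - star C" "star (- A) = - star A"
  "star (mscale c A) = mscale c (star A)"
  by (simp_all add: star_def transpose_distrib matrix_mult_distrib)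

lemma star_zero [simp]: "star 0 = 0"
  by (simp add: star_def transpose_def vec_eq_iff matrix_matrix_mult_def)

lemma star_sum: "star (sum f A) = (\<Sum>x\<in>A. star (f x))"
  by (induction A rule: infinite_finite_induct) (simp_all add: star_linear)

lemma star_one [simp]: "star (mat 1) = mat 1"
  by (simp add: star_def transpose_J J_J eps_sq)

lemma sum_munit_star:
  "(\<Sum>a\<in>UNIV. \<Sum>b\<in>UNIV. star (munit a b) ** munit b a) = mscale \<epsilon> (mat 1)"
  "(\<Sum>a\<in>UNIV. \<Sum>b\<in>UNIV. munit b a ** star (munit a b)) = mscale \<epsilon> (mat 1)"
proof -
  have "(\<Sum>a\<in>UNIV. \<Sum>b\<in>UNIV. munit b a ** star (munit a b)) =
      (\<Sum>a\<in>UNIV. \<Sum>b\<in>UNIV. munit b a ** transpose J ** munit b a) ** J"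
    by (simp add: star_def sum_matrix_mult matrix_mul_assoc)
  then show 1: "(\<Sum>a\<in>UNIV. \<Sum>b\<in>UNIV. munit b a ** star (munit a b)) = mscale \<epsilon> (mat 1)"
    by (simp add: sum_munit_transpose' J_J)
  have "(\<Sum>a\<in>UNIV. \<Sum>b\<in>UNIV. star (munit a b) ** munit b a) =
      star (\<Sum>a\<in>UNIV. \<Sum>b\<in>UNIV. star (munit b a) ** munit a b)"
    by (simp add: star_sum star_mult)
  also have "(\<Sum>a\<in>UNIV. \<Sum>b\<in>UNIV. star (munit b a) ** munit a b) =
      transpose J ** (\<Sum>a\<in>UNIV. \<Sum>b\<in>UNIV. munit a b ** J ** munit a b)"
    by (simp add: star_def sum_matrix_mult matrix_mul_assoc)
  finally show "(\<Sum>a\<in>UNIV. \<Sum>b\<in>UNIV. star (munit a b) ** munit b a) = mscale \<epsilon> (mat 1)"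
    by (simp add: sum_munit_transpose transpose_J J_J star_linear eps_sq mult.assoc)
qed

lemma trace_star [simp]: "trace (star A) = trace A"
proof -
  have "trace (star A) = trace (J ** (transpose J ** transpose A))"
    unfolding star_def by (rule trace_mul_sym)
  also have "\<dots> = trace A"
    by (simp add: transpose_J J_J_mult eps_sq trace_transpose)
  finally show ?thesis .
qed

lemma skew_part_in_lie: "A - star A \<in> lie"
  by (simp add: lie_def star_linear)

lemma lie_closed:
  "A \<in> lie \<Longrightarrow> C \<in> lie \<Longrightarrow> A + C \<in> lie" "A \<in> lie \<Longrightarrow> mscale c A \<in> lie" "0 \<in> lie"
  "A \<in> lie \<Longrightarrow> C \<in> lie \<Longrightarrow> bracket A C \<in> lie"
  by (simp_all add: lie_def star_linear bracket_def star_mult matrix_mult_distrib mscale_distrib)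

end


section \<open>Tensor operators in a ring\<close>

lemma left_commute_mult: "a * b = b * a \<Longrightarrow> a * (b * c) = b * (a * c)" for a :: "'a::semigroup_mult"
  by (metis mult.assoc)

context scalar_hom
begin

definition lin :: "('i::finite cmatrix \<Rightarrow> 'r) \<Rightarrow> bool"
  where "lin f \<longleftrightarrow> (\<forall>A C. f (A + C) = f A + f C) \<and> (\<forall>c A. f (mscale c A) = scal c * f A) \<and>
    (\<forall>c A. f A * scal c = scal c * f A)"

text \<open>The image under \<open>f \<otimes> h\<close> of the canonical element of the trace form.\<close>

definition csum :: "('i::finite cmatrix \<Rightarrow> 'r) \<Rightarrow> ('i cmatrix \<Rightarrow> 'r) \<Rightarrow> 'r"
  where "csum f h = (\<Sum>a\<in>UNIV. \<Sum>b\<in>UNIV. f (munit a b) * h (munit b a))"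

lemma linD:
  assumes "lin f"
  shows "f (A + C) = f A + f C" "f (mscale c A) = scal c * f A" "f A * scal c = scal c * f A"
    "f 0 = 0" "f (- A) = - f A" "f (A - C) = f A - f C"
proof -
  show 1: "f (A + C) = f A + f C" "f (mscale c A) = scal c * f A" "f A * scal c = scal c * f A"
    for A C c
    using assms by (simp_all add: lin_def)
  show 0: "f 0 = 0"
    using 1(1)[of 0 0] by simp
  show 2: "f (- A) = - f A" for A
    using 1(1)[of A "- A"] 0 by (simp add: eq_neg_iff_add_eq_0 add.commute)
  show "f (A - C) = f A - f C"
    using 1(1)[of A "- C"] 2 by simp
qed

lemma lin_sum: "lin f \<Longrightarrow> f (sum g S) = (\<Sum>x\<in>S. f (g x))"
  by (induction S rule: infinite_finite_induct) (auto simp: linD)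

lemma lin_comp:
  assumes "lin f"
  shows "lin (\<lambda>X. f (A ** X))" "lin (\<lambda>X. f (X ** A))" "lin (\<lambda>X. f (transpose X))"
  using linD[OF assms] by (auto simp: lin_def matrix_mult_distrib transpose_distrib)

lemma lin_diff: "lin f \<Longrightarrow> lin g \<Longrightarrow> lin (\<lambda>X. f X - g X)"
  by (auto simp: lin_def algebra_simps)

lemma csum_shift:
  assumes f: "lin f" and h: "lin h"
  shows "csum (\<lambda>X. f (X ** A)) h = csum f (\<lambda>X. h (A ** X))"
proof -
  have "csum (\<lambda>X. f (X ** A)) h =
      (\<Sum>a\<in>UNIV. \<Sum>b\<in>UNIV. \<Sum>c\<in>UNIV. scal (A $ b $ c) * f (munit a c) * h (munit b a))"
    unfolding csum_def by (simp add: munit_mult lin_sum[OF f] linD[OF f] sum_distrib_right)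
  also have "\<dots> = (\<Sum>a\<in>UNIV. \<Sum>c\<in>UNIV. \<Sum>b\<in>UNIV. f (munit a c) * (scal (A $ b $ c) * h (munit b a)))"
    by (subst (2) sum.swap) (simp add: linD(3)[OF f, symmetric] mult.assoc)
  also have "\<dots> = csum f (\<lambda>X. h (A ** X))"
    unfolding csum_def by (simp add: mult_munit lin_sum[OF h] linD[OF h] sum_distrib_left)
  finally show ?thesis .
qed

lemma csum_shift':
  assumes f: "lin f" and h: "lin h"
  shows "csum (\<lambda>X. f (A ** X)) h = csum f (\<lambda>X. h (X ** A))"
proof -
  have "csum (\<lambda>X. f (A ** X)) h =
      (\<Sum>a\<in>UNIV. \<Sum>b\<in>UNIV. \<Sum>c\<in>UNIV. scal (A $ c $ a) * f (munit c b) * h (munit b a))"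
    unfolding csum_def by (simp add: mult_munit lin_sum[OF f] linD[OF f] sum_distrib_right)
  also have "\<dots> = (\<Sum>b\<in>UNIV. \<Sum>c\<in>UNIV. \<Sum>a\<in>UNIV. scal (A $ c $ a) * f (munit c b) * h (munit b a))"
    by (subst sum.swap, subst (2) sum.swap) simp
  also have "\<dots> = (\<Sum>c\<in>UNIV. \<Sum>b\<in>UNIV. \<Sum>a\<in>UNIV. f (munit c b) * (scal (A $ c $ a) * h (munit b a)))"
    by (subst sum.swap) (simp add: linD(3)[OF f, symmetric] mult.assoc)
  also have "\<dots> = csum f (\<lambda>X. h (X ** A))"
    unfolding csum_def by (simp add: munit_mult lin_sum[OF h] linD[OF h] sum_distrib_left)
  finally show ?thesis .
qed

lemma csum_transpose: "csum (\<lambda>X. f (transpose X)) h = csum f (\<lambda>X. h (transpose X))"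
  unfolding csum_def by (subst sum.swap) simp

lemma csum_commute:
  assumes "\<And>X Y. f X * h Y = h Y * f X"
  shows "csum f h = csum h f"
  unfolding csum_def by (subst sum.swap) (simp add: assms)

lemma csum_move:
  assumes "\<And>X. x * f X = f' X * x" and "\<And>X. x * h X = h' X * x"
  shows "x * csum f h = csum f' h' * x"
proof -
  have "x * (f X * h Y) = f' X * h' Y * x" for X Y
    by (metis assms mult.assoc)
  then show ?thesis
    by (simp add: csum_def sum_distrib_left sum_distrib_right)
qed

lemma csum_add:
  "csum (\<lambda>X. f X + g X) h = csum f h + csum g h" "csum f (\<lambda>X. h X + g X) = csum f h + csum f g"
  "csum (\<lambda>X. f X - g X) h = csum f h - csum g h" "csum f (\<lambda>X. h X - g X) = csum f h - csum f g"
  "csum (\<lambda>X. - f X) h = - csum f h" "csum f (\<lambda>X. - h X) = - csum f h"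
  by (simp_all add: csum_def algebra_simps sum.distrib sum_subtractf sum_negf)

lemma csum_sum: "csum (\<lambda>X. \<Sum>a\<in>S. f a X) h = (\<Sum>a\<in>S. csum (f a) h)"
  by (induction S rule: infinite_finite_induct) (simp_all add: csum_add, simp_all add: csum_def)

lemma mult_csum: "x * csum f h = csum (\<lambda>X. x * f X) h"
  by (simp add: csum_def sum_distrib_left mult.assoc)

lemma csum_mult: "csum f h * x = csum f (\<lambda>X. h X * x)"
  by (simp add: csum_def sum_distrib_right mult.assoc)

lemma mult_csum':
  assumes "\<And>X. x * f X = f X * x"
  shows "x * csum f h = csum f (\<lambda>X. x * h X)"
  by (simp add: csum_def sum_distrib_left mult.assoc[symmetric] assms)

lemma csum_mult':
  assumes "\<And>X. h X * x = x * h X"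
  shows "csum f h * x = csum (\<lambda>X. f X * x) h"
  by (simp add: csum_def sum_distrib_right mult.assoc assms)

lemma csum_trace:
  assumes h: "lin h"
  shows "csum (\<lambda>X. scal (trace X)) h = h (mat 1)"
proof -
  have "csum (\<lambda>X. scal (trace X)) h = (\<Sum>a\<in>UNIV. \<Sum>b\<in>UNIV. if a = b then h (munit b a) else 0)"
    unfolding csum_def
    by (simp add: trace_munit if_distrib[of scal] if_distrib[of "\<lambda>x. x * c" for c] cong: if_cong)
  then show ?thesis
    by (simp add: sum_munit_diag[symmetric] lin_sum[OF h])
qed

end

locale tensor_ops = invariant_form J \<epsilon> + scalar_hom scal
  for J :: "'i::finite cmatrix" and \<epsilon> :: complex and scal :: "complex \<Rightarrow> 'r::{ring, monoid_mult}" +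
  fixes opr :: "'i cmatrix \<Rightarrow> nat \<Rightarrow> 'r"
  assumes lin_opr: "i \<noteq> 0 \<Longrightarrow> lin (\<lambda>X. opr X i)"
    and opr_mult: "i \<noteq> 0 \<Longrightarrow> opr A i * opr C i = opr (A ** C) i"
    and opr_one: "i \<noteq> 0 \<Longrightarrow> opr (mat 1) i = 1"
    and opr_commute: "\<lbrakk>i \<noteq> 0; j \<noteq> 0; i \<noteq> j\<rbrakk> \<Longrightarrow> opr A i * opr C j = opr C j * opr A i"
    and opr0_commute: "\<lbrakk>i \<noteq> 0; A \<in> lie\<rbrakk> \<Longrightarrow> opr A 0 * opr C i = opr C i * opr A 0"
    and opr0_add: "A \<in> lie \<Longrightarrow> C \<in> lie \<Longrightarrow> opr (A + C) 0 = opr A 0 + opr C 0"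
    and opr0_mscale: "A \<in> lie \<Longrightarrow> opr (mscale c A) 0 = scal c * opr A 0"
    and opr0_scal: "A \<in> lie \<Longrightarrow> opr A 0 * scal c = scal c * opr A 0"
    and opr0_bracket: "A \<in> lie \<Longrightarrow> C \<in> lie \<Longrightarrow>
      opr (bracket A C) 0 = opr A 0 * opr C 0 - opr C 0 * opr A 0"
begin

definition swp :: "nat \<Rightarrow> nat \<Rightarrow> 'r"
  where "swp i j = csum (\<lambda>X. opr X i) (\<lambda>X. opr X j)"

definition contr :: "nat \<Rightarrow> nat \<Rightarrow> 'r"
  where "contr i j = csum (\<lambda>X. opr (star X) i) (\<lambda>X. opr X j)"

definition skew_opr :: "nat \<Rightarrow> 'i cmatrix \<Rightarrow> 'r"
  where "skew_opr l X = opr (X - star X) l"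

definition casimir :: "nat \<Rightarrow> nat \<Rightarrow> 'r"
  where "casimir l i = csum (skew_opr l) (\<lambda>X. opr X i)"

definition jucys_murphy :: "nat \<Rightarrow> 'r"
  where "jucys_murphy i =
    scal (- \<epsilon>) * (\<Sum>l<i. casimir l i) + scal ((1 - \<epsilon> * of_nat CARD('i)) / 2)"

lemma scal_eps_commute: "scal \<epsilon> * x = x * scal \<epsilon>"
  by (cases rule: eps_cases) (simp_all add: scal_minus)

lemma scal_eps_sq: "scal \<epsilon> * scal \<epsilon> = 1" "scal \<epsilon> * (scal \<epsilon> * x) = x"
  by (simp_all add: scal_mult[symmetric] mult.assoc[symmetric] eps_sq)

lemma lin_star: "lin f \<Longrightarrow> lin (\<lambda>X. f (star X))"
  by (simp add: lin_def star_linear)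

lemma csum_star:
  assumes f: "lin f" and h: "lin h"
  shows "csum (\<lambda>X. f (star X)) h = csum f (\<lambda>X. h (star X))"
proof -
  define f1 where "f1 Y = f (Y ** J)" for Y
  define f2 where "f2 Y = f1 (transpose J ** Y)" for Y
  have f1: "lin f1" and f2: "lin f2"
    unfolding f1_def[abs_def] f2_def[abs_def] by (intro lin_comp f)+
  have h': "lin (\<lambda>X. h (transpose X))"
    by (intro lin_comp h)
  have "csum (\<lambda>X. f (star X)) h = csum (\<lambda>X. f2 (transpose X)) h"
    by (simp add: f1_def f2_def star_def)
  also have "\<dots> = csum f2 (\<lambda>X. h (transpose X))"
    by (rule csum_transpose)
  also have "\<dots> = csum f1 (\<lambda>X. h (transpose (X ** transpose J)))"
    unfolding f2_def by (rule csum_shift'[OF f1 h'])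
  also have "\<dots> = csum f (\<lambda>X. h (transpose (J ** X ** transpose J)))"
    unfolding f1_def using csum_shift[OF f lin_comp(2)[OF h', of "transpose J"]] by simp
  also have "(\<lambda>X. h (transpose (J ** X ** transpose J))) = (\<lambda>X. h (star X))"
    by (simp add: fun_eq_iff matrix_transpose_mul star_def transpose_J matrix_mul_assoc eps_sq)
  finally show ?thesis .
qed

lemmas csum_opr_shift = csum_shift[OF lin_opr lin_opr] csum_shift[OF lin_star[OF lin_opr] lin_opr]
  csum_shift'[OF lin_star[OF lin_opr] lin_opr]

lemma swp_opr:
  assumes "i \<noteq> 0" "j \<noteq> 0" "i \<noteq> j"
  shows "opr A j * swp i j = swp i j * opr A i"
proof -
  have "opr A j * swp i j = csum (\<lambda>X. opr X i) (\<lambda>X. opr A j * opr X j)"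
    unfolding swp_def using assms by (intro mult_csum') (simp add: opr_commute)
  also have "\<dots> = csum (\<lambda>X. opr X i * opr A i) (\<lambda>X. opr X j)"
    using assms by (simp add: opr_mult csum_opr_shift)
  also have "\<dots> = swp i j * opr A i"
    unfolding swp_def using assms by (intro csum_mult'[symmetric]) (simp add: opr_commute)
  finally show ?thesis .
qed

lemma swp_sym: "\<lbrakk>i \<noteq> 0; j \<noteq> 0; i \<noteq> j\<rbrakk> \<Longrightarrow> swp i j = swp j i"
  unfolding swp_def by (intro csum_commute opr_commute)

lemma swp_opr': "\<lbrakk>i \<noteq> 0; j \<noteq> 0; i \<noteq> j\<rbrakk> \<Longrightarrow> opr A i * swp i j = swp i j * opr A j"
  using swp_opr[of j i A] by (simp add: swp_sym)

lemma swp_sq: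
  assumes "i \<noteq> 0" "j \<noteq> 0" "i \<noteq> j"
  shows "swp i j * swp i j = 1"
proof -
  have *: "opr A i * swp i j * opr C i = csum (\<lambda>X. opr (A ** X ** C) i) (\<lambda>X. opr X j)" for A C
  proof -
    have "opr A i * swp i j * opr C i = csum (\<lambda>X. opr A i * opr X i * opr C i) (\<lambda>X. opr X j)"
      unfolding swp_def mult_csum using assms by (intro csum_mult') (simp add: opr_commute)
    then show ?thesis using assms by (simp add: opr_mult)
  qed
  have "swp i j * swp i j = csum (\<lambda>X. opr X i) (\<lambda>X. opr X j * swp i j)"
    by (subst (1) swp_def) (rule csum_mult)
  also have "\<dots> = (\<Sum>a\<in>UNIV. \<Sum>b\<in>UNIV. opr (munit a b) i * swp i j * opr (munit b a) i)"
    using assms by (simp add: swp_opr csum_def mult.assoc)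
  also have "\<dots> = csum (\<lambda>X. opr (\<Sum>a\<in>UNIV. \<Sum>b\<in>UNIV. munit a b ** X ** munit b a) i) (\<lambda>X. opr X j)"
    using assms by (simp add: * lin_sum[OF lin_opr] csum_sum)
  also have "\<dots> = csum (\<lambda>X. scal (trace X)) (\<lambda>X. opr X j)"
    using assms by (simp add: sum_munit_mult_munit linD[OF lin_opr] opr_one)
  also have "\<dots> = 1"
    using assms by (simp add: csum_trace lin_opr opr_one)
  finally show ?thesis .
qed


lemma sum_opr_munit:
  assumes "i \<noteq> 0"
  shows "(\<Sum>a\<in>UNIV. \<Sum>b\<in>UNIV. opr (munit a b) i * opr A i * opr (munit b a) i) = scal (trace A)"
    and "(\<Sum>a\<in>UNIV. \<Sum>b\<in>UNIV. opr (star (munit a b)) i * opr A i * opr (star (munit b a)) i) = scal (trace A)"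
    and "(\<Sum>a\<in>UNIV. \<Sum>b\<in>UNIV. opr (munit a b) i * opr (star (munit b a)) i) = scal \<epsilon>"
    and "(\<Sum>a\<in>UNIV. \<Sum>b\<in>UNIV. opr (star (munit a b)) i * opr (munit b a) i) = scal \<epsilon>"
proof -
  note lin = lin_sum[OF lin_opr[OF assms], symmetric]
  have 0: "opr (mscale c (mat 1)) i = scal c" for c
    using assms by (simp add: linD[OF lin_opr] opr_one)
  show 1: "(\<Sum>a\<in>UNIV. \<Sum>b\<in>UNIV. opr (munit a b) i * opr A i * opr (munit b a) i) = scal (trace A)"
    using assms by (simp add: opr_mult lin sum_munit_mult_munit 0)
  have *: "(\<Sum>a\<in>UNIV. \<Sum>b\<in>UNIV. star (munit a b) ** A ** star (munit b a)) =
      star (\<Sum>a\<in>UNIV. \<Sum>b\<in>UNIV. munit b a ** star A ** munit a b)"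
    by (simp add: star_sum star_mult matrix_mul_assoc)
  show "(\<Sum>a\<in>UNIV. \<Sum>b\<in>UNIV. opr (star (munit a b)) i * opr A i * opr (star (munit b a)) i) = scal (trace A)"
    using assms by (simp add: opr_mult lin * sum_munit_mult_munit' star_linear 0)
  show "(\<Sum>a\<in>UNIV. \<Sum>b\<in>UNIV. opr (munit a b) i * opr (star (munit b a)) i) = scal \<epsilon>"
    using sum_munit_star(2) by (subst sum.swap) (simp add: opr_mult lin 0 assms)
  show "(\<Sum>a\<in>UNIV. \<Sum>b\<in>UNIV. opr (star (munit a b)) i * opr (munit b a) i) = scal \<epsilon>"
    using sum_munit_star(1) by (simp add: opr_mult lin 0 assms)
qed

lemma commute_swp:
  assumes "\<And>X. x * opr X i = opr X i * x" "\<And>X. x * opr X j = opr X j * x"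
  shows "x * swp i j = swp i j * x"
  unfolding swp_def using assms by (rule csum_move)

lemma commute_contr:
  assumes "\<And>X. x * opr X i = opr X i * x" "\<And>X. x * opr X j = opr X j * x"
  shows "x * contr i j = contr i j * x"
  unfolding contr_def using assms by (rule csum_move)

lemma contr_sym:
  assumes "i \<noteq> 0" "j \<noteq> 0" "i \<noteq> j"
  shows "contr i j = contr j i"
proof -
  have "contr i j = csum (\<lambda>X. opr X i) (\<lambda>X. opr (star X) j)"
    unfolding contr_def using assms by (intro csum_star lin_opr)
  also have "\<dots> = contr j i"
    unfolding contr_def using assms by (intro csum_commute opr_commute)
  finally show ?thesis .
qed

lemma opr_contr:
  assumes "i \<noteq> 0" "j \<noteq> 0" "i \<noteq> j"
  shows "opr A i * contr i j = opr (star A) j * contr i j"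
proof -
  have "opr A i * contr i j = csum (\<lambda>X. opr (star (X ** star A)) i) (\<lambda>X. opr X j)"
    unfolding contr_def mult_csum using assms by (simp add: opr_mult star_mult)
  also have "\<dots> = csum (\<lambda>X. opr (star X) i) (\<lambda>X. opr (star A) j * opr X j)"
    using assms by (simp add: csum_opr_shift opr_mult)
  also have "\<dots> = opr (star A) j * contr i j"
    unfolding contr_def using assms by (intro mult_csum'[symmetric]) (simp add: opr_commute)
  finally show ?thesis .
qed

lemma opr_contr': "\<lbrakk>i \<noteq> 0; j \<noteq> 0; i \<noteq> j\<rbrakk> \<Longrightarrow> opr A j * contr i j = opr (star A) i * contr i j"
  by (metis contr_sym opr_contr)

lemma contr_opr:
  assumes "i \<noteq> 0" "j \<noteq> 0" "i \<noteq> j"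
  shows "contr i j * opr A i = contr i j * opr (star A) j"
proof -
  have "contr i j * opr A i = csum (\<lambda>X. opr (star X) i * opr A i) (\<lambda>X. opr X j)"
    unfolding contr_def using assms by (intro csum_mult') (simp add: opr_commute)
  also have "\<dots> = csum (\<lambda>X. opr (star (star A ** X)) i) (\<lambda>X. opr X j)"
    using assms by (simp add: opr_mult star_mult)
  also have "\<dots> = csum (\<lambda>X. opr (star X) i) (\<lambda>X. opr (X ** star A) j)"
    using assms by (simp add: csum_opr_shift)
  also have "\<dots> = contr i j * opr (star A) j"
    unfolding contr_def csum_mult using assms by (simp add: opr_mult)
  finally show ?thesis .
qed

lemma contr_opr': "\<lbrakk>i \<noteq> 0; j \<noteq> 0; i \<noteq> j\<rbrakk> \<Longrightarrow> contr i j * opr A j = contr i j * opr (star A) i"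
  by (metis contr_sym contr_opr)

lemma contr_mult: "contr i j * x = (\<Sum>a\<in>UNIV. \<Sum>b\<in>UNIV. opr (star (munit a b)) i * (opr (munit b a) j * x))"
  by (simp add: contr_def csum_def sum_distrib_right mult.assoc)

lemma mult_contr: "x * contr i j = (\<Sum>a\<in>UNIV. \<Sum>b\<in>UNIV. x * opr (star (munit a b)) i * opr (munit b a) j)"
  by (simp add: contr_def csum_def sum_distrib_left mult.assoc)

lemma swp_mult: "swp i j * x = (\<Sum>a\<in>UNIV. \<Sum>b\<in>UNIV. opr (munit a b) i * (opr (munit b a) j * x))"
  by (simp add: swp_def csum_def sum_distrib_right mult.assoc)

lemma mult_swp: "x * swp i j = (\<Sum>a\<in>UNIV. \<Sum>b\<in>UNIV. x * opr (munit a b) i * opr (munit b a) j)"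
  by (simp add: swp_def csum_def sum_distrib_left mult.assoc)

lemma contr_opr_contr:
  assumes "i \<noteq> 0" "j \<noteq> 0" "i \<noteq> j"
  shows "contr i j * opr A i * contr i j = scal (trace A) * contr i j"
proof -
  have "opr C j * (opr A i * contr i j) = opr A i * (opr (star C) i * contr i j)" for C
    using assms opr_commute[of j i] opr_contr'[of i j] by (simp add: left_commute_mult[of "opr _ j"])
  then have "contr i j * (opr A i * contr i j) =
      (\<Sum>a\<in>UNIV. \<Sum>b\<in>UNIV. opr (star (munit a b)) i * (opr A i * (opr (star (munit b a)) i * contr i j)))"
    by (simp add: contr_mult[of i j "opr A i * contr i j"])
  also have "\<dots> = (\<Sum>a\<in>UNIV. \<Sum>b\<in>UNIV. opr (star (munit a b)) i * opr A i * opr (star (munit b a)) i) * contr i j"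
    by (simp add: sum_distrib_right mult.assoc)
  finally show ?thesis
    using sum_opr_munit(2)[OF assms(1)] by (simp add: mult.assoc)
qed

lemma contr_sq:
  assumes "i \<noteq> 0" "j \<noteq> 0" "i \<noteq> j"
  shows "contr i j * contr i j = scal (of_nat CARD('i)) * contr i j"
  using contr_opr_contr[OF assms, of "mat 1"] assms by (simp add: opr_one trace_I)

lemma swp_contr:
  assumes "i \<noteq> 0" "j \<noteq> 0" "i \<noteq> j"
  shows "swp i j * contr i j = scal \<epsilon> * contr i j"
proof -
  have "swp i j * contr i j =
      (\<Sum>a\<in>UNIV. \<Sum>b\<in>UNIV. opr (munit a b) i * opr (star (munit b a)) i) * contr i j"
    using assms by (simp add: swp_mult opr_contr' sum_distrib_right mult.assoc)
  then show ?thesis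
    using assms by (simp add: sum_opr_munit)
qed

lemma contr_swp:
  assumes "i \<noteq> 0" "j \<noteq> 0" "i \<noteq> j"
  shows "contr i j * swp i j = scal \<epsilon> * contr i j"
proof -
  have "contr i j * swp i j =
      contr i j * (\<Sum>a\<in>UNIV. \<Sum>b\<in>UNIV. opr (star (munit a b)) j * opr (munit b a) j)"
    using assms by (simp add: mult_swp contr_opr sum_distrib_left mult.assoc)
  then show ?thesis
    using assms by (simp add: sum_opr_munit scal_eps_commute)
qed

lemma contr_contr:
  assumes "i \<noteq> 0" "j \<noteq> 0" "k \<noteq> 0" "i \<noteq> j" "j \<noteq> k" "i \<noteq> k"
  shows "contr j k * contr i j = swp i k * contr i j"
proof -
  have "opr (star (munit a b)) j * (opr (munit b a) k * contr i j) =
      opr (munit a b) i * (opr (munit b a) k * contr i j)" for a b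
    using opr_commute[of j k] opr_commute[of i k] opr_contr[of i j] assms
    by (simp add: left_commute_mult[of "opr _ j" "opr _ k"] left_commute_mult[of "opr _ i" "opr _ k"])
  then show ?thesis
    by (simp add: contr_mult[of j k "contr i j"] swp_mult)
qed

lemma contr_contr':
  assumes "i \<noteq> 0" "j \<noteq> 0" "k \<noteq> 0" "i \<noteq> j" "j \<noteq> k" "i \<noteq> k"
  shows "contr i j * contr j k = contr i j * swp i k"
  using assms by (simp add: mult_contr[of "contr i j" j k] mult_swp[of _ i k] contr_opr')

lemma swp_conj_swp:
  assumes "i \<noteq> 0" "j \<noteq> 0" "k \<noteq> 0" "i \<noteq> j" "j \<noteq> k" "i \<noteq> k"
  shows "swp i j * swp j k = swp i k * swp i j"
  using assms unfolding swp_def[of j k] swp_def[of i k]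
  by (intro csum_move) (simp_all add: swp_opr' commute_swp opr_commute)

lemma swp_conj_contr:
  assumes "i \<noteq> 0" "j \<noteq> 0" "k \<noteq> 0" "i \<noteq> j" "j \<noteq> k" "i \<noteq> k"
  shows "swp i j * contr j k = contr i k * swp i j"
  using assms unfolding contr_def[of j k] contr_def[of i k]
  by (intro csum_move) (simp_all add: swp_opr' commute_swp opr_commute)

lemma sum_opr_contr_opr:
  assumes "i \<noteq> 0" "j \<noteq> 0" "i \<noteq> j"
  shows "(\<Sum>a\<in>UNIV. \<Sum>b\<in>UNIV. opr (munit a b) i * contr i j * opr (munit b a) i) = 1"
proof -
  have *: "opr A i * contr i j * opr C i = csum (\<lambda>X. opr (A ** star X ** C) i) (\<lambda>X. opr X j)" for A C
  proof -
    have "opr A i * contr i j * opr C i = csum (\<lambda>X. opr A i * opr (star X) i * opr C i) (\<lambda>X. opr X j)"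
      unfolding contr_def mult_csum using assms by (intro csum_mult') (simp add: opr_commute)
    then show ?thesis using assms by (simp add: opr_mult)
  qed
  have "(\<Sum>a\<in>UNIV. \<Sum>b\<in>UNIV. opr (munit a b) i * contr i j * opr (munit b a) i) =
      csum (\<lambda>X. opr (\<Sum>a\<in>UNIV. \<Sum>b\<in>UNIV. munit a b ** star X ** munit b a) i) (\<lambda>X. opr X j)"
    using assms by (simp add: * lin_sum[OF lin_opr] csum_sum)
  also have "\<dots> = csum (\<lambda>X. scal (trace X)) (\<lambda>X. opr X j)"
    using assms by (simp add: sum_munit_mult_munit linD[OF lin_opr] opr_one)
  finally show ?thesis
    using assms by (simp add: csum_trace lin_opr opr_one)
qed

lemma contr_cancel:
  assumes "i \<noteq> 0" "j \<noteq> 0" "i \<noteq> j" and "x * contr i j = y * contr i j"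
    and "\<And>A. x * opr A i = opr A i * x" "\<And>A. y * opr A i = opr A i * y"
  shows "x = y"
proof -
  have 1: "z * opr A i = opr A i * z" if "z = x \<or> z = y" for z A
    using assms(5,6) that by blast
  have "z = (\<Sum>a\<in>UNIV. \<Sum>b\<in>UNIV. opr (munit a b) i * (z * contr i j) * opr (munit b a) i)"
    if "z = x \<or> z = y" for z
  proof -
    have "z = z * (\<Sum>a\<in>UNIV. \<Sum>b\<in>UNIV. opr (munit a b) i * contr i j * opr (munit b a) i)"
      using assms by (simp add: sum_opr_contr_opr)
    also have "\<dots> = (\<Sum>a\<in>UNIV. \<Sum>b\<in>UNIV. opr (munit a b) i * (z * contr i j) * opr (munit b a) i)"
      using left_commute_mult[OF 1[OF that]] by (simp add: sum_distrib_left mult.assoc)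
    finally show ?thesis .
  qed
  then show ?thesis
    using assms(4) by metis
qed

end

section \<open>Casimir operators and Jucys-Murphy elements\<close>

context tensor_ops
begin

lemma lin_skew_opr: "lin (skew_opr l)"
proof (cases "l = 0")
  case True
  have 1: "A + C - star (A + C) = (A - star A) + (C - star C)" for A C
    by (simp add: star_linear)
  have 2: "mscale c A - star (mscale c A) = mscale c (A - star A)" for c A
    by (simp add: star_linear mscale_distrib)
  show ?thesis
    unfolding lin_def skew_opr_def True 1 2
    by (simp add: opr0_add opr0_mscale opr0_scal skew_part_in_lie)
next
  case False
  then show ?thesis
    unfolding skew_opr_def[abs_def] by (simp add: linD[OF lin_opr] lin_diff lin_star[OF lin_opr] lin_opr)
qed

lemma opr_lie_commute:
  "\<lbrakk>A \<in> lie; i \<noteq> 0; l \<noteq> i\<rbrakk> \<Longrightarrow> opr A l * opr C i = opr C i * opr A l"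
  by (cases "l = 0") (simp_all add: opr0_commute opr_commute)

lemma skew_opr_commute: "\<lbrakk>i \<noteq> 0; l \<noteq> i\<rbrakk> \<Longrightarrow> skew_opr l A * opr C i = opr C i * skew_opr l A"
  by (simp add: skew_opr_def opr_lie_commute skew_part_in_lie)

lemma skew_opr_star: "skew_opr l (star A) = - skew_opr l A"
proof -
  have "skew_opr l (star A) = skew_opr l (- A)"
    by (simp add: skew_opr_def star_linear)
  then show ?thesis
    by (simp add: linD[OF lin_skew_opr])
qed

lemma opr_bracket:
  assumes "A \<in> lie" "C \<in> lie"
  shows "opr (bracket A C) l = opr A l * opr C l - opr C l * opr A l"
  using assms
  by (cases "l = 0") (simp add: opr0_bracket, simp add: opr_mult bracket_def linD[OF lin_opr])

lemma opr_skew_opr: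
  assumes "A \<in> lie"
  shows "opr A l * skew_opr l X = skew_opr l X * opr A l + skew_opr l (A ** X) - skew_opr l (X ** A)"
proof -
  have "bracket A (X - star X) = (A ** X - X ** A) - star (A ** X - X ** A)"
    using assms by (simp add: bracket_def star_linear star_mult lie_def matrix_mult_distrib)
  then have "skew_opr l (A ** X - X ** A) = opr A l * skew_opr l X - skew_opr l X * opr A l"
    using opr_bracket[OF assms skew_part_in_lie, of X l] by (simp add: skew_opr_def)
  then show ?thesis
    by (simp add: linD[OF lin_skew_opr] algebra_simps)
qed

lemma casimir_invariant:
  assumes "A \<in> lie" "i \<noteq> 0" "l \<noteq> i"
  shows "(opr A l + opr A i) * casimir l i = casimir l i * (opr A l + opr A i)"
proof -
  let ?h = "\<lambda>X. opr X i"
  have "opr A l * casimir l i = csum (\<lambda>X. skew_opr l X * opr A l) ?h +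
      csum (\<lambda>X. skew_opr l (A ** X)) ?h - csum (\<lambda>X. skew_opr l (X ** A)) ?h"
    unfolding casimir_def mult_csum opr_skew_opr[OF assms(1)] csum_add by simp
  also have "csum (\<lambda>X. skew_opr l X * opr A l) ?h = casimir l i * opr A l"
    unfolding casimir_def using assms by (intro csum_mult'[symmetric]) (simp add: opr_lie_commute)
  also have "csum (\<lambda>X. skew_opr l (A ** X)) ?h = csum (skew_opr l) (\<lambda>X. ?h (X ** A))"
    using assms by (intro csum_shift' lin_skew_opr lin_opr)
  also have "csum (\<lambda>X. skew_opr l (X ** A)) ?h = csum (skew_opr l) (\<lambda>X. ?h (A ** X))"
    using assms by (intro csum_shift lin_skew_opr lin_opr)
  finally have 1: "opr A l * casimir l i = casimir l i * opr A l +
      csum (skew_opr l) (\<lambda>X. ?h (X ** A)) - csum (skew_opr l) (\<lambda>X. ?h (A ** X))" .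
  have "opr A i * casimir l i = csum (skew_opr l) (\<lambda>X. opr A i * ?h X)"
    unfolding casimir_def using assms by (intro mult_csum') (simp add: skew_opr_commute)
  moreover have "casimir l i * opr A i = csum (skew_opr l) (\<lambda>X. ?h X * opr A i)"
    unfolding casimir_def by (rule csum_mult)
  ultimately show ?thesis
    using 1 assms by (simp add: opr_mult algebra_simps)
qed

lemma commute_casimir:
  assumes "\<And>X. x * skew_opr l X = skew_opr l X * x" "\<And>X. x * opr X i = opr X i * x"
  shows "x * casimir l i = casimir l i * x"
  unfolding casimir_def using assms by (rule csum_move)

lemma scal_commute_casimir: "i \<noteq> 0 \<Longrightarrow> scal c * casimir l i = casimir l i * scal c"
  by (rule commute_casimir) (simp_all add: linD[OF lin_skew_opr] linD[OF lin_opr])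

lemma scal_commute_swp: "i \<noteq> 0 \<Longrightarrow> j \<noteq> 0 \<Longrightarrow> scal c * swp i j = swp i j * scal c"
  by (rule commute_swp) (simp_all add: linD[OF lin_opr])

lemma scal_commute_contr: "i \<noteq> 0 \<Longrightarrow> j \<noteq> 0 \<Longrightarrow> scal c * contr i j = contr i j * scal c"
  by (rule commute_contr) (simp_all add: linD[OF lin_opr])

lemma casimir_eq: "l \<noteq> 0 \<Longrightarrow> casimir l i = swp l i - contr l i"
  unfolding casimir_def swp_def contr_def skew_opr_def by (simp add: linD[OF lin_opr] csum_add)

lemma casimir_star:
  assumes "i \<noteq> 0"
  shows "csum (skew_opr l) (\<lambda>X. opr (star X) i) = - casimir l i"
  using csum_star[OF lin_skew_opr lin_opr, of i l] assms
  by (simp add: skew_opr_star csum_add casimir_def)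

lemma casimir_double:
  assumes "i \<noteq> 0"
  shows "csum (skew_opr l) (skew_opr i) = casimir l i + casimir l i"
  using casimir_star[OF assms, of l] assms
  by (subst (2) skew_opr_def[abs_def]) (simp add: linD[OF lin_opr] csum_add casimir_def)

lemma casimir_commute:
  assumes "i \<noteq> 0" "l \<noteq> i" "i \<noteq> j" "l \<noteq> j" "j \<noteq> 0"
  shows "casimir l i * (casimir l j + casimir i j) = (casimir l j + casimir i j) * casimir l i"
proof -
  have "casimir l i * opr X j = opr X j * casimir l i" for X
    using assms by (intro commute_casimir[symmetric]) (simp_all add: skew_opr_commute opr_commute)
  moreover have "casimir l i * (skew_opr l X + skew_opr i X) = (skew_opr l X + skew_opr i X) * casimir l i" for X
    using assms by (simp add: skew_opr_def casimir_invariant skew_part_in_lie)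
  ultimately show ?thesis
    unfolding casimir_def[of _ j] csum_add[symmetric] by (intro csum_move)
qed

lemma casimir_commute_disjoint:
  assumes "i \<noteq> 0" "j \<noteq> 0" "i \<noteq> j" "l \<noteq> i" "l \<noteq> j" "m \<noteq> i" "m \<noteq> j" "l \<noteq> m"
  shows "casimir l i * casimir m j = casimir m j * casimir l i"
proof -
  have skew: "skew_opr l X * skew_opr m Y = skew_opr m Y * skew_opr l X" for X Y
    using assms
    by (cases "m = 0") (simp_all add: skew_opr_def opr_lie_commute skew_part_in_lie opr_lie_commute[symmetric])
  have "skew_opr m X * casimir l i = casimir l i * skew_opr m X" for X
    using assms skew by (intro commute_casimir) (simp_all add: skew_opr_commute)
  moreover have "opr X j * casimir l i = casimir l i * opr X j" for X
    using assms by (intro commute_casimir) (simp_all add: skew_opr_commute opr_commute)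
  ultimately show ?thesis
    by (intro commute_casimir) simp_all
qed

lemma commute_sum: "(\<And>x. x \<in> S \<Longrightarrow> y * f x = f x * y) \<Longrightarrow> y * sum f S = sum f S * y" for y :: 'r
  by (simp add: sum_distrib_left sum_distrib_right)

lemma contr_lie:
  assumes "A \<in> lie" "i \<noteq> 0" "j \<noteq> 0" "i \<noteq> j"
  shows "contr i j * (opr A i + opr A j) = 0" "(opr A i + opr A j) * contr i j = 0"
  using assms by (simp_all add: semiring_class.distrib_left semiring_class.distrib_right contr_opr opr_contr lie_def linD[OF lin_opr])

lemma contr_casimir:
  assumes "i \<noteq> 0" "j \<noteq> 0" "i \<noteq> j" "l \<noteq> i" "l \<noteq> j"
  shows "contr i j * casimir l i = - (contr i j * casimir l j)"
    and "casimir l i * contr i j = - (casimir l j * contr i j)"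
proof -
  have c: "contr i j * skew_opr l X = skew_opr l X * contr i j" for X
    using assms by (intro commute_contr[symmetric]) (simp_all add: skew_opr_commute)
  have "contr i j * casimir l i = csum (skew_opr l) (\<lambda>X. contr i j * opr X i)"
    unfolding casimir_def by (rule mult_csum'[OF c])
  also have "\<dots> = contr i j * csum (skew_opr l) (\<lambda>X. opr (star X) j)"
    using assms by (simp add: contr_opr mult_csum'[OF c])
  finally show "contr i j * casimir l i = - (contr i j * casimir l j)"
    using assms by (simp add: casimir_star)
  have "casimir l i * contr i j = csum (skew_opr l) (\<lambda>X. opr (star X) j) * contr i j"
    unfolding casimir_def csum_mult using assms by (simp add: opr_contr)
  then show "casimir l i * contr i j = - (casimir l j * contr i j)"
    using assms by (simp add: casimir_star)
qed

lemma contr_commute_casimir_sum: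
  assumes "i \<noteq> 0" "j \<noteq> 0" "i \<noteq> j" "l \<noteq> i" "l \<noteq> j" "l \<noteq> 0"
  shows "contr i j * (casimir i l + casimir j l) = (casimir i l + casimir j l) * contr i j"
proof -
  have "contr i j * opr X l = opr X l * contr i j" for X
    using assms by (intro commute_contr[symmetric]) (simp_all add: opr_commute)
  moreover have "contr i j * (skew_opr i X + skew_opr j X) = (skew_opr i X + skew_opr j X) * contr i j" for X
    using assms by (simp add: skew_opr_def contr_lie skew_part_in_lie)
  ultimately show ?thesis
    unfolding casimir_def[of _ l] csum_add[symmetric] by (intro csum_move)
qed

lemma swp_casimir:
  assumes "i \<noteq> 0" "j \<noteq> 0" "i \<noteq> j" "l \<noteq> i" "l \<noteq> j"
  shows "swp i j * casimir l i = casimir l j * swp i j"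
  unfolding casimir_def using assms
  by (intro csum_move commute_swp[symmetric]) (simp_all add: swp_opr skew_opr_commute)

lemma swp_casimir':
  assumes "i \<noteq> 0" "j \<noteq> 0" "i \<noteq> j" "l \<noteq> i" "l \<noteq> j" "l \<noteq> 0"
  shows "swp i j * casimir i l = casimir j l * swp i j"
  unfolding casimir_def using assms
  by (intro csum_move commute_swp[symmetric]) (simp_all add: swp_opr skew_opr_def opr_commute)

lemma commute_jucys_murphy:
  assumes "x * (\<Sum>l<i. casimir l i) = (\<Sum>l<i. casimir l i) * x" "x * scal ((1 - \<epsilon> * of_nat CARD('i)) / 2) = scal ((1 - \<epsilon> * of_nat CARD('i)) / 2) * x"
  shows "x * jucys_murphy i = jucys_murphy i * x"
proof -
  have "x * (scal \<epsilon> * y) = scal \<epsilon> * (x * y)" for y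
    by (rule left_commute_mult) (simp add: scal_eps_commute)
  then show ?thesis
    using assms by (simp add: jucys_murphy_def scal_minus algebra_simps)
qed

lemma sum_lessThan_remove2:
  fixes f :: "nat \<Rightarrow> 'r"
  assumes "a < n" "b < n" "a \<noteq> b"
  shows "(\<Sum>l<n. f l) = f a + f b + (\<Sum>l\<in>{..<n} - {a, b}. f l)"
proof -
  have "(\<Sum>l<n. f l) = f a + (\<Sum>l\<in>{..<n} - {a}. f l)"
    using assms by (intro sum.remove) auto
  also have "(\<Sum>l\<in>{..<n} - {a}. f l) = f b + (\<Sum>l\<in>{..<n} - {a} - {b}. f l)"
    using assms by (intro sum.remove) auto
  also have "{..<n} - {a} - {b} = {..<n} - {a, b}"
    by auto
  finally show ?thesis
    by (simp add: add.assoc)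
qed

lemma jucys_murphy_commute: "\<lbrakk>i \<noteq> 0; j \<noteq> 0\<rbrakk> \<Longrightarrow> jucys_murphy i * jucys_murphy j = jucys_murphy j * jucys_murphy i"
proof (induction i j rule: linorder_wlog)
  case (le i j)
  show ?case
  proof (cases "i = j")
    case False
    with le have ij: "i < j" "i \<noteq> 0" "j \<noteq> 0"
      by auto
    have "casimir l i * (\<Sum>m<j. casimir m j) = (\<Sum>m<j. casimir m j) * casimir l i" if "l < i" for l
    proof -
      have "casimir l i * casimir m j = casimir m j * casimir l i" if "m \<in> {..<j} - {l, i}" for m
        using that \<open>l < i\<close> ij by (intro casimir_commute_disjoint) auto
      moreover have "casimir l i * (casimir l j + casimir i j) = (casimir l j + casimir i j) * casimir l i"
        using that ij by (intro casimir_commute) auto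
      moreover have "(\<Sum>m<j. casimir m j) = casimir l j + casimir i j + (\<Sum>m\<in>{..<j} - {l, i}. casimir m j)"
        using that ij by (intro sum_lessThan_remove2) auto
      ultimately show ?thesis
        by (simp only: semiring_class.distrib_left[of _ "_ + _"] semiring_class.distrib_right[of "_ + _"] commute_sum)
    qed
    then have "(\<Sum>m<j. casimir m j) * (\<Sum>l<i. casimir l i) = (\<Sum>l<i. casimir l i) * (\<Sum>m<j. casimir m j)"
      by (intro commute_sum) simp
    moreover have "scal c * (\<Sum>l<i. casimir l i) = (\<Sum>l<i. casimir l i) * scal c" for c
      using ij by (intro commute_sum scal_commute_casimir)
    moreover have "scal c * (\<Sum>l<j. casimir l j) = (\<Sum>l<j. casimir l j) * scal c" for c
      using ij by (intro commute_sum scal_commute_casimir)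
    ultimately have "(\<Sum>m<j. casimir m j) * jucys_murphy i = jucys_murphy i * (\<Sum>m<j. casimir m j)"
      and "scal ((1 - \<epsilon> * of_nat CARD('i)) / 2) * jucys_murphy i = jucys_murphy i * scal ((1 - \<epsilon> * of_nat CARD('i)) / 2)"
      by (intro commute_jucys_murphy; simp)+
    then show ?thesis
      by (intro commute_jucys_murphy) simp_all
  qed simp
next
  case (sym i j)
  then show ?case by simp
qed

lemma swp_jucys_murphy_commute:
  assumes "i \<noteq> 0" "j \<noteq> 0" "j \<noteq> i" "j \<noteq> Suc i"
  shows "swp i (Suc i) * jucys_murphy j = jucys_murphy j * swp i (Suc i)"
proof (rule commute_jucys_murphy)
  have *: "swp i (Suc i) * casimir l j = casimir l j * swp i (Suc i)" if "l \<noteq> i" "l \<noteq> Suc i" for l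
    using assms that
    by (intro commute_casimir commute_swp[symmetric]) (simp_all add: skew_opr_commute opr_commute)
  show "swp i (Suc i) * (\<Sum>l<j. casimir l j) = (\<Sum>l<j. casimir l j) * swp i (Suc i)"
  proof (cases "j < i")
    case True
    then show ?thesis by (intro commute_sum *) auto
  next
    case False
    then have j: "i < j" "Suc i < j" using assms by auto
    have "swp i (Suc i) * casimir i j = casimir (Suc i) j * swp i (Suc i)"
      "swp i (Suc i) * casimir (Suc i) j = casimir i j * swp i (Suc i)"
      using assms swp_casimir'[of i "Suc i" j] swp_casimir'[of "Suc i" i j] by (simp_all add: swp_sym)
    moreover have "swp i (Suc i) * (\<Sum>l\<in>{..<j} - {i, Suc i}. casimir l j) =
        (\<Sum>l\<in>{..<j} - {i, Suc i}. casimir l j) * swp i (Suc i)"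
      by (intro commute_sum *) auto
    ultimately show ?thesis
      using sum_lessThan_remove2[of i j "Suc i" "\<lambda>l. casimir l j"] j by (simp add: algebra_simps)
  qed
qed (use assms in \<open>simp add: scal_commute_swp\<close>)

lemma contr_jucys_murphy_commute:
  assumes "i \<noteq> 0" "j \<noteq> 0" "j \<noteq> i" "j \<noteq> Suc i"
  shows "contr i (Suc i) * jucys_murphy j = jucys_murphy j * contr i (Suc i)"
proof (rule commute_jucys_murphy)
  have *: "contr i (Suc i) * casimir l j = casimir l j * contr i (Suc i)" if "l \<noteq> i" "l \<noteq> Suc i" for l
    using assms that
    by (intro commute_casimir commute_contr[symmetric]) (simp_all add: skew_opr_commute opr_commute)
  show "contr i (Suc i) * (\<Sum>l<j. casimir l j) = (\<Sum>l<j. casimir l j) * contr i (Suc i)"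
  proof (cases "j < i")
    case True
    then show ?thesis by (intro commute_sum *) auto
  next
    case False
    then have j: "i < j" "Suc i < j" using assms by auto
    have "contr i (Suc i) * (casimir i j + casimir (Suc i) j) = (casimir i j + casimir (Suc i) j) * contr i (Suc i)"
      using assms by (intro contr_commute_casimir_sum) auto
    moreover have "contr i (Suc i) * (\<Sum>l\<in>{..<j} - {i, Suc i}. casimir l j) =
        (\<Sum>l\<in>{..<j} - {i, Suc i}. casimir l j) * contr i (Suc i)"
      by (intro commute_sum *) auto
    ultimately show ?thesis
      using sum_lessThan_remove2[of i j "Suc i" "\<lambda>l. casimir l j"] j
      by (simp only: semiring_class.distrib_left[of _ "_ + _"] semiring_class.distrib_right[of "_ + _"])
  qed
qed (use assms in \<open>simp add: scal_commute_contr\<close>)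

lemma jucys_murphy_Suc:
  "jucys_murphy (Suc i) = scal (- \<epsilon>) * (\<Sum>l<i. casimir l (Suc i)) + scal (- \<epsilon>) * casimir i (Suc i) + scal ((1 - \<epsilon> * of_nat CARD('i)) / 2)"
  by (simp add: jucys_murphy_def algebra_simps)

lemma swp_jucys_murphy:
  assumes "i \<noteq> 0"
  shows "swp i (Suc i) * jucys_murphy i - jucys_murphy (Suc i) * swp i (Suc i) = scal \<epsilon> - contr i (Suc i)"
proof -
  have 1: "swp i (Suc i) * (\<Sum>l<i. casimir l i) = (\<Sum>l<i. casimir l (Suc i)) * swp i (Suc i)"
    unfolding sum_distrib_left sum_distrib_right using assms by (intro sum.cong swp_casimir) auto
  have 2: "swp i (Suc i) * (scal \<epsilon> * y) = scal \<epsilon> * (swp i (Suc i) * y)" for y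
    by (rule left_commute_mult) (simp add: scal_eps_commute)
  have 3: "casimir i (Suc i) * swp i (Suc i) = 1 - scal \<epsilon> * contr i (Suc i)"
    using assms by (simp add: casimir_eq left_diff_distrib swp_sq contr_swp)
  have 4: "swp i (Suc i) * scal ((1 - \<epsilon> * of_nat CARD('i)) / 2) = scal ((1 - \<epsilon> * of_nat CARD('i)) / 2) * swp i (Suc i)"
    using assms by (simp add: scal_commute_swp)
  show ?thesis
    unfolding jucys_murphy_Suc
    by (simp add: jucys_murphy_def[of i] scal_minus ring_distribs mult.assoc 1 2 3 4 scal_eps_sq)
qed

lemma contr_jucys_murphy_sum:
  assumes "i \<noteq> 0"
  shows "contr i (Suc i) * (jucys_murphy i + jucys_murphy (Suc i)) = 0"
    and "(jucys_murphy i + jucys_murphy (Suc i)) * contr i (Suc i) = 0"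
proof -
  let ?e = "contr i (Suc i)"
  have e: "?e * (scal \<epsilon> * y) = scal \<epsilon> * (?e * y)" for y
    by (rule left_commute_mult) (simp add: scal_eps_commute)
  have 1: "?e * (\<Sum>l<i. casimir l i) = - (?e * (\<Sum>l<i. casimir l (Suc i)))"
    "(\<Sum>l<i. casimir l i) * ?e = - ((\<Sum>l<i. casimir l (Suc i)) * ?e)"
    unfolding sum_distrib_left sum_distrib_right sum_negf[symmetric]
    using assms by (auto intro!: sum.cong contr_casimir)
  have 2: "?e * casimir i (Suc i) = (scal \<epsilon> - scal (of_nat CARD('i))) * ?e"
    "casimir i (Suc i) * ?e = (scal \<epsilon> - scal (of_nat CARD('i))) * ?e"
    using assms by (simp_all add: casimir_eq left_diff_distrib right_diff_distrib contr_sq contr_swp swp_contr)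
  have 3: "?e * scal ((1 - \<epsilon> * of_nat CARD('i)) / 2) = scal ((1 - \<epsilon> * of_nat CARD('i)) / 2) * ?e"
    using assms by (simp add: scal_commute_contr)
  have "\<epsilon> * (\<epsilon> - of_nat CARD('i)) = ((1 - \<epsilon> * of_nat CARD('i)) / 2) + ((1 - \<epsilon> * of_nat CARD('i)) / 2)"
    by (simp add: right_diff_distrib eps_sq)
  then have "scal \<epsilon> * ((scal \<epsilon> - scal (of_nat CARD('i))) * ?e) = scal ((1 - \<epsilon> * of_nat CARD('i)) / 2) * ?e + scal ((1 - \<epsilon> * of_nat CARD('i)) / 2) * ?e"
    by (simp only: mult.assoc[symmetric] scal_diff[symmetric] scal_mult[symmetric] scal_add semiring_class.distrib_right)
  then have 4: "scal \<epsilon> * (scal \<epsilon> * ?e) - scal \<epsilon> * (scal (of_nat CARD('i)) * ?e) = scal ((1 - \<epsilon> * of_nat CARD('i)) / 2) * ?e + scal ((1 - \<epsilon> * of_nat CARD('i)) / 2) * ?e"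
    by (simp add: ring_distribs)
  show "?e * (jucys_murphy i + jucys_murphy (Suc i)) = 0"
    unfolding jucys_murphy_Suc
    by (simp add: jucys_murphy_def[of i] scal_minus ring_distribs e 1 2 3 4)
  show "(jucys_murphy i + jucys_murphy (Suc i)) * ?e = 0"
    unfolding jucys_murphy_Suc
    by (simp add: jucys_murphy_def[of i] scal_minus ring_distribs mult.assoc 1 2 4)
qed

end

section \<open>The central elements\<close>

definition term_sum :: "('i::finite \<Rightarrow> 'g alg_term) \<Rightarrow> 'g alg_term"
  where "term_sum f = foldr (\<lambda>a t. f a \<boxplus> t) (SOME xs. distinct xs \<and> set xs = UNIV) (Scalar 0)"

lemma term_sum_list: "\<exists>xs. distinct xs \<and> set xs = (UNIV :: 'i::finite set) \<and>
    (\<forall>f :: 'i \<Rightarrow> 'g alg_term. term_sum f = foldr (\<lambda>a t. f a \<boxplus> t) xs (Scalar 0))"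
proof -
  have "\<exists>xs. distinct xs \<and> set xs = (UNIV :: 'i set)"
    using finite_distinct_list[of "UNIV :: 'i set"] by auto
  from someI_ex[OF this] show ?thesis
    unfolding term_sum_def by blast
qed

lemma set_term_sum: "set_alg_term (term_sum f) = (\<Union>a. set_alg_term (f a))"
proof -
  obtain xs where xs: "set xs = UNIV" "term_sum f = foldr (\<lambda>a t. f a \<boxplus> t) xs (Scalar 0)"
    using term_sum_list by metis
  have "set_alg_term (foldr (\<lambda>a t. f a \<boxplus> t) xs (Scalar 0)) = (\<Union>a\<in>set xs. set_alg_term (f a))"
    by (induction xs) auto
  then show ?thesis by (simp add: xs)
qed

lemma (in scalar_hom) ring_eval_term_sum:
  "ring_eval scal \<phi> (term_sum f) = (\<Sum>a\<in>UNIV. ring_eval scal \<phi> (f a))"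
proof -
  obtain xs where xs: "distinct xs" "set xs = UNIV"
    "term_sum f = foldr (\<lambda>a t. f a \<boxplus> t) xs (Scalar 0)"
    using term_sum_list by metis
  have "ring_eval scal \<phi> (foldr (\<lambda>a t. f a \<boxplus> t) xs (Scalar 0)) = (\<Sum>a\<leftarrow>xs. ring_eval scal \<phi> (f a))"
    by (induction xs) auto
  then show ?thesis
    using xs by (simp add: sum_list_distinct_conv_sum_set)
qed

text \<open>
  The operator \<open>z\<^sub>1\<close> is a matrix over the enveloping algebra acting on \<open>V\<close>; \<open>power_term l\<close> is its
  l-th power and \<open>trace_term l\<close> the trace of the latter, up to the sign \<open>\<epsilon>\<close>.
\<close>

context invariant_form
begin

definition coeff_term :: "'i \<Rightarrow> 'i \<Rightarrow> 'i cmatrix alg_term"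
  where "coeff_term a b = Scalar (- \<epsilon>) \<boxdot> Gen (munit b a - star (munit b a)) \<boxplus>
    Scalar (if a = b then (1 - \<epsilon> * of_nat CARD('i)) / 2 else 0)"

primrec power_term :: "nat \<Rightarrow> 'i \<Rightarrow> 'i \<Rightarrow> 'i cmatrix alg_term"
  where
    "power_term 0 a b = Scalar (if a = b then 1 else 0)"
  | "power_term (Suc l) a b = term_sum (\<lambda>c. coeff_term a c \<boxdot> power_term l c b)"

definition trace_term :: "nat \<Rightarrow> 'i cmatrix alg_term"
  where "trace_term l = Scalar \<epsilon> \<boxdot> term_sum (\<lambda>a. power_term l a a)"

lemma set_power_term: "set_alg_term (power_term l a b) \<subseteq> lie"
  by (induction l arbitrary: a b) (fastforce simp: set_term_sum coeff_term_def skew_part_in_lie)+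

lemma set_trace_term: "set_alg_term (trace_term l) \<subseteq> lie"
  using set_power_term by (auto simp: trace_term_def set_term_sum)

end

lemma mult_commute_mult: "c * a = a * c \<Longrightarrow> c * b = b * c \<Longrightarrow> a * b * c = c * (a * b)"
  for a :: "'a::semigroup_mult"
  by (metis mult.assoc)

context tensor_ops
begin

definition env_eval :: "'i cmatrix alg_term \<Rightarrow> 'r"
  where "env_eval u = ring_eval scal (\<lambda>A. opr A 0) u"

lemma commute_env_eval:
  assumes "set_alg_term u \<subseteq> lie" "\<And>A. A \<in> lie \<Longrightarrow> x * opr A 0 = opr A 0 * x"
    and "\<And>c. x * scal c = scal c * x"
  shows "x * env_eval u = env_eval u * x"
  unfolding env_eval_def using assms by (intro ring_eval_commute) auto

lemma opr_env_eval:
  assumes "set_alg_term u \<subseteq> lie" "i \<noteq> 0"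
  shows "opr X i * env_eval u = env_eval u * opr X i"
  using assms by (intro commute_env_eval) (simp_all add: opr0_commute linD[OF lin_opr])

lemma scal_env_eval:
  assumes "set_alg_term u \<subseteq> lie"
  shows "scal c * env_eval u = env_eval u * scal c"
  using assms by (intro commute_env_eval) (simp_all add: opr0_scal scal_commute)

lemma env_eval_power_Suc:
  "env_eval (power_term (Suc l) a b) = (\<Sum>c\<in>UNIV. env_eval (coeff_term a c) * env_eval (power_term l c b))"
  by (simp add: env_eval_def ring_eval_term_sum)

lemma env_eval_trace_term:
  "env_eval (trace_term l) = scal \<epsilon> * (\<Sum>a\<in>UNIV. env_eval (power_term l a a))"
  by (simp add: env_eval_def ring_eval_term_sum trace_term_def)

lemma jucys_murphy_1:
  "jucys_murphy (Suc 0) = (\<Sum>a\<in>UNIV. \<Sum>b\<in>UNIV. opr (munit a b) (Suc 0) * env_eval (coeff_term a b))"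
proof -
  have 1: "env_eval (coeff_term a b) = scal (- \<epsilon>) * skew_opr 0 (munit b a) +
      scal (if a = b then (1 - \<epsilon> * of_nat CARD('i)) / 2 else 0)" for a b
    by (simp add: env_eval_def coeff_term_def skew_opr_def)
  have "opr (munit a b) (Suc 0) * (scal \<epsilon> * skew_opr 0 (munit b a)) =
      scal \<epsilon> * (skew_opr 0 (munit b a) * opr (munit a b) (Suc 0))" for a b
    by (metis scal_eps_commute mult.assoc skew_opr_commute nat.distinct(1))
  then have "(\<Sum>a\<in>UNIV. \<Sum>b\<in>UNIV. opr (munit a b) (Suc 0) * env_eval (coeff_term a b)) =
      (\<Sum>a\<in>UNIV. \<Sum>b\<in>UNIV. scal (- \<epsilon>) * (skew_opr 0 (munit b a) * opr (munit a b) (Suc 0))) +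
      (\<Sum>a\<in>UNIV. \<Sum>b\<in>UNIV. opr (munit a b) (Suc 0) *
        scal (if a = b then (1 - \<epsilon> * of_nat CARD('i)) / 2 else 0))"
    by (simp add: 1 ring_distribs sum.distrib scal_minus sum_negf sum_subtractf)
  also have "(\<Sum>a\<in>UNIV. \<Sum>b\<in>UNIV. scal (- \<epsilon>) * (skew_opr 0 (munit b a) * opr (munit a b) (Suc 0))) =
      scal (- \<epsilon>) * casimir 0 (Suc 0)"
    by (subst sum.swap) (simp add: casimir_def csum_def sum_distrib_left)
  also have "(\<Sum>a\<in>UNIV. \<Sum>b\<in>UNIV. opr (munit a b) (Suc 0) *
        scal (if a = b then (1 - \<epsilon> * of_nat CARD('i)) / 2 else 0)) =
      (\<Sum>a\<in>UNIV. opr (munit a a) (Suc 0)) * scal ((1 - \<epsilon> * of_nat CARD('i)) / 2)"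
    by (simp add: if_distrib[of scal] if_distrib[of "\<lambda>x. c * x" for c] sum_distrib_right cong: if_cong)
  also have "(\<Sum>a\<in>UNIV. opr (munit a a) (Suc 0)) = 1"
    by (simp add: lin_sum[OF lin_opr, symmetric] sum_munit_diag opr_one)
  finally show ?thesis
    by (simp add: jucys_murphy_def)
qed

lemma jucys_murphy_1_power:
  "jucys_murphy (Suc 0) ^ l = (\<Sum>a\<in>UNIV. \<Sum>b\<in>UNIV. opr (munit a b) (Suc 0) * env_eval (power_term l a b))"
proof (induction l)
  case 0
  have "(\<Sum>a\<in>UNIV. \<Sum>b\<in>UNIV. opr (munit a b) (Suc 0) * env_eval (power_term 0 a b)) =
      (\<Sum>a\<in>UNIV. opr (munit a a) (Suc 0))"
    by (simp add: env_eval_def if_distrib[of scal] if_distrib[of "\<lambda>x. c * x" for c] cong: if_cong)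
  also have "(\<Sum>a\<in>UNIV. opr (munit a a) (Suc 0)) = 1"
    by (simp add: lin_sum[OF lin_opr, symmetric] sum_munit_diag opr_one)
  finally show ?case by simp
next
  case (Suc l)
  have "env_eval (coeff_term a b) * opr X (Suc 0) = opr X (Suc 0) * env_eval (coeff_term a b)" for a b X
    by (intro opr_env_eval[symmetric]) (simp_all add: coeff_term_def skew_part_in_lie)
  then have *: "opr (munit a b) (Suc 0) * env_eval (coeff_term a b) * (opr (munit c d) (Suc 0) * y) =
      (if b = c then opr (munit a d) (Suc 0) * (env_eval (coeff_term a b) * y) else 0)" for a b c d y
    by (simp add: mult.assoc left_commute_mult[of "env_eval _"])
      (simp add: mult.assoc[symmetric] opr_mult munit_munit linD[OF lin_opr])
  have "jucys_murphy (Suc 0) ^ Suc l =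
      (\<Sum>a\<in>UNIV. \<Sum>b\<in>UNIV. \<Sum>c\<in>UNIV. \<Sum>d\<in>UNIV. opr (munit a b) (Suc 0) * env_eval (coeff_term a b) *
        (opr (munit c d) (Suc 0) * env_eval (power_term l c d)))"
    unfolding power_Suc Suc unfolding jucys_murphy_1 sum_distrib_right unfolding sum_distrib_left ..
  also have "\<dots> = (\<Sum>a\<in>UNIV. \<Sum>b\<in>UNIV. \<Sum>d\<in>UNIV.
      opr (munit a d) (Suc 0) * (env_eval (coeff_term a b) * env_eval (power_term l b d)))"
    by (simp add: * sum_if_const)
  also have "\<dots> = (\<Sum>a\<in>UNIV. \<Sum>d\<in>UNIV. \<Sum>b\<in>UNIV.
      opr (munit a d) (Suc 0) * (env_eval (coeff_term a b) * env_eval (power_term l b d)))"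
    by (intro sum.cong HOL.refl sum.swap)
  finally show ?case
    by (simp add: env_eval_power_Suc sum_distrib_left del: power_term.simps)
qed

lemma contr_jucys_murphy_power:
  "contr (Suc 0) 2 * jucys_murphy (Suc 0) ^ l * contr (Suc 0) 2 = scal \<epsilon> * env_eval (trace_term l) * contr (Suc 0) 2"
proof -
  have comm: "env_eval (power_term l a b) * contr (Suc 0) 2 = contr (Suc 0) 2 * env_eval (power_term l a b)" for a b
    by (intro commute_contr opr_env_eval[symmetric] set_power_term) simp_all
  have "contr (Suc 0) 2 * jucys_murphy (Suc 0) ^ l * contr (Suc 0) 2 =
      (\<Sum>a\<in>UNIV. \<Sum>b\<in>UNIV. contr (Suc 0) 2 * opr (munit a b) (Suc 0) * contr (Suc 0) 2 * env_eval (power_term l a b))"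
    by (simp add: jucys_murphy_1_power sum_distrib_left sum_distrib_right mult.assoc comm)
  also have "\<dots> = contr (Suc 0) 2 * (\<Sum>a\<in>UNIV. env_eval (power_term l a a))"
    by (simp add: contr_opr_contr trace_munit if_distrib[of scal] if_distrib[of "\<lambda>x. x * c" for c]
        sum_distrib_left cong: if_cong)
  also have "\<dots> = (\<Sum>a\<in>UNIV. env_eval (power_term l a a)) * contr (Suc 0) 2"
    by (simp add: sum_distrib_left sum_distrib_right comm)
  finally show ?thesis
    by (simp add: env_eval_trace_term mult.assoc scal_eps_sq)
qed

lemma commute_trace_term:
  assumes "d * contr (Suc 0) 2 = contr (Suc 0) 2 * d" "d * jucys_murphy (Suc 0) = jucys_murphy (Suc 0) * d"
  shows "d * (env_eval (trace_term l) * contr (Suc 0) 2) = env_eval (trace_term l) * contr (Suc 0) 2 * d"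
proof -
  have "d * jucys_murphy (Suc 0) ^ l = jucys_murphy (Suc 0) ^ l * d"
    by (induction l) (simp_all add: left_commute_mult[OF assms(2)] mult.assoc)
  then have "d * (contr (Suc 0) 2 * jucys_murphy (Suc 0) ^ l * contr (Suc 0) 2) =
      contr (Suc 0) 2 * jucys_murphy (Suc 0) ^ l * contr (Suc 0) 2 * d"
    using assms(1) by (simp add: mult.assoc left_commute_mult[of d])
  moreover have "env_eval (trace_term l) * contr (Suc 0) 2 =
      scal \<epsilon> * (contr (Suc 0) 2 * jucys_murphy (Suc 0) ^ l * contr (Suc 0) 2)"
    unfolding contr_jucys_murphy_power by (simp add: mult.assoc scal_eps_sq)
  moreover have "d * (scal \<epsilon> * y) = scal \<epsilon> * (d * y)" for y
    by (rule left_commute_mult) (simp add: scal_eps_commute)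
  ultimately show ?thesis
    by (simp add: mult.assoc)
qed

text \<open>
  The trace is central since \<open>z\<^sub>1\<close> commutes with the diagonal action on the factors 0, 1, 2, and the
  contraction absorbs the action on the factors 1, 2.
\<close>

lemma trace_term_central:
  assumes "A \<in> lie"
  shows "opr A 0 * env_eval (trace_term l) = env_eval (trace_term l) * opr A 0"
proof -
  let ?c = "contr (Suc 0) 2" and ?w = "env_eval (trace_term l)"
  define B where "B = opr A (Suc 0) + opr A 2"
  have A: "opr A 0 * ?c = ?c * opr A 0"
    using assms by (intro commute_contr) (simp_all add: opr0_commute)
  have B: "?c * B = 0" "B * ?c = 0"
    using contr_lie[OF assms, of "Suc 0" 2] by (simp_all add: B_def)
  have "(opr A 0 + B) * ?c = ?c * (opr A 0 + B)"
    using A B by (simp add: ring_distribs)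
  moreover have "opr A 2 * casimir 0 (Suc 0) = casimir 0 (Suc 0) * opr A 2"
    using assms by (intro commute_casimir) (simp_all add: opr_commute skew_opr_commute)
  then have "(opr A 0 + B) * casimir 0 (Suc 0) = casimir 0 (Suc 0) * (opr A 0 + B)"
    using casimir_invariant[OF assms, of "Suc 0" 0] by (simp add: B_def ring_distribs add.assoc[symmetric])
  moreover have "(opr A 0 + B) * scal c = scal c * (opr A 0 + B)" for c
    using assms by (simp add: B_def ring_distribs opr0_scal linD[OF lin_opr])
  ultimately have *: "(opr A 0 + B) * (?w * ?c) = ?w * ?c * (opr A 0 + B)"
    by (intro commute_trace_term commute_jucys_murphy) simp_all
  have "B * ?w = ?w * B"
    using opr_env_eval[OF set_trace_term] by (simp add: B_def ring_distribs)
  then have "B * (?w * ?c) = 0"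
    using B by (simp add: left_commute_mult[of B])
  from \<open>B * (?w * ?c) = 0\<close> * B A have "opr A 0 * ?w * ?c = ?w * opr A 0 * ?c"
    by (simp add: ring_distribs mult.assoc)
  moreover have "opr A 0 * ?w * opr C (Suc 0) = opr C (Suc 0) * (opr A 0 * ?w)"
    "?w * opr A 0 * opr C (Suc 0) = opr C (Suc 0) * (?w * opr A 0)" for C
    using opr_env_eval[OF set_trace_term, of "Suc 0" C] opr0_commute[of "Suc 0" A C] assms
    by (auto intro!: mult_commute_mult)
  ultimately show ?thesis
    using contr_cancel[of "Suc 0" 2 "opr A 0 * ?w" "?w * opr A 0"] by fastforce
qed

end

section \<open>The defining relations\<close>

context tensor_ops
begin

lemma scal_eps_cases: obtains "scal \<epsilon> = 1" | "scal \<epsilon> = -1"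
  by (cases rule: eps_cases) (simp_all add: scal_minus)

lemma swp_braid:
  assumes "a \<noteq> 0" "b \<noteq> 0" "c \<noteq> 0" "a \<noteq> b" "b \<noteq> c" "a \<noteq> c"
  shows "swp a b * swp b c * swp a b = swp b c * swp a b * swp b c"
proof -
  have "swp a b * swp b c * swp a b = swp a c"
    unfolding swp_conj_swp[OF assms] using assms by (simp add: mult.assoc swp_sq)
  moreover have "swp b c * swp a b = swp a c * swp b c"
    using assms swp_conj_swp[of c b a] by (simp add: swp_sym[of c] swp_sym[of b a])
  then have "swp b c * swp a b * swp b c = swp a c"
    using assms by (simp add: mult.assoc swp_sq)
  ultimately show ?thesis by simp
qed

lemma swp_contr_conj:
  assumes "a \<noteq> 0" "b \<noteq> 0" "c \<noteq> 0" "a \<noteq> b" "b \<noteq> c" "a \<noteq> c"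
  shows "swp a b * swp b c * contr a b * swp b c * swp a b = contr b c"
proof -
  have 1: "swp b c * contr a b = contr a c * swp b c"
    using assms swp_conj_contr[of c b a] by (simp add: swp_sym[of c] contr_sym[of b a] contr_sym[of c a])
  have 2: "swp a b * contr a c = contr b c * swp a b"
    using assms swp_conj_contr[of b a c] by (simp add: swp_sym[of b])
  have "swp a b * swp b c * contr a b * swp b c * swp a b =
      swp a b * contr a c * (swp b c * swp b c) * swp a b"
    using 1 by (simp add: mult.assoc)
  also have "\<dots> = contr b c * (swp a b * swp a b)"
    using assms 2 by (simp add: swp_sq mult.assoc)
  finally show ?thesis
    using assms by (simp add: swp_sq)
qed

lemma contr_tangle:
  assumes "a \<noteq> 0" "b \<noteq> 0" "c \<noteq> 0" "a \<noteq> b" "b \<noteq> c" "a \<noteq> c"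
  shows "contr a b * contr b c * contr a b = contr a b"
    and "swp a b * contr b c * contr a b = scal \<epsilon> * (swp b c * contr a b)"
    and "contr a b * contr b c * swp a b = scal \<epsilon> * (contr a b * swp b c)"
proof -
  have 1: "contr a b * contr b c = swp a c * contr b c"
    using assms contr_contr[of c b a] by (simp add: swp_sym[of c] contr_sym[of b a] contr_sym[of c b])
  have 2: "contr b c * contr a b = swp a c * contr a b"
    using assms by (simp add: contr_contr)
  have 3: "contr a b * contr b c = contr a b * swp a c"
    using assms by (simp add: contr_contr')
  show "contr a b * contr b c * contr a b = contr a b"
    using assms by (simp add: 1 mult.assoc 2) (simp add: mult.assoc[symmetric] swp_sq)
  have "swp a b * swp a c = swp b c * swp a b"
    using assms swp_conj_swp[of b a c] by (simp add: swp_sym[of b a])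
  then have "swp a b * (swp a c * contr a b) = swp b c * (swp a b * contr a b)"
    by (metis mult.assoc)
  then show "swp a b * contr b c * contr a b = scal \<epsilon> * (swp b c * contr a b)"
    using assms by (simp add: mult.assoc 2 swp_contr left_commute_mult[of "swp b c" "scal \<epsilon>"] scal_eps_commute)
  have "swp a c * swp a b = swp a b * swp b c"
    using assms swp_conj_swp[of a b c] by simp
  then have "contr a b * swp a c * swp a b = contr a b * swp a b * swp b c"
    by (simp add: mult.assoc)
  then show "contr a b * contr b c * swp a b = scal \<epsilon> * (contr a b * swp b c)"
    using assms by (simp add: 3 contr_swp mult.assoc)
qed

primrec bvw_elem :: "'i cmatrix \<Rightarrow> bvw_gen \<Rightarrow> 'r"
  where
    "bvw_elem \<xi> (T i) = scal \<epsilon> * swp i (Suc i)"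
  | "bvw_elem \<xi> (E i) = scal \<epsilon> * contr i (Suc i)"
  | "bvw_elem \<xi> (Z i) = jucys_murphy i"
  | "bvw_elem \<xi> (Th i) = opr \<xi> i"
  | "bvw_elem \<xi> (W l) = env_eval (trace_term l)"

lemma symmetric_rels_hold:
  assumes "(a, b) \<in> symmetric_rels k"
  shows "ring_eval scal (bvw_elem \<xi>) a = ring_eval scal (bvw_elem \<xi>) b"
  using assms
proof (cases rule: symmetric_rels.cases)
  case (t_square i)
  then show ?thesis
    by (cases rule: scal_eps_cases) (simp_all add: scal_minus swp_sq)
next
  case (t_braid i)
  then show ?thesis
    using swp_braid[of i "Suc i" "Suc (Suc i)"] by (cases rule: scal_eps_cases) (simp_all add: scal_minus)
next
  case (t_t i j)
  then have "swp i (Suc i) * swp j (Suc j) = swp j (Suc j) * swp i (Suc i)"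
    by (intro commute_swp commute_swp[symmetric] opr_commute) auto
  with t_t show ?thesis
    by (cases rule: scal_eps_cases) (simp_all add: scal_minus)
qed

lemma brauer_rels_hold:
  assumes "(a, b) \<in> brauer_rels k (\<epsilon> * of_nat CARD('i))"
  shows "ring_eval scal (bvw_elem \<xi>) a = ring_eval scal (bvw_elem \<xi>) b"
  using assms
proof (cases rule: brauer_rels.cases)
  case symmetric
  then show ?thesis by (auto intro: symmetric_rels_hold)
next
  case (e_square i)
  then show ?thesis
    by (cases rule: scal_eps_cases) (simp_all add: scal_mult contr_sq)
next
  case (t_e i)
  then show ?thesis
    using swp_contr[of i "Suc i"] by (cases rule: scal_eps_cases) (simp_all add: scal_minus)
next
  case (e_t i)
  then show ?thesis
    using contr_swp[of i "Suc i"] by (cases rule: scal_eps_cases) (simp_all add: scal_minus)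
next
  case (conjugate i)
  then show ?thesis
    using swp_contr_conj[of i "Suc i" "Suc (Suc i)"]
    by (cases rule: scal_eps_cases) (simp_all add: scal_minus)
next
  case (t_e_commute i j)
  then have "swp i (Suc i) * contr j (Suc j) = contr j (Suc j) * swp i (Suc i)"
    by (intro commute_contr commute_swp[symmetric] opr_commute) auto
  with t_e_commute show ?thesis
    by (cases rule: scal_eps_cases) (simp_all add: scal_minus)
next
  case (e_e_commute i j)
  then have "contr i (Suc i) * contr j (Suc j) = contr j (Suc j) * contr i (Suc i)"
    by (intro commute_contr commute_contr[symmetric] opr_commute) auto
  with e_e_commute show ?thesis
    by (cases rule: scal_eps_cases) (simp_all add: scal_minus)
next
  case (tangle i j)
  then show ?thesis
    using contr_tangle[of i "Suc i" "Suc (Suc i)"] contr_tangle[of "Suc (Suc j)" "Suc j" j]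
    by (cases rule: scal_eps_cases)
      (auto simp: scal_minus swp_sym[of "Suc (Suc j)" "Suc j"] swp_sym[of "Suc j" j]
        contr_sym[of "Suc (Suc j)" "Suc j"] contr_sym[of "Suc j" j])
next
  case (tangle_left i j)
  then show ?thesis
    using contr_tangle[of i "Suc i" "Suc (Suc i)"] contr_tangle[of "Suc (Suc j)" "Suc j" j]
    by (cases rule: scal_eps_cases)
      (auto simp: scal_minus swp_sym[of "Suc (Suc j)" "Suc j"] swp_sym[of "Suc j" j]
        contr_sym[of "Suc (Suc j)" "Suc j"] contr_sym[of "Suc j" j])
next
  case (tangle_right i j)
  then show ?thesis
    using contr_tangle[of i "Suc i" "Suc (Suc i)"] contr_tangle[of "Suc (Suc j)" "Suc j" j]
    by (cases rule: scal_eps_cases)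
      (auto simp: scal_minus swp_sym[of "Suc (Suc j)" "Suc j"] swp_sym[of "Suc j" j]
        contr_sym[of "Suc (Suc j)" "Suc j"] contr_sym[of "Suc j" j])
qed

lemma vw_rels_hold:
  assumes "(a, b) \<in> vw_rels k (\<epsilon> * of_nat CARD('i)) w"
    and w: "\<And>l. ring_eval scal (bvw_elem \<xi>) (w l) = env_eval (trace_term l)"
  shows "ring_eval scal (bvw_elem \<xi>) a = ring_eval scal (bvw_elem \<xi>) b"
  using assms(1)
proof (cases rule: vw_rels.cases)
  case brauer
  then show ?thesis by (auto intro: brauer_rels_hold)
next
  case (t_z i)
  then show ?thesis
    using swp_jucys_murphy[of i] by (cases rule: scal_eps_cases) (simp_all add: scal_minus algebra_simps)
next
  case (t_z_commute i j)
  then show ?thesis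
    using swp_jucys_murphy_commute[of i j] by (cases rule: scal_eps_cases) (simp_all add: scal_minus)
next
  case (e_z_commute i j)
  then show ?thesis
    using contr_jucys_murphy_commute[of i j] by (cases rule: scal_eps_cases) (simp_all add: scal_minus)
next
  case (e_z i)
  then show ?thesis
    using contr_jucys_murphy_sum(1)[of i] by (simp add: mult.assoc)
next
  case (z_e i)
  then show ?thesis
    using contr_jucys_murphy_sum(2)[of i]
    by (cases rule: scal_eps_cases) (simp_all add: scal_minus)
next
  case (z_z i j)
  then show ?thesis by (simp add: jucys_murphy_commute)
next
  case (e_z_e l)
  then show ?thesis
    using contr_jucys_murphy_power[of l]
    by (cases rule: scal_eps_cases) (simp_all add: scal_minus w ring_eval_power numeral_2_eq_2)
qed

lemma bvw_rels_hold:
  assumes "(a, b) \<in> bvw_rels k (\<epsilon> * of_nat CARD('i)) m \<epsilon> w"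
    and w: "\<And>l. ring_eval scal (bvw_elem \<xi>) (w l) = env_eval (trace_term l)"
    and \<xi>: "\<xi> ** \<xi> = mat 1" "star \<xi> = mscale \<epsilon> \<xi>" "trace \<xi> = m"
  shows "ring_eval scal (bvw_elem \<xi>) a = ring_eval scal (bvw_elem \<xi>) b"
  using assms(1)
proof (cases rule: bvw_rels.cases)
  case vw
  then show ?thesis using w by (auto intro: vw_rels_hold)
next
  case (th_square i)
  then show ?thesis by (simp add: opr_mult \<xi> opr_one)
next
  case (th_th i j)
  then show ?thesis by (cases "i = j") (simp_all add: opr_commute)
next
  case (t_th i)
  then have "swp i (Suc i) * opr \<xi> i * swp i (Suc i) = opr \<xi> (Suc i)"
    by (simp add: swp_opr[symmetric] mult.assoc swp_sq)
  with t_th show ?thesis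
    by (cases rule: scal_eps_cases) (simp_all add: scal_minus)
next
  case (t_th_commute i j)
  then have "swp i (Suc i) * opr \<xi> j = opr \<xi> j * swp i (Suc i)"
    by (intro commute_swp[symmetric] opr_commute) auto
  with t_th_commute show ?thesis
    by (cases rule: scal_eps_cases) (simp_all add: scal_minus)
next
  case (e_th_commute i j)
  then have "contr i (Suc i) * opr \<xi> j = opr \<xi> j * contr i (Suc i)"
    by (intro commute_contr[symmetric] opr_commute) auto
  with e_th_commute show ?thesis
    by (cases rule: scal_eps_cases) (simp_all add: scal_minus)
next
  case (e_th_th i)
  then have "contr i (Suc i) * opr \<xi> i * opr \<xi> (Suc i) = contr i (Suc i) * opr (star \<xi> ** \<xi>) (Suc i)"
    by (simp add: contr_opr opr_mult[symmetric] mult.assoc)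
  with e_th_th show ?thesis
    by (cases rule: scal_eps_cases) (simp_all add: scal_minus \<xi> linD[OF lin_opr] opr_one mscale_distrib)
next
  case (th_th_e i)
  then have "opr \<xi> i * opr \<xi> (Suc i) * contr i (Suc i) = opr (\<xi> ** star \<xi>) i * contr i (Suc i)"
    by (simp add: opr_contr' opr_mult[symmetric] mult.assoc)
  with th_th_e show ?thesis
    by (cases rule: scal_eps_cases) (simp_all add: scal_minus \<xi> linD[OF lin_opr] opr_one mscale_distrib)
next
  case (th_z j)
  then have "opr \<xi> k * casimir l j = casimir l j * opr \<xi> k" if "l < j" for l
    using that by (intro commute_casimir opr_commute skew_opr_commute[symmetric]) auto
  with th_z have "opr \<xi> k * jucys_murphy j = jucys_murphy j * opr \<xi> k"
    by (intro commute_jucys_murphy commute_sum) (auto simp: linD[OF lin_opr])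
  with th_z show ?thesis by simp
next
  case (e_th_e i)
  have "m = \<epsilon> * m"
    using trace_star[of \<xi>] \<xi> by simp
  then have "scal m = scal \<epsilon> * scal m"
    by (simp only: scal_mult[symmetric])
  with e_th_e show ?thesis
    using contr_opr_contr[of i "Suc i" \<xi>] \<xi>
    by (cases rule: scal_eps_cases) (simp, simp, metis mult_minus_left)
qed

lemma bvw_elem_scal:
  assumes "g \<in> generic_bvw_gens k"
  shows "scal c * bvw_elem \<xi> g = bvw_elem \<xi> g * scal c"
proof -
  have eps: "scal c * (scal \<epsilon> * x) = scal \<epsilon> * x * scal c" if "scal c * x = x * scal c" for x
    using that by (simp add: left_commute_mult[of "scal c"] scal_eps_commute mult.assoc)
  from assms consider i where "g = T i" "i \<noteq> 0" | i where "g = E i" "i \<noteq> 0" | i where "g = Z i" "i \<noteq> 0"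
    | i where "g = Th i" "i \<noteq> 0" | l where "g = W l"
    by (auto simp: generic_bvw_gens_def bvw_gens_def)
  then show ?thesis
  proof cases
    case 3
    then show ?thesis
      by (simp add: commute_jucys_murphy commute_sum scal_commute_casimir scal_commute)
  qed (simp_all add: eps[OF scal_commute_swp] eps[OF scal_commute_contr] linD[OF lin_opr] scal_env_eval set_trace_term)
qed

lemma bvw_elem_W_commute:
  assumes "g \<in> generic_bvw_gens k"
  shows "bvw_elem \<xi> (W l) * bvw_elem \<xi> g = bvw_elem \<xi> g * bvw_elem \<xi> (W l)"
proof -
  let ?w = "env_eval (trace_term l)"
  have eps: "?w * (scal \<epsilon> * x) = scal \<epsilon> * x * ?w" if "?w * x = x * ?w" for x
    using that by (simp add: left_commute_mult[of "?w"] scal_eps_commute mult.assoc)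
  have opr: "?w * opr X i = opr X i * ?w" if "i \<noteq> 0" for X i
    using that by (simp add: opr_env_eval set_trace_term)
  have opr0: "?w * opr A 0 = opr A 0 * ?w" if "A \<in> lie" for A
    using that by (simp add: trace_term_central)
  have scal: "?w * scal c = scal c * ?w" for c
    by (simp add: scal_env_eval set_trace_term)
  from assms consider i where "g = T i" "i \<noteq> 0" | i where "g = E i" "i \<noteq> 0" | i where "g = Z i" "i \<noteq> 0"
    | i where "g = Th i" "i \<noteq> 0" | l where "g = W l"
    by (auto simp: generic_bvw_gens_def bvw_gens_def)
  then show ?thesis
  proof cases
    case 1
    then show ?thesis by (simp add: eps commute_swp opr)
  next
    case 2
    then show ?thesis by (simp add: eps commute_contr opr)
  next
    case (3 i)
    have "?w * skew_opr j X = skew_opr j X * ?w" for j X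
      by (cases "j = 0") (simp_all add: skew_opr_def opr opr0 skew_part_in_lie)
    with 3 show ?thesis
      by (simp add: commute_jucys_murphy commute_sum commute_casimir opr scal)
  next
    case 4
    then show ?thesis by (simp add: opr)
  next
    case (5 m)
    then show ?thesis
      by (simp add: commute_env_eval set_trace_term opr0 scal)
  qed
qed

end


section \<open>Group elements\<close>

locale tensor_ops_group = tensor_ops J \<epsilon> scal opr
  for J :: "'i::finite cmatrix" and \<epsilon> :: complex and scal :: "complex \<Rightarrow> 'r::{ring, monoid_mult}" and opr +
  fixes \<sigma> :: 'r and g :: "'i cmatrix"
  assumes star_g: "star g ** g = mat 1" "g ** star g = mat 1"
    and \<sigma>_opr: "i \<noteq> 0 \<Longrightarrow> \<sigma> * opr A i = opr A i * \<sigma>"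
    and \<sigma>_opr0: "A \<in> lie \<Longrightarrow> \<sigma> * opr A 0 = opr (g ** A ** star g) 0 * \<sigma>"
    and \<sigma>_scal: "\<sigma> * scal c = scal c * \<sigma>"
begin

primrec group_op :: "nat \<Rightarrow> 'r"
  where
    "group_op 0 = \<sigma>"
  | "group_op (Suc k) = opr g (Suc k) * group_op k"

lemma conj_lie: "A \<in> lie \<Longrightarrow> g ** A ** star g \<in> lie"
  by (simp add: lie_def star_mult matrix_mult_distrib matrix_mul_assoc)

lemma group_op_opr_beyond: "i > k \<Longrightarrow> group_op k * opr A i = opr A i * group_op k"
proof (induction k)
  case (Suc k)
  then have "opr g (Suc k) * (opr A i * group_op k) = opr A i * (opr g (Suc k) * group_op k)"
    by (intro left_commute_mult opr_commute) auto
  with Suc show ?case by (simp add: mult.assoc)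
qed (simp add: \<sigma>_opr)

lemma group_op_opr:
  "\<lbrakk>i \<noteq> 0; i \<le> k\<rbrakk> \<Longrightarrow> group_op k * opr A i = opr (g ** A ** star g) i * group_op k"
proof (induction k)
  case (Suc k)
  show ?case
  proof (cases "i = Suc k")
    case True
    then have "group_op (Suc k) * opr A i = opr g i * opr A i * group_op k"
      by (simp add: group_op_opr_beyond mult.assoc)
    also have "opr g i * opr A i = opr (g ** A ** star g) i * opr g i"
      using Suc by (simp add: opr_mult matrix_mul_assoc[symmetric] star_g)
    finally show ?thesis
      using True by (simp add: mult.assoc)
  next
    case False
    with Suc have "opr g (Suc k) * (opr (g ** A ** star g) i * group_op k) =
        opr (g ** A ** star g) i * (opr g (Suc k) * group_op k)"
      by (intro left_commute_mult opr_commute) auto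
    with Suc False show ?thesis by (simp add: mult.assoc)
  qed
qed simp

lemma group_op_opr0: "A \<in> lie \<Longrightarrow> group_op k * opr A 0 = opr (g ** A ** star g) 0 * group_op k"
proof (induction k)
  case (Suc k)
  then have "opr g (Suc k) * (opr (g ** A ** star g) 0 * group_op k) =
        opr (g ** A ** star g) 0 * (opr g (Suc k) * group_op k)"
    by (intro left_commute_mult opr0_commute[symmetric] conj_lie) auto
  with Suc show ?case by (simp add: mult.assoc)
qed (simp add: \<sigma>_opr0)

lemma group_op_scal: "group_op k * scal c = scal c * group_op k"
proof (induction k)
  case (Suc k)
  have "opr g (Suc k) * (scal c * group_op k) = scal c * (opr g (Suc k) * group_op k)"
    by (intro left_commute_mult) (simp add: linD[OF lin_opr])
  with Suc show ?case by (simp add: mult.assoc)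
qed (simp add: \<sigma>_scal)

lemma group_op_skew_opr:
  assumes "l \<le> k"
  shows "group_op k * skew_opr l X = skew_opr l (g ** X ** star g) * group_op k"
proof -
  have "g ** (X - star X) ** star g = g ** X ** star g - star (g ** X ** star g)"
    by (simp add: star_mult matrix_mult_distrib matrix_mul_assoc)
  then show ?thesis
    using assms by (cases "l = 0") (simp_all add: skew_opr_def group_op_opr0 group_op_opr skew_part_in_lie)
qed

lemma csum_conj:
  assumes f: "lin f" and h: "lin h"
  shows "csum (\<lambda>X. f (g ** X ** star g)) (\<lambda>X. h (g ** X ** star g)) = csum f h"
proof -
  define f' where "f' Y = f (Y ** star g)" for Y
  define h' where "h' Y = h (g ** Y ** star g)" for Y
  have h': "lin h'"
    unfolding h'_def by (intro lin_comp(1)[where A = g and f = "\<lambda>X. h (X ** star g)", unfolded matrix_mul_assoc] lin_comp h)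
  have f': "lin f'"
    unfolding f'_def by (intro lin_comp f)
  have "csum (\<lambda>X. f' (g ** X)) h' = csum f' (\<lambda>X. h' (X ** g))"
    by (rule csum_shift'[OF f' h'])
  also have "\<dots> = csum f (\<lambda>X. h' (star g ** X ** g))"
    unfolding f'_def using csum_shift[OF f lin_comp(2)[OF h']] by simp
  also have "(\<lambda>X. h' (star g ** X ** g)) = h"
    by (simp add: fun_eq_iff h'_def matrix_mul_assoc star_g)
      (simp add: matrix_mul_assoc[symmetric] star_g)
  finally show ?thesis
    by (simp add: f'_def h'_def matrix_mul_assoc)
qed

lemma group_op_swp:
  assumes "i \<noteq> 0" "j \<noteq> 0" "i \<le> k" "j \<le> k"
  shows "group_op k * swp i j = swp i j * group_op k"
proof -
  have "group_op k * swp i j = csum (\<lambda>X. opr (g ** X ** star g) i) (\<lambda>X. opr (g ** X ** star g) j) * group_op k"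
    unfolding swp_def using assms by (intro csum_move group_op_opr)
  then show ?thesis
    using assms by (simp add: csum_conj[OF lin_opr lin_opr] swp_def)
qed

lemma group_op_contr:
  assumes "i \<noteq> 0" "j \<noteq> 0" "i \<le> k" "j \<le> k"
  shows "group_op k * contr i j = contr i j * group_op k"
proof -
  have "group_op k * contr i j = csum (\<lambda>X. opr (g ** star X ** star g) i) (\<lambda>X. opr (g ** X ** star g) j) * group_op k"
    unfolding contr_def using assms by (intro csum_move group_op_opr)
  moreover have "g ** star X ** star g = star (g ** X ** star g)" for X
    by (simp add: star_mult matrix_mul_assoc)
  ultimately show ?thesis
    using assms by (simp add: csum_conj[OF lin_star[OF lin_opr] lin_opr] contr_def)
qed

lemma group_op_casimir:
  assumes "i \<noteq> 0" "l \<le> k" "i \<le> k"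
  shows "group_op k * casimir l i = casimir l i * group_op k"
proof -
  have "group_op k * casimir l i = csum (\<lambda>X. skew_opr l (g ** X ** star g)) (\<lambda>X. opr (g ** X ** star g) i) * group_op k"
    unfolding casimir_def using assms by (intro csum_move group_op_opr group_op_skew_opr)
  then show ?thesis
    using assms by (simp add: csum_conj[OF lin_skew_opr lin_opr] casimir_def)
qed

lemma group_op_jucys_murphy:
  assumes "i \<noteq> 0" "i \<le> k"
  shows "group_op k * jucys_murphy i = jucys_murphy i * group_op k"
  using assms by (intro commute_jucys_murphy commute_sum group_op_casimir group_op_scal) auto

lemma \<sigma>_trace_term: "\<sigma> * env_eval (trace_term l) = env_eval (trace_term l) * \<sigma>"
proof -
  let ?c = "contr (Suc 0) 2" and ?w = "env_eval (trace_term l)"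
  define h where "h = opr g 2 * opr g (Suc 0)"
  have op: "group_op 2 = h * \<sigma>"
    by (simp add: h_def numeral_2_eq_2 mult.assoc)
  have "group_op 2 * (?w * ?c) = ?w * ?c * group_op 2"
    by (intro commute_trace_term group_op_contr group_op_jucys_murphy) simp_all
  also have "\<dots> = ?w * (group_op 2 * ?c)"
    by (simp add: group_op_contr mult.assoc)
  finally have *: "h * \<sigma> * (?w * ?c) = ?w * (h * \<sigma> * ?c)"
    by (simp add: op)
  have \<sigma>c: "\<sigma> * ?c = ?c * \<sigma>"
    by (intro commute_contr) (simp_all add: \<sigma>_opr)
  have \<sigma>h: "\<sigma> * h = h * \<sigma>"
    by (simp add: h_def \<sigma>_opr mult.assoc left_commute_mult[of \<sigma>])
  have wh: "?w * h = h * ?w"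
    using opr_env_eval[OF set_trace_term] by (simp add: h_def mult.assoc left_commute_mult[of ?w])
  have wc: "?w * ?c = ?c * ?w"
    by (intro commute_contr) (simp_all add: opr_env_eval set_trace_term)
  have "h * ?c = opr g 2 * (opr (star g) 2 * ?c)"
    by (simp add: h_def mult.assoc opr_contr)
  then have hc: "h * ?c = ?c"
    by (simp add: mult.assoc[symmetric] opr_mult star_g opr_one)
  have "h * (\<sigma> * (?w * ?c)) = h * (?c * (\<sigma> * ?w))"
    by (simp only: wc left_commute_mult[OF \<sigma>c])
  also have "\<dots> = \<sigma> * ?w * ?c"
    by (simp only: mult.assoc[symmetric] hc) (simp only: mult.assoc wc left_commute_mult[OF \<sigma>c])
  finally have 1: "h * \<sigma> * (?w * ?c) = \<sigma> * ?w * ?c"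
    by (simp add: mult.assoc)
  have "h * \<sigma> * ?c = ?c * \<sigma>"
    by (simp only: mult.assoc \<sigma>c) (simp only: mult.assoc[symmetric] hc)
  then have 2: "?w * (h * \<sigma> * ?c) = ?w * \<sigma> * ?c"
    by (simp add: \<sigma>c mult.assoc)
  have "\<sigma> * ?w * opr A (Suc 0) = opr A (Suc 0) * (\<sigma> * ?w)" "?w * \<sigma> * opr A (Suc 0) = opr A (Suc 0) * (?w * \<sigma>)" for A
    using opr_env_eval[OF set_trace_term, of "Suc 0" A l] \<sigma>_opr[of "Suc 0" A]
    by (auto intro!: mult_commute_mult)
  with * 1 2 show ?thesis
    using contr_cancel[of "Suc 0" 2 "\<sigma> * ?w" "?w * \<sigma>"] by fastforce
qed

lemma group_op_bvw_elem:
  assumes "x \<in> generic_bvw_gens k" "g ** \<xi> ** star g = \<xi>"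
  shows "group_op k * bvw_elem \<xi> x = bvw_elem \<xi> x * group_op k"
proof -
  have eps: "group_op k * (scal \<epsilon> * y) = scal \<epsilon> * y * group_op k" if "group_op k * y = y * group_op k" for y
    using that by (simp add: left_commute_mult[of "group_op k"] scal_eps_commute mult.assoc)
  have W: "group_op m * env_eval (trace_term l) = env_eval (trace_term l) * group_op m" for m l
  proof (induction m)
    case (Suc m)
    have "opr g (Suc m) * (env_eval (trace_term l) * group_op m) = env_eval (trace_term l) * (opr g (Suc m) * group_op m)"
      by (intro left_commute_mult opr_env_eval set_trace_term) simp
    with Suc show ?case by (simp add: mult.assoc)
  qed (simp add: \<sigma>_trace_term)
  from assms(1) consider i where "x = T i" "i \<noteq> 0" "Suc i \<le> k" | i where "x = E i" "i \<noteq> 0" "Suc i \<le> k"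
    | i where "x = Z i" "i \<noteq> 0" "i \<le> k" | i where "x = Th i" "i \<noteq> 0" "i \<le> k" | l where "x = W l"
    by (auto simp: generic_bvw_gens_def bvw_gens_def)
  then show ?thesis
    by cases (simp_all add: eps group_op_swp group_op_contr group_op_jucys_murphy group_op_opr assms(2) W)
qed

end

section \<open>The operators on tensors\<close>

lemma sum_fun_apply: "(\<Sum>x\<in>S. F x) w = (\<Sum>x\<in>S. F x w)"
  by (induction S rule: infinite_finite_induct) auto

locale tensor_rep = invariant_form J \<epsilon> + vector_space sc
  for J :: "'i::finite cmatrix" and \<epsilon> :: complex and sc :: "complex \<Rightarrow> 'x::ab_group_add \<Rightarrow> 'x" +
  fixes \<rho> :: "'i cmatrix \<Rightarrow> 'x \<Rightarrow> 'x"
  assumes lie_module: "lie_module lie sc \<rho>"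
begin

definition tscal :: "complex \<Rightarrow> ((nat \<Rightarrow> 'i) \<Rightarrow> 'x) endo"
  where "tscal c = Endo (tscale sc c)"

definition topr :: "'i cmatrix \<Rightarrow> nat \<Rightarrow> ((nat \<Rightarrow> 'i) \<Rightarrow> 'x) endo"
  where "topr A i = Endo (at_factor sc \<rho> A i)"

definition pointwise :: "('x \<Rightarrow> 'x) \<Rightarrow> ((nat \<Rightarrow> 'i) \<Rightarrow> 'x) endo"
  where "pointwise h = Endo (\<lambda>f w. h (f w))"

lemma \<rho>_add: "A \<in> lie \<Longrightarrow> \<rho> A (x + y) = \<rho> A x + \<rho> A y"
  and \<rho>_scale: "A \<in> lie \<Longrightarrow> \<rho> A (sc c x) = sc c (\<rho> A x)"
  using lie_module
  by (auto simp: lie_module_def Vector_Spaces.linear_def module_hom_iff)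

lemma \<rho>_lie:
  "A \<in> lie \<Longrightarrow> C \<in> lie \<Longrightarrow> \<rho> (A + C) x = \<rho> A x + \<rho> C x"
  "A \<in> lie \<Longrightarrow> \<rho> (mscale c A) x = sc c (\<rho> A x)"
  "A \<in> lie \<Longrightarrow> C \<in> lie \<Longrightarrow> \<rho> (bracket A C) x = \<rho> A (\<rho> C x) - \<rho> C (\<rho> A x)"
  using lie_module by (auto simp: lie_module_def)

lemma \<rho>_zero: "A \<in> lie \<Longrightarrow> \<rho> A 0 = 0"
  using \<rho>_scale[of A 0 0] by simp

lemma app_tscal: "app (tscal c) f = tscale sc c f"
  unfolding tscal_def
  by (rule fun_cong[OF app_Endo]) (simp add: tscale_def fun_eq_iff scale_right_distrib)

lemma app_topr: "i \<noteq> 0 \<or> A \<in> lie \<Longrightarrow> app (topr A i) f = at_factor sc \<rho> A i f"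
  unfolding topr_def
  by (rule fun_cong[OF app_Endo])
    (auto simp: at_factor_def fun_eq_iff scale_right_distrib sum.distrib \<rho>_add)

lemma app_pointwise: "(\<And>x y. h (x + y) = h x + h y) \<Longrightarrow> app (pointwise h) f w = h (f w)"
  unfolding pointwise_def by (subst app_Endo) (auto simp: fun_eq_iff)

lemma pointwise_commute_topr:
  assumes "\<And>x y. h (x + y) = h x + h y" "\<And>c x. h (sc c x) = sc c (h x)" "i \<noteq> 0"
  shows "pointwise h * topr A i = topr A i * pointwise h"
proof -
  have "h 0 = 0"
    using assms(1)[of 0 0] by simp
  then have "h (sum f S) = (\<Sum>x\<in>S. h (f x))" for f :: "'i \<Rightarrow> 'x" and S
    by (induction S rule: infinite_finite_induct) (auto simp: assms(1))
  then show ?thesis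
    using assms(2,3)
    by (intro endo_eqI) (simp add: fun_eq_iff app_pointwise[OF assms(1)] app_topr at_factor_def)
qed

lemma pointwise_commute_tscal:
  assumes "\<And>x y. h (x + y) = h x + h y" "\<And>c x. h (sc c x) = sc c (h x)"
  shows "pointwise h * tscal c = tscal c * pointwise h"
  by (intro endo_eqI) (simp add: fun_eq_iff app_pointwise[OF assms(1)] app_tscal tscale_def assms(2))

lemma topr_0_eq: "A \<in> lie \<Longrightarrow> topr A 0 = pointwise (\<rho> A)"
  by (intro endo_eqI) (simp add: fun_eq_iff app_topr app_pointwise \<rho>_add at_factor_def)

sublocale scalar_hom tscal
  by unfold_locales
    (auto intro!: endo_eqI simp: app_tscal tscale_def fun_eq_iff scale_left_distrib)

lemma topr_mult:
  assumes "i \<noteq> 0"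
  shows "topr A i * topr C i = topr (A ** C) i"
proof (rule endo_eqI)
  fix f :: "(nat \<Rightarrow> 'i) \<Rightarrow> 'x"
  show "app (topr A i * topr C i) f = app (topr (A ** C) i) f"
    using assms
    by (simp add: fun_eq_iff app_topr at_factor_def scale_sum_right matrix_matrix_mult_def scale_sum_left)
      (intro allI sum.swap)
qed

lemma topr_commute:
  assumes "i \<noteq> 0" "j \<noteq> 0" "i \<noteq> j"
  shows "topr A i * topr C j = topr C j * topr A i"
proof (rule endo_eqI)
  fix f :: "(nat \<Rightarrow> 'i) \<Rightarrow> 'x"
  have 1: "f (w(i := b, j := c)) = f (w(j := c, i := b))" for w b c
    using assms by (simp add: fun_upd_twist)
  show "app (topr A i * topr C j) f = app (topr C j * topr A i) f"
    using assms
    by (simp add: fun_eq_iff app_topr at_factor_def scale_sum_right 1 mult.commute)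
      (intro allI sum.swap)
qed

sublocale tensor_ops J \<epsilon> tscal topr
proof
  show "lin (\<lambda>X. topr X i)" if "i \<noteq> 0" for i
    using that unfolding lin_def
    by (auto intro!: endo_eqI simp: app_tscal app_topr at_factor_def tscale_def fun_eq_iff
        scale_left_distrib sum.distrib scale_sum_right mscale_nth mult.commute)
  show "topr (mat 1) i = 1" if "i \<noteq> 0" for i
    using that by (intro endo_eqI)
      (simp add: app_topr at_factor_def fun_eq_iff mat_def if_distrib[of "\<lambda>x. sc x y" for y] cong: if_cong)
  show "topr A 0 * topr C i = topr C i * topr A 0" if "i \<noteq> 0" "A \<in> lie" for A C i
    using that by (simp add: topr_0_eq pointwise_commute_topr \<rho>_add \<rho>_scale)
  show "topr (A + C) 0 = topr A 0 + topr C 0" if "A \<in> lie" "C \<in> lie" for A C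
    using that by (intro endo_eqI) (simp add: app_topr at_factor_def fun_eq_iff \<rho>_lie lie_closed)
  show "topr (mscale c A) 0 = tscal c * topr A 0" if "A \<in> lie" for A c
    using that by (intro endo_eqI)
      (simp add: app_topr app_tscal at_factor_def tscale_def fun_eq_iff \<rho>_lie lie_closed)
  show "topr A 0 * tscal c = tscal c * topr A 0" if "A \<in> lie" for A c
    using that by (simp add: topr_0_eq pointwise_commute_tscal \<rho>_add \<rho>_scale)
  show "topr (bracket A C) 0 = topr A 0 * topr C 0 - topr C 0 * topr A 0" if "A \<in> lie" "C \<in> lie" for A C
    using that by (intro endo_eqI) (simp add: app_topr at_factor_def fun_eq_iff \<rho>_lie lie_closed)
qed (use topr_mult topr_commute in blast)+

lemma at_factor_munit:
  "i \<noteq> 0 \<Longrightarrow> at_factor sc \<rho> (munit a b) i f w = (if w i = a then f (w(i := b)) else 0)"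
  by (simp add: at_factor_def munit_nth if_distrib[of "\<lambda>x. sc x y" for y] sum_if_const cong: if_cong)

lemma app_swp:
  assumes "i \<noteq> 0" "j \<noteq> 0" "i \<noteq> j"
  shows "app (swp i j) f = flip i j f"
  using assms
  by (simp add: fun_eq_iff swp_def csum_def app_sum sum_fun_apply app_topr at_factor_munit flip_def
      sum_if_const cong: if_cong)

lemma star_munit_nth: "star (munit a b) $ c $ d = J $ b $ c * J $ a $ d"
proof -
  have "star (munit a b) = (\<Sum>x\<in>UNIV. mscale (J $ b $ x) (\<Sum>y\<in>UNIV. mscale (J $ a $ y) (munit x y)))"
    unfolding star_def transpose_munit mult_munit sum_matrix_mult mscale_simps munit_mult
    by (simp add: transpose_def)
  then show ?thesis
    by (simp add: sum_component mscale_nth munit_nth if_distrib[of "\<lambda>x. y * x" for y] sum_if_const cong: if_cong)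
qed

lemma app_contr:
  assumes "i \<noteq> 0" "j \<noteq> 0" "i \<noteq> j"
  shows "app (contr i j) f w =
    sc (J $ w i $ w j) (\<Sum>a\<in>UNIV. \<Sum>b\<in>UNIV. sc (J $ a $ b) (f (w(i := a, j := b))))"
proof -
  have J: "J $ a $ b = \<epsilon> * J $ b $ a" for a b
    using arg_cong[OF transpose_J, of "\<lambda>M. M $ b $ a"] by (simp only: transpose_def mscale_nth vec_lambda_beta)
  have "app (contr i j) f w =
      (\<Sum>a\<in>UNIV. \<Sum>c\<in>UNIV. sc (J $ w j $ w i * J $ a $ c) (f (w(i := c, j := a))))"
    using assms
    by (simp add: contr_def csum_def app_sum sum_fun_apply app_topr at_factor_def[of sc \<rho> _ i])
      (simp add: at_factor_munit star_munit_nth if_distrib[of "sc c" for c] sum_if_const cong: if_cong)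
  also have "\<dots> = (\<Sum>a\<in>UNIV. \<Sum>c\<in>UNIV. sc (J $ w i $ w j * J $ c $ a) (f (w(i := c, j := a))))"
    by (intro sum.cong HOL.refl arg_cong2[of _ _ _ _ sc]) (subst (1 2) J, simp add: eps_sq mult_ac)
  finally show ?thesis
    by (subst sum.swap) (simp add: scale_sum_right)
qed

end

section \<open>The Killing form and the trivial submodule\<close>

interpretation mscale: vector_space mscale
  by unfold_locales (simp_all add: mscale_distrib)

lemma trace_transpose_mult:
  "trace (transpose P ** Q) = (\<Sum>a\<in>UNIV. \<Sum>b\<in>UNIV. P $ a $ b * Q $ a $ b)" for P Q :: "'i::finite cmatrix"
  by (simp add: trace_def matrix_matrix_mult_def transpose_def) (rule sum.swap)

context invariant_form
begin

definition proj :: "'i cmatrix \<Rightarrow> 'i cmatrix"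
  where "proj A = mscale (1/2) (A - star A)"

lemma proj_in_lie: "proj A \<in> lie"
  by (simp add: proj_def lie_closed skew_part_in_lie)

lemma lie_diff: "A \<in> lie \<Longrightarrow> C \<in> lie \<Longrightarrow> A - C \<in> lie"
  by (simp add: lie_def star_linear)

lemma proj_lie: "A \<in> lie \<Longrightarrow> proj A = A"
  by (simp add: proj_def lie_def vec_eq_iff mscale_nth)

lemma proj_linear: "proj (A + C) = proj A + proj C" "proj (mscale c A) = mscale c (proj A)" "proj 0 = 0"
  by (simp_all add: proj_def star_linear mscale_distrib algebra_simps)

lemma proj_sum: "proj (sum f S) = (\<Sum>x\<in>S. proj (f x))"
  by (induction S rule: infinite_finite_induct) (auto simp: proj_linear)

lemma subspace_lie: "mscale.subspace lie"
  by (simp add: mscale.subspace_def lie_closed)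

lemma trace_lie: "A \<in> lie \<Longrightarrow> trace A = 0"
  using trace_star[of A] by (simp add: lie_def trace_def sum_negf)

lemma lie_basis_exists: "\<exists>B. basis_of mscale lie B"
proof -
  obtain B where B: "B \<subseteq> lie" "mscale.independent B" "lie \<subseteq> mscale.span B"
    by (rule mscale.maximal_independent_subset)
  with mscale.span_minimal[OF B(1) subspace_lie] show ?thesis
    by (auto simp: basis_of_def)
qed

lemma finite_basis:
  assumes "basis_of mscale lie B"
  shows "finite B"
proof -
  have "A \<in> mscale.span (range (\<lambda>(a, b). munit a b))" for A :: "'i cmatrix"
    by (subst munit_expansion)
      (intro mscale.span_sum mscale.span_scale, rule mscale.span_base, auto)
  then show ?thesis
    using assms mscale.independent_span_bound[of "range (\<lambda>(a, b). munit a b)" B]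
    by (auto simp: basis_of_def)
qed

lemma basis_expansion:
  assumes "basis_of mscale lie B" "A \<in> lie"
  shows "(\<Sum>b\<in>B. mscale (mscale.representation B A b) b) = A"
  using assms finite_basis[OF assms(1)]
  by (intro mscale.sum_representation_eq) (auto simp: basis_of_def)

lemma sum_representation_entries:
  assumes "basis_of mscale lie B"
  shows "(\<Sum>a\<in>UNIV. \<Sum>c\<in>UNIV. A $ a $ c * mscale.representation B (proj (munit a c)) b) =
    mscale.representation B (proj A) b"
proof -
  have B: "mscale.independent B" "mscale.span B = lie"
    using assms by (auto simp: basis_of_def)
  have "proj A = (\<Sum>a\<in>UNIV. \<Sum>c\<in>UNIV. mscale (A $ a $ c) (proj (munit a c)))"
    by (subst munit_expansion) (simp add: proj_sum proj_linear)
  moreover have "mscale.representation B (\<Sum>x\<in>S. f x) b = (\<Sum>x\<in>S. mscale.representation B (f x) b)"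
    if "\<And>x. f x \<in> lie" for f :: "'i \<Rightarrow> 'i cmatrix" and S
    using B that by (intro mscale.representation_sum[THEN fun_cong]) auto
  moreover have "(\<Sum>x\<in>S. f x) \<in> lie" if "\<And>x. f x \<in> lie" for f :: "'i \<Rightarrow> 'i cmatrix" and S
    using that by (intro mscale.subspace_sum subspace_lie)
  moreover have "mscale.representation B (mscale d (proj X)) b = d * mscale.representation B (proj X) b" for d X
    using B by (simp add: mscale.representation_scale proj_in_lie)
  ultimately show ?thesis
    by (simp add: lie_closed proj_in_lie)
qed

lemma trace_on_lie:
  assumes add: "\<And>A C. A \<in> lie \<Longrightarrow> C \<in> lie \<Longrightarrow> f (A + C) = f A + f C"
    and scale: "\<And>A c. A \<in> lie \<Longrightarrow> f (mscale c A) = mscale c (f A)"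
    and closed: "\<And>A. A \<in> lie \<Longrightarrow> f A \<in> lie"
  shows "trace_on mscale lie f = (\<Sum>a\<in>UNIV. \<Sum>c\<in>UNIV. f (proj (munit a c)) $ a $ c)"
proof -
  define B where "B = (SOME B. basis_of mscale lie B)"
  have B: "basis_of mscale lie B"
    unfolding B_def using lie_basis_exists by (rule someI_ex)
  have in_lie: "b \<in> lie" if "b \<in> B" for b
    using B that mscale.span_base by (auto simp: basis_of_def)
  have "f 0 = 0"
    using scale[of 0 0] by (simp add: lie_closed)
  have f_sum: "f (\<Sum>b\<in>S. mscale (r b) b) = (\<Sum>b\<in>S. mscale (r b) (f b)) \<and> (\<Sum>b\<in>S. mscale (r b) b) \<in> lie"
    if "S \<subseteq> B" for S r
    using that
    by (induction S rule: infinite_finite_induct) (auto simp: \<open>f 0 = 0\<close> lie_closed add scale in_lie)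
  have "f (proj X) = (\<Sum>b\<in>B. mscale (mscale.representation B (proj X) b) (f b))" for X
    using f_sum[OF order_refl, of "mscale.representation B (proj X)"] basis_expansion[OF B proj_in_lie] by simp
  then have "(\<Sum>a\<in>UNIV. \<Sum>c\<in>UNIV. f (proj (munit a c)) $ a $ c) =
      (\<Sum>a\<in>UNIV. \<Sum>c\<in>UNIV. \<Sum>b\<in>B. f b $ a $ c * mscale.representation B (proj (munit a c)) b)"
    by (simp add: sum_component mscale_nth mult.commute)
  also have "\<dots> = (\<Sum>a\<in>UNIV. \<Sum>b\<in>B. \<Sum>c\<in>UNIV. f b $ a $ c * mscale.representation B (proj (munit a c)) b)"
    by (intro sum.cong HOL.refl sum.swap)
  also have "\<dots> = (\<Sum>b\<in>B. \<Sum>a\<in>UNIV. \<Sum>c\<in>UNIV. f b $ a $ c * mscale.representation B (proj (munit a c)) b)"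
    by (rule sum.swap)
  also have "\<dots> = (\<Sum>b\<in>B. mscale.representation B (f b) b)"
    by (simp add: sum_representation_entries[OF B] proj_lie closed in_lie)
  finally show ?thesis
    by (simp add: trace_on_def B_def Let_def)
qed

lemma sum_entries: "(\<Sum>a\<in>UNIV. \<Sum>b\<in>UNIV. (P ** munit a b ** Q) $ a $ b) = trace P * trace Q"
proof -
  have "(P ** munit a b ** Q) $ a $ b = P $ a $ a * Q $ b $ b" for a b
    by (simp add: mult_munit sum_matrix_mult munit_mult sum_component mscale_nth munit_nth
        if_distrib[of "\<lambda>x. y * x" for y] sum_if_const cong: if_cong)
  then show ?thesis
    by (simp add: trace_def sum_product)
qed

lemma sum_entries_star:
  "(\<Sum>a\<in>UNIV. \<Sum>b\<in>UNIV. (P ** star (munit a b) ** Q) $ a $ b) = \<epsilon> * trace (star P ** Q)"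
proof -
  have "P ** star (munit a b) ** Q = (P ** transpose J) ** munit b a ** (J ** Q)" for a b
    by (simp add: star_def matrix_mul_assoc)
  moreover have "(R ** munit b a ** S) $ a $ b = R $ a $ b * S $ a $ b" for R S :: "'i cmatrix" and a b
    by (simp add: mult_munit sum_matrix_mult munit_mult sum_component mscale_nth munit_nth
        if_distrib[of "\<lambda>x. y * x" for y] sum_if_const cong: if_cong)
  ultimately have "(\<Sum>a\<in>UNIV. \<Sum>b\<in>UNIV. (P ** star (munit a b) ** Q) $ a $ b) =
      trace (transpose (P ** transpose J) ** (J ** Q))"
    by (simp add: trace_transpose_mult)
  also have "transpose (P ** transpose J) ** (J ** Q) = mscale \<epsilon> (star P ** Q)"
    by (simp add: star_def matrix_transpose_mul matrix_mul_assoc transpose_J eps_sq)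
  finally show ?thesis
    by simp
qed

lemma killing_eq:
  assumes A: "A \<in> lie" and C: "C \<in> lie"
  shows "killing lie A C = (of_nat CARD('i) - 2 * \<epsilon>) * trace (A ** C)"
proof -
  have br: "bracket A (bracket C X) = A ** C ** X ** mat 1 - A ** X ** C - C ** X ** A + mat 1 ** X ** (C ** A)" for X
    by (simp add: bracket_def matrix_mult_distrib matrix_mul_assoc)
  have "killing lie A C = (\<Sum>a\<in>UNIV. \<Sum>c\<in>UNIV. bracket A (bracket C (proj (munit a c))) $ a $ c)"
    unfolding killing_def using assms
    by (intro trace_on_lie)
      (simp_all add: lie_closed, simp_all add: bracket_def matrix_mult_distrib mscale_distrib algebra_simps)
  also have "\<dots> = (1/2) * ((\<Sum>a\<in>UNIV. \<Sum>c\<in>UNIV. bracket A (bracket C (munit a c)) $ a $ c) -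
      (\<Sum>a\<in>UNIV. \<Sum>c\<in>UNIV. bracket A (bracket C (star (munit a c))) $ a $ c))"
  proof -
    have "bracket A (bracket C (proj X)) =
        mscale (1/2) (bracket A (bracket C X) - bracket A (bracket C (star X)))" for X
      by (simp add: proj_def bracket_def matrix_mult_distrib mscale_distrib algebra_simps)
    then show ?thesis
      by (simp add: mscale_nth sum_subtractf sum_distrib_left right_diff_distrib)
  qed
  also have "(\<Sum>a\<in>UNIV. \<Sum>c\<in>UNIV. bracket A (bracket C (munit a c)) $ a $ c) =
      2 * of_nat CARD('i) * trace (A ** C)"
    using trace_mul_sym[of C A] trace_lie[OF A] trace_lie[OF C]
    by (simp only: br vector_add_component vector_minus_component sum.distrib sum_subtractf sum_entries trace_I)
      simp
  also have "(\<Sum>a\<in>UNIV. \<Sum>c\<in>UNIV. bracket A (bracket C (star (munit a c))) $ a $ c) =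
      4 * \<epsilon> * trace (A ** C)"
  proof -
    have "trace (star (A ** C) ** mat 1) = trace (A ** C)" "trace (star A ** C) = - trace (A ** C)"
      "trace (star C ** A) = - trace (A ** C)" "trace (star (mat 1) ** (C ** A)) = trace (A ** C)"
      using A C trace_mul_sym[of C A]
      by (simp_all only: matrix_mul_rid trace_star) (simp_all add: lie_def matrix_mult_distrib trace_def sum_negf)
    then show ?thesis
      by (simp only: br vector_add_component vector_minus_component sum.distrib sum_subtractf sum_entries_star)
        (simp add: algebra_simps)
  qed
  finally show ?thesis
    by (simp add: algebra_simps)
qed

lemma trace_lie_proj:
  assumes "A \<in> lie"
  shows "trace (A ** proj Y) = trace (A ** Y)"
proof -
  have "trace (A ** star Y) = trace (Y ** star A)"
    using trace_star[of "A ** star Y"] by (simp add: star_mult)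
  also have "\<dots> = - trace (A ** Y)"
    using assms trace_mul_sym[of Y A] by (simp add: lie_def matrix_mult_distrib trace_def sum_negf)
  finally show ?thesis
    by (simp add: proj_def matrix_mult_distrib)
      (simp add: trace_def sum_subtractf)
qed

lemma killing_dual_eq:
  assumes B: "basis_of mscale lie B" and b: "b \<in> B"
  shows "killing_dual lie B b = mscale (1 / (of_nat CARD('i) - 2 * \<epsilon>))
    (proj (\<Sum>x\<in>UNIV. \<Sum>y\<in>UNIV. mscale (mscale.representation B (proj (munit x y)) b) (munit y x)))"
    (is "_ = mscale ?n (proj ?Y)")
proof -
  have ind: "mscale.independent B" and span: "mscale.span B = lie"
    using B by (auto simp: basis_of_def)
  have in_lie: "b \<in> lie" if "b \<in> B" for b
    using span that mscale.span_base by auto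
  have n: "of_nat CARD('i) - 2 * \<epsilon> \<noteq> 0"
    using card_neq by simp
  show ?thesis
    unfolding killing_dual_def
  proof (rule the_equality)
    have dual: "killing lie b' (mscale ?n (proj ?Y)) = (if b' = b then 1 else 0)" if "b' \<in> B" for b'
    proof -
      have "trace (A ** munit y x) = A $ x $ y" for A :: "'i cmatrix" and x y
        by (simp add: mult_munit trace_def sum_component mscale_nth munit_nth
            if_distrib[of "\<lambda>x. y * x" for y] sum_if_const cong: if_cong)
      moreover have "trace (sum f S) = (\<Sum>x\<in>S. trace (f x))" for f :: "'i \<Rightarrow> 'i cmatrix" and S
        by (simp add: trace_def sum_component) (rule sum.swap)
      ultimately have "trace (b' ** ?Y) = (\<Sum>x\<in>UNIV. \<Sum>y\<in>UNIV. b' $ x $ y * mscale.representation B (proj (munit x y)) b)"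
        by (simp add: sum_matrix_mult mult.commute)
      also have "\<dots> = (if b' = b then 1 else 0)"
        using that ind
        by (simp add: sum_representation_entries[OF B] proj_lie in_lie mscale.representation_basis)
      finally show ?thesis
        using that n by (simp add: killing_eq in_lie lie_closed proj_in_lie trace_lie_proj)
    qed
    show "mscale ?n (proj ?Y) \<in> lie \<and>
        (\<forall>b'\<in>B. killing lie b' (mscale ?n (proj ?Y)) = (if b' = b then 1 else 0))"
      by (simp add: lie_closed proj_in_lie dual)
    fix d assume d: "d \<in> lie \<and> (\<forall>b'\<in>B. killing lie b' d = (if b' = b then 1 else 0))"
    define x where "x = d - mscale ?n (proj ?Y)"
    have x: "x \<in> lie"
      unfolding x_def using d by (intro lie_diff) (simp_all add: lie_closed proj_in_lie)
    have x0: "trace (A ** x) = 0" if "A \<in> lie" for A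
    proof -
      have "A \<in> mscale.span B" using that span by simp
      then show ?thesis
      proof (induction rule: mscale.span_induct_alt)
        case (step c b' y)
        have "killing lie b' (mscale ?n (proj ?Y)) = killing lie b' d"
          using d step(1) dual by simp
        then have "trace (b' ** mscale ?n (proj ?Y)) = trace (b' ** d)"
          using n d step by (simp add: killing_eq in_lie lie_closed proj_in_lie)
        then have "trace (b' ** x) = 0"
          unfolding x_def matrix_mult_distrib by (simp add: trace_def sum_subtractf)
        then have "trace (mscale c (b' ** x)) = 0"
          by simp
        then show ?case
          using step by (simp only: matrix_mult_distrib mscale_simps trace_add) simp
      qed (simp add: matrix_mult_distrib trace_def)
    qed
    have "x $ i $ j = 0" for i j
    proof -
      have "x $ i $ j = trace (x ** munit j i)"
        by (simp add: mult_munit trace_def sum_component mscale_nth munit_nth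
            if_distrib[of "\<lambda>x. y * x" for y] sum_if_const cong: if_cong)
      also have "\<dots> = trace (proj (munit j i) ** x)"
        unfolding trace_mul_sym[of "proj _"] by (simp add: trace_lie_proj[OF x])
      also have "\<dots> = 0"
        by (intro x0 proj_in_lie)
      finally show ?thesis .
    qed
    then show "d = mscale ?n (proj ?Y)"
      by (simp add: x_def vec_eq_iff)
  qed
qed

end

context tensor_ops
begin

lemma skew_opr_half: "opr (proj A) l = scal (1/2) * skew_opr l A"
proof -
  have "scal (1/2) * skew_opr l A = skew_opr l (mscale (1/2) A)"
    by (rule linD(2)[OF lin_skew_opr, symmetric])
  then show ?thesis
    by (simp add: skew_opr_def proj_def star_linear mscale_distrib)
qed

lemma sum_killing_dual:
  assumes B: "basis_of mscale lie B" and i: "i \<noteq> 0"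
  shows "(\<Sum>b\<in>B. opr b l * opr (killing_dual lie B b) i) =
    scal (1 / (2 * (of_nat CARD('i) - 2 * \<epsilon>))) * casimir l i"
proof -
  define n where "n = 1 / (of_nat CARD('i) - 2 * \<epsilon>)"
  define r where "r x y b = mscale.representation B (proj (munit x y)) b" for x y b
  have in_lie: "b \<in> lie" if "b \<in> B" for b
    using B that mscale.span_base by (auto simp: basis_of_def)
  have dual: "opr (killing_dual lie B b) i =
      scal (n/2) * (\<Sum>x\<in>UNIV. \<Sum>y\<in>UNIV. scal (r x y b) * skew_opr i (munit y x))" if "b \<in> B" for b
    unfolding killing_dual_eq[OF B that] linD(2)[OF lin_opr[OF i]] skew_opr_half
      mult.assoc[symmetric] scal_mult[symmetric]
    by (simp add: lin_sum[OF lin_skew_opr] linD[OF lin_skew_opr] n_def r_def)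
  have basis: "opr b l = scal (1/2) * skew_opr l b" if "b \<in> B" for b
    using skew_opr_half[of b l] that by (simp add: proj_lie in_lie)
  have skew_proj: "skew_opr l (proj X) = skew_opr l X" for X
  proof -
    have "proj X - star (proj X) = X - star X"
      by (simp add: proj_def star_linear vec_eq_iff mscale_nth algebra_simps)
    then show ?thesis by (simp add: skew_opr_def)
  qed
  have pull: "skew_opr l X * (scal c * y) = scal c * (skew_opr l X * y)" for X c y
    by (intro left_commute_mult linD[OF lin_skew_opr])
  have comb: "scal c * (scal d * y) = scal (c * d) * y" for c d y
    by (simp add: scal_mult mult.assoc)
  have "(\<Sum>b\<in>B. opr b l * opr (killing_dual lie B b) i) =
      (\<Sum>b\<in>B. scal (1/2) * (skew_opr l b * (scal (n/2) *
        (\<Sum>x\<in>UNIV. \<Sum>y\<in>UNIV. scal (r x y b) * skew_opr i (munit y x)))))"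
    by (intro sum.cong HOL.refl) (simp add: dual basis mult.assoc)
  also have "\<dots> = scal (n/4) * (\<Sum>b\<in>B. \<Sum>x\<in>UNIV. \<Sum>y\<in>UNIV. scal (r x y b) * (skew_opr l b * skew_opr i (munit y x)))"
    by (simp add: pull comb sum_distrib_left)
  also have "(\<Sum>b\<in>B. \<Sum>x\<in>UNIV. \<Sum>y\<in>UNIV. scal (r x y b) * (skew_opr l b * skew_opr i (munit y x))) =
      (\<Sum>x\<in>UNIV. \<Sum>y\<in>UNIV. \<Sum>b\<in>B. scal (r x y b) * (skew_opr l b * skew_opr i (munit y x)))"
    by (subst sum.swap, subst (2) sum.swap) (rule HOL.refl)
  also have "\<dots> = (\<Sum>x\<in>UNIV. \<Sum>y\<in>UNIV. skew_opr l (\<Sum>b\<in>B. mscale (r x y b) b) * skew_opr i (munit y x))"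
    by (simp add: lin_sum[OF lin_skew_opr] linD[OF lin_skew_opr] sum_distrib_right mult.assoc)
  also have "\<dots> = csum (skew_opr l) (skew_opr i)"
    unfolding r_def by (simp add: basis_expansion[OF B proj_in_lie] skew_proj csum_def)
  also have "\<dots> = scal 2 * casimir l i"
    using scal_add[of 1 1] by (simp add: casimir_double[OF i] semiring_class.distrib_right)
  also have "scal (n/4) * (scal 2 * casimir l i) = scal (1 / (2 * (of_nat CARD('i) - 2 * \<epsilon>))) * casimir l i"
  proof -
    have "1 / D / 4 * 2 = 1 / (2 * D)" for D :: complex
      by simp
    then show ?thesis
      unfolding comb n_def by (simp only:)
  qed
  finally show ?thesis .
qed

end

context invariant_form
begin

definition pairing :: "'i cmatrix \<Rightarrow> complex"
  where "pairing u = trace (transpose J ** u)"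

lemma sum_skew_mult:
  "(\<Sum>a\<in>UNIV. \<Sum>b\<in>UNIV. lie_on_VV (munit a b - star (munit a b)) (munit b a ** u)) =
    mscale (of_nat CARD('i) - \<epsilon>) u + transpose u - mscale (pairing u) J" (is ?A)
  and sum_mult_skew:
  "(\<Sum>a\<in>UNIV. \<Sum>b\<in>UNIV. munit b a ** lie_on_VV (munit a b - star (munit a b)) u) =
    mscale (of_nat CARD('i) - \<epsilon>) u + transpose u - mscale (pairing u) J" (is ?B)
proof -
  have 1: "(\<Sum>a\<in>UNIV. \<Sum>b\<in>UNIV. munit a b ** munit b a ** u) = mscale (of_nat CARD('i)) u"
    "(\<Sum>a\<in>UNIV. \<Sum>b\<in>UNIV. munit b a ** munit a b ** u) = mscale (of_nat CARD('i)) u"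
    using sum_munit_mult_munit[of "mat 1 :: 'i cmatrix"] sum_munit_mult_munit'[of "mat 1 :: 'i cmatrix"]
    by (simp_all only: sum_matrix_mult(1)[symmetric] matrix_mul_rid trace_I mscale_simps matrix_mul_lid)
  have 2: "(\<Sum>a\<in>UNIV. \<Sum>b\<in>UNIV. star (munit a b) ** munit b a ** u) = mscale \<epsilon> u"
    "(\<Sum>a\<in>UNIV. \<Sum>b\<in>UNIV. munit b a ** star (munit a b) ** u) = mscale \<epsilon> u"
    by (simp_all only: sum_matrix_mult(1)[symmetric] sum_munit_star mscale_simps matrix_mul_lid)
  have 3: "(\<Sum>a\<in>UNIV. \<Sum>b\<in>UNIV. munit b a ** u ** transpose (munit a b)) = transpose u"
    by (simp add: sum_munit_transpose')
  have "munit b a ** u ** transpose (star (munit a b)) = munit b a ** (u ** transpose J) ** munit a b ** J" for a b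
    by (simp add: star_def matrix_transpose_mul matrix_mul_assoc)
  then have "(\<Sum>a\<in>UNIV. \<Sum>b\<in>UNIV. munit b a ** u ** transpose (star (munit a b))) = mscale (trace (u ** transpose J)) J"
    by (simp only: sum_matrix_mult(1)[symmetric] sum_munit_mult_munit' mscale_simps matrix_mul_lid)
  then have 4: "(\<Sum>a\<in>UNIV. \<Sum>b\<in>UNIV. munit b a ** u ** transpose (star (munit a b))) = mscale (pairing u) J"
    by (simp add: pairing_def trace_mul_sym[of "transpose J"])
  show ?A
    unfolding lie_on_VV_def matrix_mult_distrib transpose_distrib matrix_mul_assoc sum.distrib sum_subtractf
      1 2 3 4 mscale_distrib by (simp add: algebra_simps)
  show ?B
    unfolding lie_on_VV_def matrix_mult_distrib transpose_distrib matrix_mul_assoc sum.distrib sum_subtractf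
      1 2 3 4 mscale_distrib by (simp add: algebra_simps)
qed

lemma solve_pair:
  assumes "mscale (of_nat CARD('i) - \<epsilon>) v + v' = mscale c J"
    and "mscale (of_nat CARD('i) - \<epsilon>) v' + v = mscale (\<epsilon> * c) J"
  shows "v = mscale (c / of_nat CARD('i)) J"
proof -
  define N where "N = (of_nat CARD('i) :: complex)"
  have N: "N \<noteq> 0" "N - 2 * \<epsilon> \<noteq> 0"
    using card_neq by (simp_all add: N_def)
  have "v $ a $ b = c / N * J $ a $ b" for a b
  proof -
    have "(N - \<epsilon>) * v $ a $ b + v' $ a $ b = c * J $ a $ b"
      "(N - \<epsilon>) * v' $ a $ b + v $ a $ b = \<epsilon> * c * J $ a $ b"
      using arg_cong[OF assms(1), of "\<lambda>M. M $ a $ b"] arg_cong[OF assms(2), of "\<lambda>M. M $ a $ b"]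
      by (simp_all add: mscale_nth N_def)
    then have "(N - 2 * \<epsilon>) * (N * v $ a $ b) = (N - 2 * \<epsilon>) * (c * J $ a $ b)"
      using eps_sq by algebra
    then have "N * v $ a $ b = c * J $ a $ b"
      using N(2) by (metis mult_left_cancel)
    then show ?thesis
      using N(1) by (simp add: field_simps)
  qed
  then show ?thesis
    by (simp add: vec_eq_iff mscale_nth N_def)
qed

lemma pairing_transpose: "pairing (transpose u) = \<epsilon> * pairing u"
proof -
  have "pairing (transpose u) = trace (u ** J)"
    unfolding pairing_def using trace_transpose[of "transpose J ** transpose u"] by (simp add: matrix_transpose_mul)
  then show ?thesis
    by (simp add: pairing_def transpose_J trace_mul_sym[of u] eps_sq mult.assoc[symmetric])
qed

lemma transpose_J_J: "transpose J ** J = mat 1" and J_transpose_J: "J ** transpose J = mat 1"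
  by (simp_all add: transpose_J J_J eps_sq)

lemma lie_iff:
  "A \<in> lie \<longleftrightarrow> transpose A ** J + J ** A = 0" "A \<in> lie \<longleftrightarrow> A ** J + J ** transpose A = 0"
proof -
  show "A \<in> lie \<longleftrightarrow> transpose A ** J + J ** A = 0"
  proof
    assume "A \<in> lie"
    then have "J ** star A = - (J ** A)"
      by (simp add: lie_def matrix_mult_distrib)
    then show "transpose A ** J + J ** A = 0"
      by (simp add: star_def transpose_J J_J_mult eps_sq matrix_mul_assoc[symmetric])
  next
    assume "transpose A ** J + J ** A = 0"
    then have "transpose J ** (transpose A ** J + J ** A) = 0"
      by (simp add: matrix_mult_distrib)
    then have "star A + A = 0"
      by (simp add: star_def matrix_mult_distrib matrix_mul_assoc transpose_J_J)
    then show "A \<in> lie"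
      by (simp add: lie_def eq_neg_iff_add_eq_0)
  qed
  show "A \<in> lie \<longleftrightarrow> A ** J + J ** transpose A = 0"
  proof
    assume "A \<in> lie"
    then have "star A ** transpose J = - (A ** transpose J)"
      by (simp add: lie_def matrix_mult_distrib)
    then have "mscale \<epsilon> (mscale \<epsilon> (J ** transpose A)) = mscale \<epsilon> (- mscale \<epsilon> (A ** J))"
      by (simp add: star_def transpose_J J_J eps_sq matrix_mul_assoc[symmetric])
    then show "A ** J + J ** transpose A = 0"
      by (simp add: eps_sq mscale_distrib)
  next
    assume "A ** J + J ** transpose A = 0"
    then have "(A ** J + J ** transpose A) ** transpose J = 0"
      by (simp add: matrix_mult_distrib)
    then have "A + J ** transpose A ** transpose J = 0"
      by (simp add: matrix_mult_distrib matrix_mul_assoc[symmetric] J_transpose_J)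
    then have "A + star A = 0"
      by (simp add: star_def transpose_J)
    then show "A \<in> lie"
      by (simp add: lie_def eq_neg_iff_add_eq_0 add.commute)
  qed
qed

lemma trivial_submodule_lie: "trivial_submodule lie = range (\<lambda>c. mscale c J)"
proof (intro set_eqI iffI)
  fix u assume "u \<in> trivial_submodule lie"
  then have "lie_on_VV (munit a b - star (munit a b)) u = 0" for a b
    by (simp add: trivial_submodule_def skew_part_in_lie)
  then have eq: "mscale (of_nat CARD('i) - \<epsilon>) u + transpose u = mscale (pairing u) J"
    using sum_mult_skew[of u] by (simp add: matrix_mult_distrib)
  from arg_cong[OF this, of transpose]
  have "mscale (of_nat CARD('i) - \<epsilon>) (transpose u) + u = mscale (\<epsilon> * pairing u) J"
    by (simp add: transpose_distrib transpose_J mult.commute)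
  from solve_pair[OF eq this] show "u \<in> range (\<lambda>c. mscale c J)" by blast
next
  fix u assume "u \<in> range (\<lambda>c. mscale c J)"
  then show "u \<in> trivial_submodule lie"
    by (auto simp: trivial_submodule_def lie_on_VV_def lie_iff(2) mscale_distrib(1)[symmetric])
qed

lemma pairing_J: "pairing J = of_nat CARD('i)"
  by (simp add: pairing_def transpose_J J_J eps_sq trace_I mult.assoc[symmetric])

lemma pairing_lie_on_VV:
  assumes "A \<in> lie"
  shows "pairing (lie_on_VV A u) = 0"
proof -
  have "trace (transpose J ** (u ** transpose A)) = trace (transpose A ** transpose J ** u)"
    using trace_mul_sym[of "transpose J ** u" "transpose A"] by (simp add: matrix_mul_assoc)
  then have "pairing (lie_on_VV A u) = trace ((transpose J ** A + transpose A ** transpose J) ** u)"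
    by (simp add: pairing_def lie_on_VV_def matrix_mult_distrib trace_add matrix_mul_assoc)
  also have "transpose J ** A + transpose A ** transpose J = mscale \<epsilon> (transpose A ** J + J ** A)"
    by (simp add: transpose_J mscale_distrib)
  also have "\<dots> = 0"
    using assms lie_iff(1)[of A] by simp
  finally show ?thesis
    by (simp add: matrix_mult_distrib trace_def)
qed

lemma trivial_projection_lie: "trivial_projection lie u = mscale (pairing u / of_nat CARD('i)) J"
proof -
  let ?P = "\<lambda>u. mscale (pairing u / of_nat CARD('i)) J"
  have "trivial_projection lie = ?P"
    unfolding trivial_projection_def
  proof (rule the_equality)
    have lin: "pairing (u + v) = pairing u + pairing v" "pairing (mscale c u) = c * pairing u" for u v c
      by (simp_all add: pairing_def matrix_mult_distrib trace_add)
    have "Vector_Spaces.linear mscale mscale ?P"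
      by (simp add: Vector_Spaces.linear_iff mscale.vector_space_axioms lin add_divide_distrib mscale_distrib)
    moreover have "range ?P = trivial_submodule lie"
    proof -
      have "mscale c J \<in> range ?P" for c
        by (rule range_eqI[of _ _ "mscale c J"]) (simp add: lin pairing_J)
      then show ?thesis
        unfolding trivial_submodule_lie by auto
    qed
    moreover have "lie_on_VV A (mscale c J) = 0" if "A \<in> lie" for A c
      using that trivial_submodule_lie by (auto simp: trivial_submodule_def)
    ultimately show "Vector_Spaces.linear mscale mscale ?P \<and> range ?P = trivial_submodule lie \<and>
        (\<forall>u. ?P (?P u) = ?P u) \<and> (\<forall>A\<in>lie. \<forall>u. ?P (lie_on_VV A u) = lie_on_VV A (?P u))"
      by (simp add: lin pairing_J pairing_lie_on_VV)
  next
    fix P assume P: "Vector_Spaces.linear mscale mscale P \<and> range P = trivial_submodule lie \<and>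
      (\<forall>u. P (P u) = P u) \<and> (\<forall>A\<in>lie. \<forall>u. P (lie_on_VV A u) = lie_on_VV A (P u))"
    then have lin: "P (u + v) = P u + P v" "P (mscale c u) = mscale c (P u)" for u v c
      by (auto simp: Vector_Spaces.linear_iff)
    have P0: "P 0 = 0"
      using lin(2)[of 0 0] by simp
    have lin': "P (u - v) = P u - P v" for u v
      using lin(1)[of "u - v" v] by simp
    have P_sum: "P (sum f S) = (\<Sum>x\<in>S. P (f x))" for f :: "'i \<Rightarrow> 'i cmatrix" and S
      by (induction S rule: infinite_finite_induct) (auto simp: lin P0)
    have "P (lie_on_VV A u) = 0" if "A \<in> lie" for A u
      using P that by (auto simp: trivial_submodule_def)
    then have "P (mscale (of_nat CARD('i) - \<epsilon>) u + transpose u - mscale (pairing u) J) = 0" for u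
      by (simp add: sum_skew_mult[symmetric] P_sum skew_part_in_lie)
    moreover have "P J = J"
    proof -
      have "J \<in> range P"
        using P trivial_submodule_lie by (metis mscale_simps(4) rangeI)
      then obtain u where "J = P u" by blast
      then show ?thesis using P by metis
    qed
    ultimately have eq: "mscale (of_nat CARD('i) - \<epsilon>) (P u) + P (transpose u) = mscale (pairing u) J" for u
      by (simp add: lin lin')
    show "P = ?P"
    proof
      fix u show "P u = ?P u"
        using eq[of u] eq[of "transpose u"]
        by (intro solve_pair[of _ "P (transpose u)"]) (simp_all add: pairing_transpose)
    qed
  qed
  then show ?thesis by simp
qed

end

section \<open>Centrality in the enveloping algebra\<close>

text \<open>
  The product of all algebras presented by relations on the generators \<open>'g\<close>; as a type it cannot
  depend on a single set of relations. The enveloping algebra is one of the factors.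
\<close>

quotient_type 'g pres =
  "('g alg_term \<times> 'g alg_term) set \<Rightarrow> 'g alg_term" / "\<lambda>f g. \<forall>R. alg_cong R (f R) (g R)"
  by (intro equivpI reflpI sympI transpI) (blast intro: alg_cong.intros)+

lemma alg_cong_plus_uminus: "alg_cong R (Scalar (-1) \<boxdot> a \<boxplus> a) (Scalar 0)"
proof -
  have "alg_cong R (Scalar (-1) \<boxdot> a \<boxplus> a) (Scalar (-1) \<boxdot> a \<boxplus> Scalar 1 \<boxdot> a)"
    by (intro alg_cong.plus alg_cong.refl alg_cong.sym[OF alg_cong.times_one])
  moreover have "alg_cong R (Scalar (-1) \<boxdot> a \<boxplus> Scalar 1 \<boxdot> a) ((Scalar (-1) \<boxplus> Scalar 1) \<boxdot> a)"
    by (rule alg_cong.sym[OF alg_cong.distrib_right])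
  moreover have "alg_cong R ((Scalar (-1) \<boxplus> Scalar 1) \<boxdot> a) (Scalar 0 \<boxdot> a)"
    using alg_cong.scalar_plus[of R "-1" 1] by (intro alg_cong.times alg_cong.refl) simp
  moreover have "alg_cong R (Scalar 0 \<boxdot> a) (Scalar 0)"
    by (rule alg_cong.times_zero)
  ultimately show ?thesis
    by (meson alg_cong.trans)
qed

lemma alg_cong_times_one_right: "alg_cong R (a \<boxdot> Scalar 1) a"
  using alg_cong.trans[OF alg_cong.sym[OF alg_cong.scalar_central] alg_cong.times_one] .

instantiation pres :: (type) ab_group_add
begin

lift_definition zero_pres :: "'a pres" is "\<lambda>R. Scalar 0" .
lift_definition plus_pres :: "'a pres \<Rightarrow> 'a pres \<Rightarrow> 'a pres" is "\<lambda>f g R. f R \<boxplus> g R"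
  by (blast intro: alg_cong.plus)
lift_definition uminus_pres :: "'a pres \<Rightarrow> 'a pres" is "\<lambda>f R. Scalar (-1) \<boxdot> f R"
  by (blast intro: alg_cong.times alg_cong.refl)
definition minus_pres :: "'a pres \<Rightarrow> 'a pres \<Rightarrow> 'a pres" where "minus_pres a b = a + (- b)"

instance
proof
  fix a b c :: "'a pres"
  show "a + b + c = a + (b + c)" by transfer (blast intro: alg_cong.plus_assoc)
  show "a + b = b + a" by transfer (blast intro: alg_cong.plus_commute)
  show "0 + a = a" by transfer (blast intro: alg_cong.plus_zero)
  show "- a + a = 0" by transfer (blast intro: alg_cong_plus_uminus)
qed (simp add: minus_pres_def)

end

lift_definition pres_scale :: "complex \<Rightarrow> 'g pres \<Rightarrow> 'g pres" is "\<lambda>c f R. Scalar c \<boxdot> f R"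
  by (blast intro: alg_cong.times alg_cong.refl)

lift_definition pres_mult ::
    "('g alg_term \<times> 'g alg_term) set \<Rightarrow> 'g \<Rightarrow> 'g pres \<Rightarrow> 'g pres"
  is "\<lambda>R0 g f R. if R = R0 then Gen g \<boxdot> f R else Scalar 0"
  by (auto intro: alg_cong.times alg_cong.refl)

lift_definition pres_at :: "('g alg_term \<times> 'g alg_term) set \<Rightarrow> 'g pres \<Rightarrow> 'g alg_term \<Rightarrow> bool"
  is "\<lambda>R f a. alg_cong R (f R) a"
  by (auto intro: alg_cong.trans alg_cong.sym)

lift_definition pres_one :: "'g pres" is "\<lambda>R. Scalar 1" .

lemma pres_at_unique: "pres_at R x a \<Longrightarrow> pres_at R x b \<Longrightarrow> alg_cong R a b"
  by transfer (blast intro: alg_cong.trans alg_cong.sym)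

lemma pres_at_cong: "pres_at R x a \<Longrightarrow> alg_cong R a b \<Longrightarrow> pres_at R x b"
  by transfer (blast intro: alg_cong.trans)

lemma pres_at_one: "pres_at R pres_one (Scalar 1)"
  by transfer (rule alg_cong.refl)

lemma pres_at_eval:
  assumes "pres_at R x b"
  shows "pres_at R (eval_term pres_scale (pres_mult R) a x) (a \<boxdot> b)"
  using assms
proof (induction a arbitrary: x b)
  case (Gen g)
  then show ?case by simp (transfer, auto intro: alg_cong.times alg_cong.refl)
next
  case (Scalar c)
  then show ?case by simp (transfer, auto intro: alg_cong.times alg_cong.refl)
next
  case (Plus a1 a2)
  have "pres_at R (y + z) (s \<boxplus> t)" if "pres_at R y s" "pres_at R z t" for y z s t
    using that by transfer (blast intro: alg_cong.plus)
  then have "pres_at R (eval_term pres_scale (pres_mult R) (a1 \<boxplus> a2) x) (a1 \<boxdot> b \<boxplus> a2 \<boxdot> b)"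
    using Plus by simp
  then show ?case
    by (rule pres_at_cong) (rule alg_cong.sym[OF alg_cong.distrib_right])
next
  case (Times a1 a2)
  have "pres_at R (eval_term pres_scale (pres_mult R) (a1 \<boxdot> a2) x) (a1 \<boxdot> (a2 \<boxdot> b))"
    using Times by simp
  then show ?case
    by (rule pres_at_cong) (rule alg_cong.sym[OF alg_cong.times_assoc])
qed

lemma vector_space_pres: "vector_space (pres_scale :: complex \<Rightarrow> 'g pres \<Rightarrow> 'g pres)"
proof
  fix c d :: complex and x y :: "'g pres"
  show "pres_scale c (x + y) = pres_scale c x + pres_scale c y"
    by transfer (blast intro: alg_cong.distrib_left)
  have "alg_cong R (Scalar (c + d) \<boxdot> a) (Scalar c \<boxdot> a \<boxplus> Scalar d \<boxdot> a)" for R and a :: "'g alg_term"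
    by (rule alg_cong.trans[OF _ alg_cong.distrib_right])
      (intro alg_cong.times alg_cong.refl alg_cong.sym[OF alg_cong.scalar_plus])
  then show "pres_scale (c + d) x = pres_scale c x + pres_scale d x"
    by transfer blast
  have "alg_cong R (Scalar c \<boxdot> (Scalar d \<boxdot> a)) (Scalar (c * d) \<boxdot> a)" for R and a :: "'g alg_term"
    by (rule alg_cong.trans[OF alg_cong.sym[OF alg_cong.times_assoc]])
      (intro alg_cong.times alg_cong.refl alg_cong.scalar_times)
  then show "pres_scale c (pres_scale d x) = pres_scale (c * d) x"
    by transfer blast
  show "pres_scale 1 x = x"
    by transfer (blast intro: alg_cong.times_one)
qed

context
  fixes \<gg> :: "'i::finite cmatrix set"
begin

abbreviation "env \<equiv> alg_cong (env_rels \<gg>)"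

lemma pres_mult_linear:
  "Vector_Spaces.linear pres_scale pres_scale (pres_mult (env_rels \<gg>) A)"
proof -
  have "env (Gen A \<boxdot> (Scalar c \<boxdot> a)) (Scalar c \<boxdot> (Gen A \<boxdot> a))" for c a
    by (meson alg_cong.intros)
  moreover have "alg_cong R (Scalar 0) (Scalar 0 \<boxplus> Scalar 0)" "alg_cong R (Scalar 0) (Scalar c \<boxdot> Scalar 0)"
    for R :: "('i cmatrix alg_term \<times> 'i cmatrix alg_term) set" and c
    using alg_cong.scalar_plus[of R 0 0] alg_cong.scalar_times[of R c 0] by (auto intro: alg_cong.sym)
  ultimately show ?thesis
    unfolding Vector_Spaces.linear_iff
    by (intro conjI vector_space_pres allI; transfer) (auto intro: alg_cong.distrib_left)
qed

lemma lie_module_pres: "lie_module \<gg> pres_scale (pres_mult (env_rels \<gg>))"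
proof -
  have zero: "alg_cong R (Scalar 0) (Scalar 0 \<boxplus> Scalar 0)" "alg_cong R (Scalar 0) (Scalar c \<boxdot> Scalar 0)"
    "alg_cong R (Scalar 0) (Scalar 0 \<boxplus> Scalar (-1) \<boxdot> Scalar 0)"
    for R :: "('i cmatrix alg_term \<times> 'i cmatrix alg_term) set" and c
  proof -
    show 1: "alg_cong R (Scalar 0) (Scalar 0 \<boxplus> Scalar 0)" and 2: "alg_cong R (Scalar 0) (Scalar c \<boxdot> Scalar 0)" for c
      using alg_cong.scalar_plus[of R 0 0] alg_cong.scalar_times[of R c 0] by (auto intro: alg_cong.sym)
    show "alg_cong R (Scalar 0) (Scalar 0 \<boxplus> Scalar (-1) \<boxdot> Scalar 0)"
      by (rule alg_cong.trans[OF 1]) (intro alg_cong.plus alg_cong.refl 2)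
  qed
  show ?thesis
    unfolding lie_module_def
  proof (intro conjI ballI allI pres_mult_linear)
    fix A C c and x :: "'i cmatrix pres" assume A: "A \<in> \<gg>"
    show "pres_mult (env_rels \<gg>) (mscale c A) x = pres_scale c (pres_mult (env_rels \<gg>) A x)"
    proof -
      have "env (Gen (mscale c A)) (Scalar c \<boxdot> Gen A)"
        using A by (intro alg_cong.rel) (auto simp: env_rels_def)
      then have "env (Gen (mscale c A) \<boxdot> a) (Scalar c \<boxdot> (Gen A \<boxdot> a))" for a
        by (meson alg_cong.intros)
      then show ?thesis by transfer (auto intro: zero)
    qed
    assume C: "C \<in> \<gg>"
    show "pres_mult (env_rels \<gg>) (A + C) x = pres_mult (env_rels \<gg>) A x + pres_mult (env_rels \<gg>) C x"
    proof -
      have "env (Gen (A + C)) (Gen A \<boxplus> Gen C)"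
        using A C by (intro alg_cong.rel) (auto simp: env_rels_def)
      then have "env (Gen (A + C) \<boxdot> a) (Gen A \<boxdot> a \<boxplus> Gen C \<boxdot> a)" for a
        by (meson alg_cong.intros)
      then show ?thesis by transfer (auto intro: zero)
    qed
    show "pres_mult (env_rels \<gg>) (bracket A C) x = pres_mult (env_rels \<gg>) A (pres_mult (env_rels \<gg>) C x) -
        pres_mult (env_rels \<gg>) C (pres_mult (env_rels \<gg>) A x)"
    proof -
      have "env (Gen (bracket A C)) (Gen A \<boxdot> Gen C \<boxminus> Gen C \<boxdot> Gen A)"
        using A C by (intro alg_cong.rel) (auto simp: env_rels_def)
      then have "env (Gen (bracket A C) \<boxdot> a) ((Gen A \<boxdot> Gen C \<boxminus> Gen C \<boxdot> Gen A) \<boxdot> a)" for a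
        by (intro alg_cong.times alg_cong.refl)
      moreover have "env ((Gen A \<boxdot> Gen C \<boxminus> Gen C \<boxdot> Gen A) \<boxdot> a)
          (Gen A \<boxdot> (Gen C \<boxdot> a) \<boxplus> Scalar (-1) \<boxdot> (Gen C \<boxdot> (Gen A \<boxdot> a)))" for a
      proof -
        have "env (Scalar (-1) \<boxdot> (Gen C \<boxdot> Gen A) \<boxdot> a) (Scalar (-1) \<boxdot> (Gen C \<boxdot> (Gen A \<boxdot> a)))"
          by (rule alg_cong.trans[OF alg_cong.times_assoc])
            (intro alg_cong.times alg_cong.refl alg_cong.times_assoc)
        then show ?thesis
          by (intro alg_cong.trans[OF alg_cong.distrib_right] alg_cong.plus alg_cong.times_assoc)
      qed
      ultimately have "env (Gen (bracket A C) \<boxdot> a)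
          (Gen A \<boxdot> (Gen C \<boxdot> a) \<boxplus> Scalar (-1) \<boxdot> (Gen C \<boxdot> (Gen A \<boxdot> a)))" for a
        by (blast intro: alg_cong.trans)
      then show ?thesis unfolding minus_pres_def by transfer (auto intro: zero)
    qed
  qed
qed

end

lemma (in tensor_rep) app_env_eval:
  assumes "set_alg_term u \<subseteq> lie"
  shows "app (env_eval u) f w = eval_term sc \<rho> u (f w)"
  using assms unfolding env_eval_def
  by (induction u arbitrary: f) (auto simp: app_topr app_tscal tscale_def at_factor_def)

lemma (in invariant_form) trace_term_in_centre: "trace_term l \<in> env_centre lie"
proof -
  let ?R = "env_rels lie"
  interpret U: tensor_rep J \<epsilon> "pres_scale :: complex \<Rightarrow> 'i cmatrix pres \<Rightarrow> 'i cmatrix pres" "pres_mult ?R"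
    by (intro tensor_rep.intro tensor_rep_axioms.intro invariant_form_axioms vector_space_pres lie_module_pres)
  have gen: "alg_cong ?R (trace_term l \<boxdot> Gen A) (Gen A \<boxdot> trace_term l)" if "A \<in> lie" for A
  proof -
    have A: "set_alg_term (Gen A) \<subseteq> lie" using that by simp
    have "U.env_eval (trace_term l) * U.env_eval (Gen A) = U.env_eval (Gen A) * U.env_eval (trace_term l)"
      using U.trace_term_central[OF that, of l] by (simp add: U.env_eval_def)
    then have "app (U.env_eval (trace_term l) * U.env_eval (Gen A)) f = app (U.env_eval (Gen A) * U.env_eval (trace_term l)) f" for f
      by simp
    from fun_cong[OF this[of "\<lambda>_. pres_one"], of "\<lambda>_. undefined"]
    have "eval_term pres_scale (pres_mult ?R) (trace_term l \<boxdot> Gen A) pres_one =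
        eval_term pres_scale (pres_mult ?R) (Gen A \<boxdot> trace_term l) pres_one"
      by (simp add: U.app_env_eval[OF A] U.app_env_eval[OF set_trace_term])
    then have "alg_cong ?R (trace_term l \<boxdot> Gen A \<boxdot> Scalar 1) (Gen A \<boxdot> trace_term l \<boxdot> Scalar 1)"
      by (metis pres_at_eval pres_at_one pres_at_unique)
    then show ?thesis
      by (meson alg_cong.trans alg_cong.sym alg_cong_times_one_right)
  qed
  have "alg_cong ?R (trace_term l \<boxdot> a) (a \<boxdot> trace_term l)" if "set_alg_term a \<subseteq> lie" for a
    using that
  proof (induction a)
    case (Scalar c)
    then show ?case by (intro alg_cong.sym[OF alg_cong.scalar_central])
  next
    case (Plus a b)
    then have "alg_cong ?R (trace_term l \<boxdot> a \<boxplus> trace_term l \<boxdot> b) (a \<boxdot> trace_term l \<boxplus> b \<boxdot> trace_term l)"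
      by (intro alg_cong.plus) auto
    then show ?case
      by (meson alg_cong.trans alg_cong.sym alg_cong.distrib_left alg_cong.distrib_right)
  next
    case (Times a b)
    then have "alg_cong ?R (trace_term l \<boxdot> a \<boxdot> b) (a \<boxdot> trace_term l \<boxdot> b)"
      by - (rule alg_cong.times, auto intro: alg_cong.refl)
    moreover have "alg_cong ?R (a \<boxdot> (trace_term l \<boxdot> b)) (a \<boxdot> (b \<boxdot> trace_term l))"
      using Times by - (rule alg_cong.times, auto intro: alg_cong.refl)
    ultimately show ?case
      by (meson alg_cong.trans alg_cong.sym alg_cong.times_assoc)
  qed (simp add: gen)
  then show ?thesis
    using set_trace_term by (auto simp: env_centre_def terms_over_def)
qed

section \<open>The forms\<close>

lemma pos_less: "pos a < pos b \<longleftrightarrow> a < b" for a b :: "'i::{finite,linorder}"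
proof -
  have mono: "pos a < pos b" if "a < b" for a b :: 'i
    unfolding pos_def using that by (intro psubset_card_mono) auto
  show ?thesis
    using mono[of a b] mono[of b a] by (cases a b rule: linorder_cases) auto
qed

lemma bij_pos: "bij_betw (pos :: 'i::{finite,linorder} \<Rightarrow> nat) UNIV {..<CARD('i)}"
proof -
  have inj: "inj (pos :: 'i \<Rightarrow> nat)"
    by (metis injI less_irrefl linorder_cases pos_less)
  moreover have "pos a < CARD('i)" for a :: 'i
    unfolding pos_def by (intro psubset_card_mono) auto
  then have "range (pos :: 'i \<Rightarrow> nat) = {..<CARD('i)}"
    using inj by (intro card_subset_eq) (auto simp: card_image)
  ultimately show ?thesis
    by (simp add: bij_betw_def)
qed

lemma pos_eq: "pos a = pos b \<longleftrightarrow> a = b" for a b :: "'i::{finite,linorder}"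
  using pos_less[of a b] pos_less[of b a] by (metis less_irrefl linorder_cases)

lemma sum_pos: "(\<Sum>a\<in>(UNIV :: 'i::{finite,linorder} set). f (pos a)) = (\<Sum>x<CARD('i). f x)"
  using sum.reindex_bij_betw[OF bij_pos] .

lemma cmat_nth: "cmat A $ a $ b = of_real (A $ a $ b)"
  by (simp add: cmat_def)

lemma cmat_mult: "cmat (A ** C) = cmat A ** cmat C"
  by (simp add: vec_eq_iff cmat_nth matrix_matrix_mult_def)

lemma cmat_transpose: "cmat (transpose A) = transpose (cmat A)"
  by (simp add: vec_eq_iff cmat_nth transpose_def)

lemma cmat_add: "cmat (A + C) = cmat A + cmat C"
  by (simp add: vec_eq_iff cmat_nth)

lemma matrix_inv_eq:
  fixes A C :: "'i::finite cmatrix"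
  assumes "A ** C = mat 1" "C ** A = mat 1"
  shows "matrix_inv A = C"
  unfolding matrix_inv_def
proof (rule some_equality)
  fix D assume "A ** D = mat 1 \<and> D ** A = mat 1"
  then have "C ** (A ** D) = C" by simp
  then show "D = C"
    using assms by (simp add: matrix_mul_assoc)
qed (use assms in simp)

lemma form_matrix_Orth:
  "cmat (form_matrix (Orth p q) :: 'i::{finite,linorder} rmatrix) $ a $ b =
    (if a = b then if pos a < p then 1 else -1 else 0)"
  by (simp add: cmat_nth)

lemma form_matrix_Symp:
  "cmat (form_matrix (Symp n) :: 'i::{finite,linorder} rmatrix) $ a $ b =
    (if pos b = pos a + n then 1 else if pos a = pos b + n then -1 else 0)"
  by (simp add: cmat_nth)

lemma
  fixes G :: real_form
  defines "J \<equiv> cmat (form_matrix G) :: 'i::{finite,linorder} cmatrix"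
  assumes dim: "CARD('i) = form_dim G"
  shows transpose_form: "transpose J = mscale (form_sign G) J"
    and form_form: "J ** J = mscale (form_sign G) (mat 1)"
    and trace_form: "trace J = m1 G"
proof -
  have "transpose J = mscale (form_sign G) J \<and> J ** J = mscale (form_sign G) (mat 1) \<and> trace J = m1 G"
  proof (cases G)
    case (Orth p q)
    have J: "J $ a $ b = (if a = b then if pos a < p then 1 else -1 else 0)" for a b
      unfolding J_def Orth by (rule form_matrix_Orth)
    have "trace J = (\<Sum>x<p + q. if x < p then 1 else -1)"
      using dim sum_pos[where 'i = 'i, of "\<lambda>x. if x < p then 1 else (-1 :: complex)"]
      by (simp add: trace_def J Orth)
    also have "{..<p + q} = {..<p} \<union> {p..<p + q}"
      by auto
    also have "(\<Sum>x\<in>\<dots>. if x < p then 1 else (-1 :: complex)) = of_nat p - of_nat q"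
      by (subst sum.union_disjoint) auto
    finally show ?thesis
      using Orth
      by (auto simp: vec_eq_iff J transpose_def mscale_nth matrix_matrix_mult_def mat_def
          if_distrib[of "\<lambda>x. y * x" for y] if_distrib[of "\<lambda>x. x * y" for y] cong: if_cong)
  next
    case (Symp n)
    define F :: "nat \<Rightarrow> nat \<Rightarrow> complex"
      where "F x y = (if y = x + n then 1 else if x = y + n then -1 else 0)" for x y
    have J: "J $ a $ b = F (pos a) (pos b)" for a b
      unfolding J_def Symp F_def by (rule form_matrix_Symp)
    have n: "n > 0" and card: "CARD('i) = 2 * n"
      using dim Symp finite_UNIV_card_ge_0[where 'a = 'i] by auto
    have pos: "pos a < 2 * n" for a :: 'i
      using bij_pos[where 'i = 'i] card by (auto simp: bij_betw_def)
    have "(J ** J) $ a $ b = (if a = b then -1 else 0)" for a b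
    proof -
      have "(J ** J) $ a $ b = (\<Sum>x<2 * n. F (pos a) x * F x (pos b))"
        using sum_pos[where 'i = 'i, of "\<lambda>x. F (pos a) x * F x (pos b)"]
        by (simp add: matrix_matrix_mult_def J card)
      also have "\<dots> = (\<Sum>x\<in>{if pos a < n then pos a + n else pos a - n}. F (pos a) x * F x (pos b))"
        using pos[of a] by (intro sum.mono_neutral_right) (auto simp: F_def split: if_splits)
      also have "\<dots> = (if a = b then -1 else 0)"
        using pos[of a] pos[of b] n by (auto simp: F_def pos_eq[symmetric])
      finally show ?thesis .
    qed
    moreover have "transpose J = mscale (-1) J"
      using n by (auto simp: vec_eq_iff transpose_def J F_def mscale_nth)
    moreover have "trace J = 0"
      using n by (simp add: trace_def J F_def)
    ultimately show ?thesis
      using Symp by (auto simp: vec_eq_iff mscale_nth mat_def)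
  qed
  then show "transpose J = mscale (form_sign G) J" "J ** J = mscale (form_sign G) (mat 1)" "trace J = m1 G"
    by simp_all
qed

lemma m0_eq: "m0 G = form_sign G * of_nat (form_dim G)"
  by (cases G) simp_all

lemma invariant_form_cmat:
  assumes "(\<exists>p q n. G = Orth p q \<and> p + q = 2 * n + 1) \<or> (\<exists>n. G = Symp n)"
    and dim: "CARD('i::{finite,linorder}) = form_dim G"
  shows "invariant_form (cmat (form_matrix G) :: 'i cmatrix) (form_sign G)"
proof
  show "of_nat CARD('i) \<noteq> 2 * form_sign G"
  proof (cases G)
    case (Orth p q)
    with assms(1) obtain n where "CARD('i) = 2 * n + 1" using dim by auto
    then have "CARD('i) \<noteq> 2" by presburger
    then have "of_nat CARD('i) \<noteq> (of_nat 2 :: complex)" unfolding of_nat_eq_iff .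
    with Orth show ?thesis by simp
  next
    case (Symp n)
    have "complex_of_nat CARD('i) + of_nat 2 \<noteq> 0"
      unfolding of_nat_add[symmetric] of_nat_eq_0_iff by simp
    with Symp show ?thesis by (simp add: eq_neg_iff_add_eq_0)
  qed
  show "form_sign G * form_sign G = 1" by (cases G) simp_all
qed (simp_all add: transpose_form[OF dim] form_form[OF dim])

lemma lie_algebra_eq:
  assumes "invariant_form (cmat (form_matrix G) :: 'i::{finite,linorder} cmatrix) \<epsilon>"
  shows "lie_algebra G = invariant_form.lie (cmat (form_matrix G) :: 'i cmatrix)"
proof -
  interpret invariant_form "cmat (form_matrix G) :: 'i cmatrix" \<epsilon> by fact
  define R where "R = (form_matrix G :: 'i rmatrix)"
  have eq: "transpose (cmat A + mscale \<i> (cmat B)) ** cmat R + cmat R ** (cmat A + mscale \<i> (cmat B)) =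
      cmat (transpose A ** R + R ** A) + mscale \<i> (cmat (transpose B ** R + R ** B))" for A B
    by (simp add: cmat_add cmat_mult cmat_transpose transpose_distrib matrix_mult_distrib mscale_distrib algebra_simps)
  have zero: "cmat A + mscale \<i> (cmat B) = 0 \<longleftrightarrow> A = 0 \<and> B = 0" for A B :: "'i rmatrix"
    by (auto simp: vec_eq_iff cmat_nth mscale_nth complex_eq_iff)
  have split: "\<exists>A B. C = cmat A + mscale \<i> (cmat B)" for C :: "'i cmatrix"
    by (intro exI[of _ "\<chi> a b. Re (C $ a $ b)"] exI[of _ "\<chi> a b. Im (C $ a $ b)"])
      (simp add: vec_eq_iff cmat_nth mscale_nth complex_eq_iff)
  have iff: "cmat A + mscale \<i> (cmat B) \<in> lie \<longleftrightarrow> A \<in> real_lie_algebra G \<and> B \<in> real_lie_algebra G" for A B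
  proof -
    have iff: "cmat A + mscale \<i> (cmat B) \<in> lie \<longleftrightarrow>
        transpose (cmat A + mscale \<i> (cmat B)) ** cmat R + cmat R ** (cmat A + mscale \<i> (cmat B)) = 0"
      unfolding R_def by (rule lie_iff(1))
    also have "\<dots> \<longleftrightarrow> transpose A ** R + R ** A = 0 \<and> transpose B ** R + R ** B = 0"
      unfolding eq by (rule zero)
    finally show ?thesis
      by (simp add: real_lie_algebra_def R_def)
  qed
  show ?thesis
  proof (intro set_eqI iffI)
    fix C :: "'i cmatrix" assume "C \<in> lie_algebra G"
    then show "C \<in> lie" by (auto simp: lie_algebra_def iff)
  next
    fix C :: "'i cmatrix" assume C: "C \<in> lie"
    obtain A B where "C = cmat A + mscale \<i> (cmat B)" using split by metis
    with C iff show "C \<in> lie_algebra G" unfolding lie_algebra_def by blast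
  qed
qed

lemma xi_facts:
  assumes "invariant_form (cmat (form_matrix G) :: 'i::{finite,linorder} cmatrix) (form_sign G)"
    and dim: "CARD('i) = form_dim G"
  shows "xi G ** xi G = (mat 1 :: 'i cmatrix)"
    and "invariant_form.star (cmat (form_matrix G)) (xi G) = mscale (form_sign G) (xi G :: 'i cmatrix)"
    and "trace (xi G :: 'i cmatrix) = m1 G"
proof -
  interpret invariant_form "cmat (form_matrix G) :: 'i cmatrix" "form_sign G" by fact
  obtain c where c: "xi G = mscale c (cmat (form_matrix G) :: 'i cmatrix)" "c * c * form_sign G = 1" "c * m1 G = m1 G"
  proof (cases G)
    case Orth
    then show ?thesis by (intro that[of 1]) simp_all
  next
    case Symp
    then show ?thesis by (intro that[of \<i>]) simp_all
  qed
  show "xi G ** xi G = (mat 1 :: 'i cmatrix)"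
    by (simp add: c J_J mult.assoc[symmetric])
  show "star (xi G) = mscale (form_sign G) (xi G)"
    by (simp add: c star_linear) (simp add: star_def transpose_J J_J_mult J_J eps_sq mult_ac)
  show "trace (xi G :: 'i cmatrix) = m1 G"
    by (simp add: c trace_form[OF dim])
qed

lemma max_compact_facts:
  assumes "invariant_form (cmat (form_matrix G) :: 'i::{finite,linorder} cmatrix) (form_sign G)"
    and dim: "CARD('i) = form_dim G" and g: "g \<in> max_compact G"
  defines "h \<equiv> invariant_form.star (cmat (form_matrix G)) (cmat g) :: 'i cmatrix"
  shows "h ** cmat g = mat 1" "cmat g ** h = mat 1" "cmat g ** xi G ** h = xi G"
    "matrix_inv (cmat g) = h"
proof -
  interpret invariant_form "cmat (form_matrix G) :: 'i cmatrix" "form_sign G" by fact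
  have xi: "xi G ** xi G = (mat 1 :: 'i cmatrix)"
    by (rule xi_facts(1)[OF assms(1) dim])
  have "cmat (transpose g ** form_matrix G ** g) = cmat (form_matrix G)"
    using g by (simp add: max_compact_def real_group_def)
  then have "transpose (cmat g) ** cmat (form_matrix G) ** cmat g = cmat (form_matrix G)"
    by (simp add: cmat_mult cmat_transpose)
  then show 1: "h ** cmat g = mat 1"
    by (simp add: h_def star_def matrix_mul_assoc[symmetric] transpose_J_J)
  then show 2: "cmat g ** h = mat 1"
    using matrix_left_right_inverse[of h "cmat g"] by simp
  show "matrix_inv (cmat g) = h"
    by (rule matrix_inv_eq[OF 2 1])
  have "xi G ** cmat g ** xi G = cmat g"
    using g matrix_inv_eq[OF xi xi] by (simp add: max_compact_def)
  then have "xi G ** cmat g ** (xi G ** xi G) = cmat g ** xi G"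
    by (simp only: matrix_mul_assoc)
  then have "cmat g ** xi G = xi G ** cmat g"
    by (simp add: xi)
  then show "cmat g ** xi G ** h = xi G"
    by (simp add: matrix_mul_assoc[symmetric] 2)
qed


section \<open>The action on tensors\<close>

context tensor_rep
begin

lemma tensors_closed:
  "f \<in> tensors k \<Longrightarrow> tscale sc c f \<in> tensors k"
  "f \<in> tensors k \<Longrightarrow> g \<in> tensors k \<Longrightarrow> f + g \<in> tensors k"
  "(\<And>x. x \<in> S \<Longrightarrow> F x \<in> tensors k) \<Longrightarrow> sum F S \<in> tensors k"
  "(0 :: (nat \<Rightarrow> 'i) \<Rightarrow> 'x) \<in> tensors k"
  by (auto simp: tensors_def tscale_def sum_fun_apply)

lemma words_iff: "w \<in> words k \<longleftrightarrow> (\<forall>i. i \<notin> {1..k} \<longrightarrow> w i = undefined)" for w :: "nat \<Rightarrow> 'i"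
  by (auto simp: words_def PiE_def extensional_def)

lemma words_upd: "i \<in> {1..k} \<Longrightarrow> w(i := b) \<in> words k \<longleftrightarrow> w \<in> words k"
  for w :: "nat \<Rightarrow> 'i"
  by (auto simp: words_iff)

lemma at_factor_tensors:
  "\<lbrakk>i \<le> k; i = 0 \<longrightarrow> A \<in> lie; f \<in> tensors k\<rbrakk> \<Longrightarrow> at_factor sc \<rho> A i f \<in> tensors k"
  by (auto simp: tensors_def at_factor_def words_upd \<rho>_zero)

lemma app_topr_tensors:
  "\<lbrakk>i \<le> k; i = 0 \<longrightarrow> A \<in> lie; f \<in> tensors k\<rbrakk> \<Longrightarrow> app (topr A i) f \<in> tensors k"
  using at_factor_tensors app_topr by metis

lemma app_tscal_tensors: "f \<in> tensors k \<Longrightarrow> app (tscal c) f \<in> tensors k"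
  by (simp add: app_tscal tensors_closed)

lemma app_csum_tensors:
  assumes "\<And>X f. f \<in> tensors k \<Longrightarrow> app (F X) f \<in> tensors k" "\<And>X f. f \<in> tensors k \<Longrightarrow> app (H X) f \<in> tensors k"
    and "f \<in> tensors k"
  shows "app (csum F H) f \<in> tensors k"
  unfolding csum_def app_sum using assms by (auto intro!: tensors_closed)

lemma app_bvw_elem_tensors:
  assumes "g \<in> generic_bvw_gens k" "f \<in> tensors k"
  shows "app (bvw_elem \<xi> g) f \<in> tensors k"
proof -
  have skew: "app (skew_opr l X) f \<in> tensors k" if "l \<le> k" "f \<in> tensors k" for l X f
    using that unfolding skew_opr_def by (intro app_topr_tensors) (auto simp: skew_part_in_lie)
  have casimir: "app (casimir l i) f \<in> tensors k" if "l \<le> k" "i \<noteq> 0" "i \<le> k" "f \<in> tensors k" for l i f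
    using that unfolding casimir_def by (intro app_csum_tensors skew app_topr_tensors) auto
  from assms(1) consider i where "g = T i" "i \<noteq> 0" "Suc i \<le> k" | i where "g = E i" "i \<noteq> 0" "Suc i \<le> k"
    | i where "g = Z i" "i \<noteq> 0" "i \<le> k" | i where "g = Th i" "i \<noteq> 0" "i \<le> k" | l where "g = W l"
    by (auto simp: generic_bvw_gens_def bvw_gens_def)
  then show ?thesis
  proof cases
    case (1 i)
    then show ?thesis
      using assms(2) by (auto simp: swp_def intro!: app_tscal_tensors app_csum_tensors app_topr_tensors)
  next
    case (2 i)
    then show ?thesis
      using assms(2) by (auto simp: contr_def intro!: app_tscal_tensors app_csum_tensors app_topr_tensors)
  next
    case (3 i)
    then show ?thesis
      using assms(2)
      by (auto simp: jucys_murphy_def app_sum intro!: app_tscal_tensors casimir tensors_closed)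
  next
    case (4 i)
    then show ?thesis
      using assms(2) by (auto intro!: app_topr_tensors)
  next
    case (5 l)
    have "eval_term sc \<rho> u 0 = 0" if "set_alg_term u \<subseteq> lie" for u
      using app_env_eval[OF that, of 0 undefined] by simp
    with 5 assms(2) show ?thesis
      by (auto simp: tensors_def app_env_eval set_trace_term)
  qed
qed

lemma app_ring_eval_tensors:
  assumes "a \<in> terms_over (generic_bvw_gens k)" "f \<in> tensors k"
  shows "app (ring_eval tscal (bvw_elem \<xi>) a) f \<in> tensors k"
  using assms
  by (induction a arbitrary: f) (auto simp: terms_over_def app_bvw_elem_tensors app_tscal_tensors intro!: tensors_closed)

end

locale tensor_rep_group = tensor_rep J \<epsilon> sc \<rho>
  for J :: "'i::finite cmatrix" and \<epsilon> :: complex and sc :: "complex \<Rightarrow> 'x::ab_group_add \<Rightarrow> 'x" and \<rho> +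
  fixes \<tau> :: "'x \<Rightarrow> 'x" and g :: "'i cmatrix"
  assumes inv: "star g ** g = mat 1" "g ** star g = mat 1"
    and linear_\<tau>: "Vector_Spaces.linear sc sc \<tau>"
    and \<tau>_\<rho>: "A \<in> lie \<Longrightarrow> \<tau> (\<rho> A x) = \<rho> (g ** A ** star g) (\<tau> x)"
begin

lemma \<tau>_linear: "\<tau> (x + y) = \<tau> x + \<tau> y" "\<tau> (sc c x) = sc c (\<tau> x)"
  using linear_\<tau> by (auto simp: Vector_Spaces.linear_iff)

lemma \<tau>_zero: "\<tau> 0 = 0"
  using \<tau>_linear(2)[of 0 0] by simp

sublocale tensor_ops_group J \<epsilon> tscal topr "pointwise \<tau>" g
proof
  show "pointwise \<tau> * topr A 0 = topr (g ** A ** star g) 0 * pointwise \<tau>" if "A \<in> lie" for A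
  proof -
    have "g ** A ** star g \<in> lie"
      using that by (simp add: lie_def star_mult matrix_mult_distrib matrix_mul_assoc)
    with that show ?thesis
      by (intro endo_eqI) (simp add: fun_eq_iff topr_0_eq app_pointwise \<tau>_linear \<rho>_add \<tau>_\<rho>)
  qed
qed (simp_all add: inv pointwise_commute_topr pointwise_commute_tscal \<tau>_linear)

lemma app_group_op:
  "app (group_op k) f w = (\<Sum>v\<in>words k. sc (\<Prod>i=1..k. g $ w i $ v i)
    (\<tau> (f (\<lambda>i. if i \<in> {1..k} then v i else w i))))"
proof (induction k arbitrary: w)
  case 0
  have "words 0 = {\<lambda>i. undefined :: 'i}"
    by (auto simp: words_def)
  then show ?case by (simp add: app_pointwise \<tau>_linear)
next
  case (Suc k)
  have inj: "inj_on (\<lambda>(b, v). v(Suc k := b)) (UNIV \<times> words k :: ('i \<times> (nat \<Rightarrow> 'i)) set)"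
    unfolding words_def by (rule inj_combinator) simp
  have words: "words (Suc k) = (\<lambda>(b, v). v(Suc k := b)) ` (UNIV \<times> words k :: ('i \<times> (nat \<Rightarrow> 'i)) set)"
    unfolding words_def atLeastAtMostSuc_conv[of 1 k, simplified] One_nat_def by (rule PiE_insert_eq)
  have prod: "(\<Prod>i=1..k. g $ (w(Suc k := b)) i $ v i) = (\<Prod>i=1..k. g $ w i $ (v(Suc k := b)) i)" for b v
    by (intro prod.cong) auto
  have override: "(\<lambda>i. if i \<in> {1..k} then v i else (w(Suc k := b)) i) =
      (\<lambda>i. if i \<in> {1..Suc k} then (v(Suc k := b)) i else w i)" for v b
    by (auto simp: fun_eq_iff)
  have "app (group_op (Suc k)) f w = (\<Sum>b\<in>UNIV. sc (g $ w (Suc k) $ b) (app (group_op k) f (w(Suc k := b))))"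
    by (simp add: app_topr at_factor_def)
  also have "\<dots> = (\<Sum>b\<in>UNIV. \<Sum>v\<in>words k. sc (\<Prod>i=1..Suc k. g $ w i $ (v(Suc k := b)) i)
      (\<tau> (f (\<lambda>i. if i \<in> {1..Suc k} then (v(Suc k := b)) i else w i))))"
    unfolding Suc override
    by (simp add: scale_sum_right prod mult.commute)
  also have "\<dots> = (\<Sum>v\<in>words (Suc k). sc (\<Prod>i=1..Suc k. g $ w i $ v i)
      (\<tau> (f (\<lambda>i. if i \<in> {1..Suc k} then v i else w i))))"
    unfolding words sum.reindex[OF inj] by (simp only: sum.cartesian_product comp_def case_prod_unfold)
  finally show ?case .
qed

lemma app_group_op_tensors:
  assumes "f \<in> tensors k"
  shows "app (group_op k) f =
    (\<lambda>w. if w \<in> words k then \<Sum>v\<in>words k. sc (\<Prod>i=1..k. g $ w i $ v i) (\<tau> (f v)) else 0)"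
proof
  fix w
  show "app (group_op k) f w =
    (if w \<in> words k then \<Sum>v\<in>words k. sc (\<Prod>i=1..k. g $ w i $ v i) (\<tau> (f v)) else 0)"
  proof (cases "w \<in> words k")
    case True
    then have "(\<lambda>i. if i \<in> {1..k} then v i else w i) = v" if "v \<in> words k" for v
      using that by (auto simp: words_iff fun_eq_iff)
    with True show ?thesis
      unfolding app_group_op by (auto intro!: sum.cong)
  next
    case False
    then have "(\<lambda>i. if i \<in> {1..k} then v i else w i) \<notin> words k" for v
      by (auto simp: words_iff)
    with False assms show ?thesis
      unfolding app_group_op by (simp add: tensors_def \<tau>_zero del: atLeastAtMost_iff)
  qed
qed

end

lemma set_power: "set_alg_term (a \<up> l) \<subseteq> set_alg_term a"
  by (induction l) auto

lemma symmetric_rels_gens: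
  "(a, b) \<in> symmetric_rels k \<Longrightarrow> set_alg_term a \<union> set_alg_term b \<subseteq> bvw_gens k"
  by (erule symmetric_rels.cases) (auto simp: bvw_gens_def)

lemma brauer_rels_gens:
  "(a, b) \<in> brauer_rels k m \<Longrightarrow> set_alg_term a \<union> set_alg_term b \<subseteq> bvw_gens k"
  by (erule brauer_rels.cases, use symmetric_rels_gens[of a b k] in simp) (auto simp: bvw_gens_def)

lemma vw_rels_gens:
  "(a, b) \<in> vw_rels k m w \<Longrightarrow>
    set_alg_term a \<union> set_alg_term b \<subseteq> bvw_gens k \<union> (\<Union>l. set_alg_term (w l))"
  by (erule vw_rels.cases, use brauer_rels_gens[of a b k m] in auto)
    (use set_power[of "zz 1"] in \<open>fastforce simp: bvw_gens_def\<close>)+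

lemma bvw_rels_gens:
  "(a, b) \<in> bvw_rels k m m' \<epsilon> w \<Longrightarrow>
    set_alg_term a \<union> set_alg_term b \<subseteq> bvw_gens k \<union> (\<Union>l. set_alg_term (w l))"
  by (erule bvw_rels.cases, use vw_rels_gens[of a b k m w] in auto) (auto simp: bvw_gens_def)

locale real_form_module =
  fixes G :: real_form
    and sc :: "complex \<Rightarrow> 'x::ab_group_add \<Rightarrow> 'x"
    and \<rho> :: "'i::{finite,linorder} cmatrix \<Rightarrow> 'x \<Rightarrow> 'x"
    and \<sigma> :: "'i rmatrix \<Rightarrow> 'x \<Rightarrow> 'x"
    and B :: "'i cmatrix set"
  assumes form: "(\<exists>p q n. G = Orth p q \<and> p + q = 2 * n + 1) \<or> (\<exists>n. G = Symp n)"
    and dim: "CARD('i) = form_dim G"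
    and module: "gK_module G sc \<rho> \<sigma>"
    and basis: "basis_of mscale (lie_algebra G) B"
begin

sublocale invariant_form "cmat (form_matrix G) :: 'i cmatrix" "form_sign G"
  using invariant_form_cmat[OF form dim] .

lemma lie_algebra: "lie_algebra G = lie"
  by (rule lie_algebra_eq) (rule invariant_form_axioms)

sublocale tensor_rep "cmat (form_matrix G) :: 'i cmatrix" "form_sign G" sc \<rho>
  using module lie_algebra
  by (intro tensor_rep.intro tensor_rep_axioms.intro invariant_form_axioms) (simp_all add: gK_module_def)

abbreviation "generator \<equiv> bvw_elem (xi G)"

lemma lie_basis: "basis_of mscale lie B"
  using basis by (simp add: lie_algebra)

lemma m0_card: "m0 G = form_sign G * of_nat CARD('i)"
  by (simp add: m0_eq dim)

lemma app_omega:
  assumes "i \<noteq> 0"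
  shows "omega G sc \<rho> B j i f = app (tscal (1 / (2 * (of_nat CARD('i) - 2 * form_sign G))) * casimir j i) f"
proof -
  have "b \<in> lie" if "b \<in> B" for b
    using lie_basis that mscale.span_base by (auto simp: basis_of_def)
  then have "omega G sc \<rho> B j i f = app (\<Sum>b\<in>B. topr b j * topr (killing_dual lie B b) i) f"
    using assms by (simp add: omega_def app_sum app_topr lie_algebra)
  then show ?thesis
    by (simp only: sum_killing_dual[OF lie_basis assms])
qed

lemma app_generator:
  assumes "g \<in> generic_bvw_gens k"
  shows "app (generator g) f = bvw_op G sc \<rho> B trace_term g f"
proof -
  let ?\<epsilon> = "form_sign G" and ?N = "of_nat CARD('i) :: complex"
  from assms consider i where "g = T i" "i \<noteq> 0" | i where "g = E i" "i \<noteq> 0" | i where "g = Z i" "i \<noteq> 0"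
    | i where "g = Th i" "i \<noteq> 0" | l where "g = W l"
    by (auto simp: generic_bvw_gens_def bvw_gens_def)
  then show ?thesis
  proof cases
    case (1 i)
    then show ?thesis by (simp add: app_tscal app_swp)
  next
    case (2 i)
    have "pairing (munit a b) = cmat (form_matrix G) $ a $ b" for a b :: 'i
      by (simp add: pairing_def trace_transpose_mult munit_nth if_distrib[of "\<lambda>x. y * x" for y] sum_if_const cong: if_cong)
    then have P: "trivial_projection (lie_algebra G) (\<chi> c d. if c = a \<and> d = b then 1 else 0) $ c' $ d' =
        cmat (form_matrix G) $ a $ b / ?N * cmat (form_matrix G) $ c' $ d'" for a b c' d' :: 'i
      by (simp add: lie_algebra trivial_projection_lie munit_def[symmetric] mscale_nth)
    have "m0 G * (cmat (form_matrix G) $ a $ b / ?N * c) = ?\<epsilon> * (c * cmat (form_matrix G) $ a $ b)" for a b :: 'i and c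
      by (simp add: m0_card)
    with 2 show ?thesis
      by (simp add: fun_eq_iff app_tscal tscale_def app_contr at_pair_def P scale_sum_right)
  next
    case (3 i)
    define c where "c = 1 / (2 * (?N - 2 * ?\<epsilon>))"
    have "2 * (- e * D) * (1 / (2 * D)) = - e" if "D \<noteq> 0" for e D :: complex
      using that by simp
    moreover have "?N - 2 * ?\<epsilon> \<noteq> 0"
      using card_neq by simp
    moreover have "2 - m0 G = - ?\<epsilon> * (?N - 2 * ?\<epsilon>)"
      using eps_sq by (simp add: m0_card algebra_simps)
    ultimately have c: "2 * (2 - m0 G) * c = - ?\<epsilon>"
      unfolding c_def by metis
    have "(\<Sum>j<i. omega G sc \<rho> B j i f) = tscale sc c (app (\<Sum>j<i. casimir j i) f)"
      using 3 by (simp add: app_omega app_tscal app_sum)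
        (simp add: c_def fun_eq_iff tscale_def sum_fun_apply scale_sum_right)
    then have "tscale sc (2 * (2 - m0 G)) (\<Sum>j<i. omega G sc \<rho> B j i f) =
        tscale sc (- ?\<epsilon>) (app (\<Sum>j<i. casimir j i) f)"
      using c by (simp add: tscale_def)
    with 3 show ?thesis
      by (simp add: jucys_murphy_def app_tscal m0_card)
  next
    case (4 i)
    then show ?thesis by (simp add: app_topr)
  next
    case (5 l)
    then show ?thesis by (simp add: fun_eq_iff app_env_eval set_trace_term)
  qed
qed

lemma generator_relations:
  assumes "(a, b) \<in> bvw_rels k (m0 G) (m1 G) (form_sign G) w"
    and "\<And>l. ring_eval tscal generator (w l) = env_eval (trace_term l)"
  shows "ring_eval tscal generator a = ring_eval tscal generator b"
  using assms xi_facts[OF invariant_form_axioms dim] by (intro bvw_rels_hold) (simp_all add: m0_card)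

lemma generic_action:
  "acts_by (generic_bvw_gens k) (generic_bvw_rels k (m0 G) (m1 G) (form_sign G))
    (tscale sc) (tensors k) (bvw_op G sc \<rho> B trace_term)"
proof (rule acts_byI)
  fix a b assume "(a, b) \<in> generic_bvw_rels k (m0 G) (m1 G) (form_sign G)"
  then consider "(a, b) \<in> bvw_rels k (m0 G) (m1 G) (form_sign G) ww"
    | l g where "a = ww l \<boxdot> Gen g" "b = Gen g \<boxdot> ww l" "g \<in> generic_bvw_gens k"
    by (auto simp: generic_bvw_rels_def)
  then show "a \<in> terms_over (generic_bvw_gens k) \<and> b \<in> terms_over (generic_bvw_gens k) \<and>
      ring_eval tscal generator a = ring_eval tscal generator b"
  proof cases
    case 1
    then show ?thesis
      using bvw_rels_gens[OF 1] generator_relations[OF 1]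
      by (auto simp: terms_over_def generic_bvw_gens_def)
  next
    case 2
    then show ?thesis
      using bvw_elem_W_commute by (auto simp: terms_over_def generic_bvw_gens_def)
  qed
qed (use scalar_hom_axioms app_tscal app_generator app_bvw_elem_tensors[of _ k _ "xi G"] bvw_elem_scal in
    \<open>auto simp: app_generator[symmetric]\<close>)

lemma constant_action:
  assumes "infinitesimal_character (lie_algebra G) sc \<rho> \<eta>"
  shows "acts_by (bvw_gens k) (constant_bvw_rels k (m0 G) (m1 G) (form_sign G) (\<lambda>l. \<eta> (trace_term l)))
    (tscale sc) (tensors k) (bvw_op G sc \<rho> B trace_term)"
proof (rule acts_byI)
  have gens: "g \<in> generic_bvw_gens k" if "g \<in> bvw_gens k" for g
    using that by (simp add: generic_bvw_gens_def)
  fix a b assume ab: "(a, b) \<in> constant_bvw_rels k (m0 G) (m1 G) (form_sign G) (\<lambda>l. \<eta> (trace_term l))"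
  have "tscal (\<eta> (trace_term l)) = env_eval (trace_term l)" for l
    using assms trace_term_in_centre[of l]
    by (intro endo_eqI)
      (simp add: fun_eq_iff app_tscal tscale_def app_env_eval set_trace_term infinitesimal_character_def lie_algebra)
  then have "ring_eval tscal generator a = ring_eval tscal generator b"
    using ab unfolding constant_bvw_rels_def by (intro generator_relations) auto
  then show "a \<in> terms_over (bvw_gens k) \<and> b \<in> terms_over (bvw_gens k) \<and>
      ring_eval tscal generator a = ring_eval tscal generator b"
    using bvw_rels_gens[OF ab[unfolded constant_bvw_rels_def]] by (auto simp: terms_over_def)
qed (use scalar_hom_axioms app_tscal app_generator[of _ k] app_bvw_elem_tensors[of _ k _ "xi G"] bvw_elem_scal[of _ k] in
    \<open>auto simp: app_generator[of _ k, symmetric] generic_bvw_gens_def\<close>)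

lemma K_op_commute:
  assumes a: "a \<in> terms_over (generic_bvw_gens k)" and g: "g \<in> max_compact G" and f: "f \<in> tensors k"
  shows "eval_term (tscale sc) (bvw_op G sc \<rho> B trace_term) a (K_op sc \<sigma> k g f) =
    K_op sc \<sigma> k g (eval_term (tscale sc) (bvw_op G sc \<rho> B trace_term) a f)"
proof -
  note facts = max_compact_facts[OF invariant_form_axioms dim g]
  interpret tensor_rep_group "cmat (form_matrix G) :: 'i cmatrix" "form_sign G" sc \<rho> "\<sigma> g" "cmat g"
  proof (intro tensor_rep_group.intro tensor_rep_group_axioms.intro tensor_rep_axioms)
    show "Vector_Spaces.linear sc sc (\<sigma> g)"
      using module g by (simp add: gK_module_def group_rep_def)
    show "\<sigma> g (\<rho> A x) = \<rho> (cmat g ** A ** star (cmat g)) (\<sigma> g x)" if "A \<in> lie" for A x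
      using module g that facts(4) by (simp add: gK_module_def lie_algebra)
  qed (use facts in simp_all)
  have K: "K_op sc \<sigma> k g f = app (group_op k) f" if "f \<in> tensors k" for f
    using that by (simp add: app_group_op_tensors K_op_def)
  have ev: "eval_term (tscale sc) (bvw_op G sc \<rho> B trace_term) a f = app (ring_eval tscal generator a) f" for f
    using a by (intro eval_term_eq_app app_tscal app_generator) (auto simp: terms_over_def)
  have "group_op k * ring_eval tscal generator a = ring_eval tscal generator a * group_op k"
    using a facts(3)
    by (intro ring_eval_commute group_op_bvw_elem group_op_scal) (auto simp: terms_over_def)
  then have "app (group_op k * ring_eval tscal generator a) f = app (ring_eval tscal generator a * group_op k) f"
    by simp
  then show ?thesis
    using a f by (simp add: ev K app_ring_eval_tensors)
qed

end

theorem theorem3p13: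
  fixes G :: real_form
    and sc :: "complex \<Rightarrow> 'x::ab_group_add \<Rightarrow> 'x"
    and \<rho> :: "'i::{finite,linorder} cmatrix \<Rightarrow> 'x \<Rightarrow> 'x"
    and \<sigma> :: "'i rmatrix \<Rightarrow> 'x \<Rightarrow> 'x"
    and B :: "'i cmatrix set"
    and k :: nat
  assumes "(\<exists>p q n. G = Orth p q \<and> p + q = 2 * n + 1) \<or> (\<exists>n. G = Symp n)"
    and "CARD('i) = form_dim G"
    and "harish_chandra_module G sc \<rho> \<sigma>"
    and "basis_of mscale (lie_algebra G) B"
  shows "\<exists>u. range u \<subseteq> env_centre (lie_algebra G) \<and>
    acts_by (generic_bvw_gens k) (generic_bvw_rels k (m0 G) (m1 G) (form_sign G))
      (tscale sc) (tensors k) (bvw_op G sc \<rho> B u) \<and>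
    (\<forall>\<eta>. infinitesimal_character (lie_algebra G) sc \<rho> \<eta> \<longrightarrow>
      acts_by (bvw_gens k) (constant_bvw_rels k (m0 G) (m1 G) (form_sign G) (\<lambda>l. \<eta> (u l)))
        (tscale sc) (tensors k) (bvw_op G sc \<rho> B u)) \<and>
    (\<forall>a\<in>terms_over (generic_bvw_gens k). \<forall>g\<in>max_compact G. \<forall>f\<in>tensors k.
      eval_term (tscale sc) (bvw_op G sc \<rho> B u) a (K_op sc \<sigma> k g f) =
      K_op sc \<sigma> k g (eval_term (tscale sc) (bvw_op G sc \<rho> B u) a f))"
proof -
  interpret real_form_module G sc \<rho> \<sigma> B
    using assms by unfold_locales (simp_all add: harish_chandra_module_def)
  show ?thesis
    using generic_action constant_action K_op_commute trace_term_in_centre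
    by (intro exI[of _ trace_term]) (auto simp: lie_algebra)
qed

end
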